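(* Let $d_3\ge p_2>p_1\ge 3$ be integers such that $p_1$ and $p_2$ are prime numbers. Then $(p_1,p_2,d_3)\in \operatorname{mdeg}(\operatorname{Tame}(\mathbb{C}^3))$ if and only if $d_3\in p_1\mathbb{N}+p_2\mathbb{N}$, i.e. if and only if $d_3=k_1p_1+k_2p_2$ for some $k_1,k_2\in\mathbb{N}=\{0,1,2,\dots\}$.
   Context: For a polynomial mapping $F=(F_1,\dots,F_n):\mathbb{C}^n\to\mathbb{C}^n$, its multidegree is $\operatorname{mdeg}F=(\deg F_1,\dots,\deg F_n)$. A triangular automorphism of $\mathbb{C}^n$ is a map of the form $(x_1,\dots,x_n)\mapsto (x_1,\,x_2+f_2(x_1),\,\dots,\,x_n+f_n(x_1,\dots,x_{n-1}))$ with polynomials $f_i$. The group $\operatorname{Tame}(\mathbb{C}^n)$ of tame automorphisms is the group generated by the affine linear automorphisms and the triangular automorphisms of $\mathbb{C}^n$. $\operatorname{mdeg}(\operatorname{Tame}(\mathbb{C}^3))$ denotes the set of multidegrees of tame automorphisms of $\mathbb{C}^3$. *)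

theory Defs
  imports Complex_Main "HOL-Computational_Algebra.Primes"
begin

type_synonym c3 = "complex \<times> complex \<times> complex"

definition poly3_le :: "nat \<Rightarrow> (c3 \<Rightarrow> complex) \<Rightarrow> bool" where
  "poly3_le d f \<longleftrightarrow> (\<exists>S c. finite S \<and> (\<forall>(i,j,k)\<in>S. i + j + k \<le> d) \<and>
     f = (\<lambda>(x,y,z). \<Sum>(i,j,k)\<in>S. c (i,j,k) * x ^ i * y ^ j * z ^ k))"

definition poly3 :: "(c3 \<Rightarrow> complex) \<Rightarrow> bool" where
  "poly3 f \<longleftrightarrow> (\<exists>d. poly3_le d f)"

text \<open>Total degree (polynomial functions on C^3 determine their polynomial).\<close>
definition deg3 :: "(c3 \<Rightarrow> complex) \<Rightarrow> nat" where
  "deg3 f = (LEAST d. poly3_le d f)"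

definition mdeg3 :: "(c3 \<Rightarrow> c3) \<Rightarrow> nat \<times> nat \<times> nat" where
  "mdeg3 F = (deg3 (\<lambda>v. fst (F v)), deg3 (\<lambda>v. fst (snd (F v))), deg3 (\<lambda>v. snd (snd (F v))))"

definition affine3 :: "(c3 \<Rightarrow> c3) \<Rightarrow> bool" where
  "affine3 F \<longleftrightarrow> bij F \<and>
    (\<exists>a :: nat \<Rightarrow> nat \<Rightarrow> complex. \<exists>b :: nat \<Rightarrow> complex.
       F = (\<lambda>(x,y,z). (a 0 0 * x + a 0 1 * y + a 0 2 * z + b 0,
                        a 1 0 * x + a 1 1 * y + a 1 2 * z + b 1,
                        a 2 0 * x + a 2 1 * y + a 2 2 * z + b 2)))"

definition triangular3 :: "(c3 \<Rightarrow> c3) \<Rightarrow> bool" where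
  "triangular3 F \<longleftrightarrow>
    (\<exists>f2 f3. poly3 f2 \<and> poly3 f3 \<and>
       (\<forall>x y z y' z'. f2 (x,y,z) = f2 (x,y',z')) \<and>
       (\<forall>x y z z'. f3 (x,y,z) = f3 (x,y,z')) \<and>
       F = (\<lambda>(x,y,z). (x, y + f2 (x,y,z), z + f3 (x,y,z))))"

inductive_set tame3 :: "(c3 \<Rightarrow> c3) set" where
  affine: "affine3 F \<Longrightarrow> F \<in> tame3"
| triangular: "triangular3 F \<Longrightarrow> F \<in> tame3"
| comp: "F \<in> tame3 \<Longrightarrow> G \<in> tame3 \<Longrightarrow> F \<circ> G \<in> tame3"
| inverse: "F \<in> tame3 \<Longrightarrow> inv F \<in> tame3"

end

(*
Give the variables positive real weights that are linearly independent over the rationals and close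
to 1. Then every polynomial has a monomial as its top term, so that two elements whose top terms are
algebraically dependent have commensurable degrees.

Call a triple reducible if it descends to the variables by moves x -> c x + P(y, z) and by
Shestakov-Umirbaev moves, each of which lowers the degree. The heart of the proof is that reducible
triples are closed under all moves x -> c x + P(y, z), also those that raise the degree, so that the
components of every tame automorphism are reducible. This is an induction on the degree in which
competing reductions of one triple are compared. The comparison rests on two estimates for the
degree br y z of dy \<and> dz. First, a polynomial expression in y and z whose top terms cancel, where
deg y = p eta and deg z = q eta with coprime p and q, has degree at least (p q - p - q) eta + br y z:
each operator y d/dy - i kills one top term and costs at most deg y + deg z - br y z. Second, if
x, y, z have constant nonzero Jacobian, the maximum of deg x + br y z, deg y + br x z and
deg z + br x y is attained at least twice.

Because the weights are close to 1, weighted degrees determine total degrees. A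
Shestakov-Umirbaev move needs a component of total degree 2 m next to one of degree s m, or 3 m / 2,
which the primes p1 and p2 exclude. A move x -> c x + P(y, z) puts the degree of one component into
the semigroup generated by the other two, or makes it larger than their Frobenius number; since d3
is the largest degree and p1, p2 are distinct primes, both give d3 = k1 p1 + k2 p2. Conversely, for
such d3 the map (x + z^p1, y + z^p2, z + (x + z^p1)^k1 (y + z^p2)^k2) has the required multidegree.
*)
theory Submission
  imports Defs "HOL-Library.Poly_Mapping" "HOL-Library.Product_Plus" "HOL-Computational_Algebra.Polynomial"
begin

subsection \<open>Polynomials\<close>

text \<open>Degrees may rise and fall along a product of tame generators, so no descent can be read
  off a given factorization; closure under all moves replaces it by a descending one. The critical
  configuration is that y descends over (x, z) while x is moved over (y, z). Coincidences of degrees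
  are removed by detours through smaller triples, and moves without cancelling top terms can then be
  interchanged. If top terms cancel, the gap p q - p - q must be small against a component of the
  triple, which leaves only q = 2 or (p, q) = (2, 3). These are the degrees s delta and 2 delta (s
  odd) from which Shestakov-Umirbaev moves are built: the failing interchange is itself such a move.
  Two proportions of the degrees of (x, y, z), namely 3/2 : 3 : 2 and 4/3 : 3 : 2, survive the two
  estimates. For them the Jacobian of the mixed triple (x', y0, z) supplies a third inequality, and
  the possible reductions of the smaller triple are examined one by one.\<close>

type_synonym expo = "nat \<times> nat \<times> nat"
type_synonym mpol = "expo \<Rightarrow>\<^sub>0 complex"

abbreviation coef :: "mpol \<Rightarrow> expo \<Rightarrow> complex" where
  "coef \<equiv> Poly_Mapping.lookup"

abbreviation supp :: "mpol \<Rightarrow> expo set" where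
  "supp \<equiv> Poly_Mapping.keys"

definition mon :: "expo \<Rightarrow> complex \<Rightarrow> mpol" where
  "mon k c = Poly_Mapping.single k c"

definition cst :: "complex \<Rightarrow> mpol" where
  "cst = mon 0"

lemma cst_0 [simp]: "cst 0 = 0"
  and cst_1 [simp]: "cst 1 = 1"
  by (simp_all add: cst_def mon_def)

lemma cst_add: "cst (a + b) = cst a + cst b"
  and cst_diff: "cst (a - b) = cst a - cst b"
  and cst_uminus: "cst (- a) = - cst a"
  and cst_mult: "cst (a * b) = cst a * cst b"
  by (simp_all add: cst_def mon_def single_add single_diff single_uminus mult_single)

lemma cst_of_nat: "cst (of_nat n) = of_nat n"
  by (simp add: cst_def mon_def)

lemma mon_mult: "mon k c * mon l d = mon (k + l) (c * d)"
  by (simp add: mon_def mult_single)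

lemma mon_0 [simp]: "mon k 0 = 0"
  by (simp add: mon_def)

lemma mon_add: "mon k (c + d) = mon k c + mon k d"
  by (simp add: mon_def single_add)

lemma coef_mon: "coef (mon k c) l = (if k = l then c else 0)"
  by (simp add: mon_def lookup_single when_def)

lemma supp_mon: "supp (mon k c) = (if c = 0 then {} else {k})"
  by (simp add: mon_def)

lemma coef_cst_mult: "coef (cst c * p) k = c * coef p k"
proof -
  have "cst c * p = Poly_Mapping.map ((*) c) p"
    by (simp add: cst_def mon_def mult_map_scale_conv_mult)
  then show ?thesis
    by (simp add: Poly_Mapping.map.rep_eq when_def)
qed

lemma cst_cancel [simp]: "c \<noteq> 0 \<Longrightarrow> cst (inverse c) * (cst c * p) = p"
  "c \<noteq> 0 \<Longrightarrow> cst c * (cst (inverse c) * p) = p"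
  by (simp_all add: mult.assoc [symmetric] cst_mult [symmetric])

lemma mpol_split:
  assumes "p \<noteq> 0" "k \<in> supp p"
  shows "k \<notin> supp (p - mon k (coef p k))" "supp (p - mon k (coef p k)) \<subseteq> supp p"
    "p = mon k (coef p k) + (p - mon k (coef p k))"
  using assms by (auto simp: in_keys_iff lookup_minus coef_mon split: if_splits)

lemma mpol_induct [case_names zero add]:
  assumes "P 0"
    and "\<And>k c p. c \<noteq> 0 \<Longrightarrow> k \<notin> supp p \<Longrightarrow> P p \<Longrightarrow> P (mon k c + p)"
  shows "P p"
proof (induction "card (supp p)" arbitrary: p rule: less_induct)
  case less
  show ?case
  proof (cases "p = 0")
    case True
    then show ?thesis using assms(1) by simp
  next
    case False
    then obtain k where k: "k \<in> supp p"
      by (metis all_not_in_conv keys_eq_empty)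
    let ?q = "p - mon k (coef p k)"
    note s = mpol_split [OF False k]
    have "supp ?q \<subset> supp p" using s k by blast
    then have "card (supp ?q) < card (supp p)" by (simp add: psubset_card_mono)
    then have "P ?q" using less by blast
    moreover have "coef p k \<noteq> 0" using k by (simp add: in_keys_iff)
    ultimately have "P (mon k (coef p k) + ?q)"
      using assms(2) s(1) by blast
    then show ?thesis using s(3) by simp
  qed
qed

subsection \<open>Derivations\<close>

text \<open>Diagonal in the monomial basis: an additive \<open>l\<close> gives a derivation that
  keeps every monomial and only rescales it, so neither support nor degree can grow.\<close>

definition der :: "(expo \<Rightarrow> complex) \<Rightarrow> mpol \<Rightarrow> mpol" where
  "der l p = Poly_Mapping.mapp (\<lambda>k c. l k * c) p"

lemma coef_der: "coef (der l p) k = l k * coef p k"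
  by (simp add: der_def lookup_mapp when_def in_keys_iff)

lemma der_mon: "der l (mon k c) = mon k (l k * c)"
  by (intro poly_mapping_eqI) (simp add: coef_der coef_mon)

lemma der_add: "der l (p + q) = der l p + der l q"
  and der_diff: "der l (p - q) = der l p - der l q"
  and der_0 [simp]: "der l 0 = 0"
  by (intro poly_mapping_eqI; simp add: coef_der lookup_add lookup_minus algebra_simps)+

lemma supp_der: "supp (der l p) \<subseteq> supp p"
  by (auto simp: in_keys_iff coef_der)

locale derivation =
  fixes l :: "expo \<Rightarrow> complex"
  assumes l_add: "l (a + b) = l a + l b"
begin

lemma l_0: "l 0 = 0"
  using l_add[of 0 0] by simp

lemma der_mult: "der l (p * q) = der l p * q + p * der l q"
proof (induction p rule: mpol_induct)
  case zero
  show ?case by simp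
next
  case (add k c p)
  have "der l (mon k c * q) = der l (mon k c) * q + mon k c * der l q"
  proof (induction q rule: mpol_induct)
    case zero
    show ?case by simp
  next
    case (add k c p)
    then show ?case
      by (simp add: algebra_simps der_add mon_mult der_mon l_add flip: mon_add)
  qed
  with add show ?case by (simp add: algebra_simps der_add)
qed

lemma der_cst [simp]: "der l (cst c) = 0"
  by (simp add: cst_def der_mon l_0)

lemma der_cst_mult: "der l (cst c * p) = cst c * der l p"
  by (simp add: der_mult)

end

definition exponent :: "nat \<Rightarrow> expo \<Rightarrow> complex" where
  "exponent i k = of_nat (if i = 0 then fst k else if i = 1 then fst (snd k) else snd (snd k))"

lemma exponent_zero [simp]: "exponent i 0 = 0"
  by (simp add: exponent_def zero_prod_def)

abbreviation D :: "nat \<Rightarrow> mpol \<Rightarrow> mpol" where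
  "D i \<equiv> der (exponent i)"

interpretation exponent: derivation "exponent i" for i
  by unfold_locales (auto simp: exponent_def)

subsection \<open>Weighted degree\<close>

text \<open>\<open>wt_inj\<close> expresses the rational independence of the weights of the
  variables; \<open>wt_finite\<close> makes the set of degrees discrete, as induction on degrees
  requires.\<close>

locale weight =
  fixes wt :: "expo \<Rightarrow> real"
  assumes wt_add: "wt (a + b) = wt a + wt b"
    and wt_inj: "inj wt"
    and wt_pos: "a \<noteq> 0 \<Longrightarrow> 0 < wt a"
    and wt_finite: "finite {a. wt a \<le> r}"
begin

lemma wt_0 [simp]: "wt 0 = 0"
  using wt_add[of 0 0] by simp

lemma wt_ge_0: "0 \<le> wt a"
  using wt_pos[of a] by (cases "a = 0") auto

text \<open>The zero polynomial gets the junk degree -1, smaller than every genuine degree.\<close>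
definition dg :: "mpol \<Rightarrow> real" where
  "dg p = (if p = 0 then -1 else Max (wt ` supp p))"

lemma dg_0 [simp]: "dg 0 = -1"
  by (simp add: dg_def)

lemma supp_nonempty: "p \<noteq> 0 \<Longrightarrow> supp p \<noteq> {}"
  by simp

lemma dg_ge: "k \<in> supp p \<Longrightarrow> wt k \<le> dg p"
  by (auto simp: dg_def)

lemma dg_top:
  assumes "p \<noteq> 0"
  obtains k where "k \<in> supp p" "dg p = wt k"
proof -
  have "Max (wt ` supp p) \<in> wt ` supp p"
    using assms by (intro Max_in) auto
  then obtain k where "k \<in> supp p" "Max (wt ` supp p) = wt k" by blast
  then show ?thesis using that assms by (simp add: dg_def)
qed

lemma dg_nonneg: "p \<noteq> 0 \<Longrightarrow> 0 \<le> dg p"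
  by (metis dg_top wt_ge_0)

lemma dg_ge_m1: "-1 \<le> dg p"
  using dg_nonneg[of p] by (cases "p = 0") auto

lemma dg_le_iff: "p \<noteq> 0 \<Longrightarrow> dg p \<le> r \<longleftrightarrow> (\<forall>k\<in>supp p. wt k \<le> r)"
  by (auto simp: dg_def)

lemma dg_leI: "-1 \<le> r \<Longrightarrow> (\<And>k. k \<in> supp p \<Longrightarrow> wt k \<le> r) \<Longrightarrow> dg p \<le> r"
  by (cases "p = 0") (auto simp: dg_le_iff)

lemma dg_lessI: "-1 < r \<Longrightarrow> (\<And>k. k \<in> supp p \<Longrightarrow> wt k < r) \<Longrightarrow> dg p < r"
  by (cases "p = 0") (auto simp: dg_def)

lemma dg_mon: "c \<noteq> 0 \<Longrightarrow> dg (mon k c) = wt k"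
  by (auto simp: dg_def supp_mon dest: arg_cong[where f = supp])

lemma dg_cst: "dg (cst c) \<le> 0"
  by (cases "c = 0") (auto simp: cst_def dg_mon)

lemma dg_add: "dg (p + q) \<le> max (dg p) (dg q)"
proof (rule dg_leI)
  show "-1 \<le> max (dg p) (dg q)" using dg_ge_m1[of p] by simp
next
  fix k assume "k \<in> supp (p + q)"
  then have "k \<in> supp p \<or> k \<in> supp q" using keys_add[of p q] by blast
  then show "wt k \<le> max (dg p) (dg q)"
    by (auto dest: dg_ge)
qed

lemma dg_uminus [simp]: "dg (- p) = dg p"
  by (simp add: dg_def)

lemma dg_diff: "dg (p - q) \<le> max (dg p) (dg q)"
  using dg_add[of p "- q"] by simp

lemma dg_add_eq: "dg p < dg q \<Longrightarrow> dg (p + q) = dg q"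
  using dg_add[of p q] dg_diff[of "p + q" p] by (auto simp: max_def split: if_splits)

lemma dg_add_eq2: "dg q < dg p \<Longrightarrow> dg (p + q) = dg p"
  using dg_add_eq[of q p] by (simp add: add.commute)

lemma dg_diff_eq: "dg q < dg p \<Longrightarrow> dg (p - q) = dg p"
  using dg_add_eq2[of "- q" p] by simp

lemma dg_sum_le: "-1 \<le> r \<Longrightarrow> (\<And>i. i \<in> I \<Longrightarrow> dg (f i) \<le> r) \<Longrightarrow> dg (sum f I) \<le> r"
proof (induction I rule: infinite_finite_induct)
  case (insert i I)
  then show ?case using dg_add[of "f i" "sum f I"] by fastforce
qed auto

lemma dg_cst_mult [simp]: "c \<noteq> 0 \<Longrightarrow> dg (cst c * p) = dg p"
proof -
  assume c: "c \<noteq> 0"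
  have "supp (cst c * p) = supp p" using c by (auto simp: in_keys_iff coef_cst_mult)
  moreover have "cst c * p = 0 \<longleftrightarrow> p = 0" using c
    by (metis calculation keys_eq_empty)
  ultimately show ?thesis by (simp add: dg_def)
qed

lemma dg_cst_mult_le: "dg (cst c * p) \<le> dg p"
  using dg_ge_m1[of p] by (cases "c = 0") auto

text \<open>By injectivity of \<open>wt\<close> each factor has a single heaviest monomial, and no
  other pair of monomials can reach the product of the two.\<close>

lemma dg_mult:
  assumes "p \<noteq> 0" "q \<noteq> 0"
  shows mult_nonzero: "p * q \<noteq> 0" and "dg (p * q) = dg p + dg q"
proof -
  obtain a where a: "a \<in> supp p" "dg p = wt a" by (rule dg_top [OF assms(1)])
  obtain b where b: "b \<in> supp q" "dg q = wt b" by (rule dg_top [OF assms(2)])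
  have sub: "supp (p * q) \<subseteq> {k + l |k l. k \<in> supp p \<and> l \<in> supp q}"
    by (rule keys_mult)
  have le: "wt k \<le> wt a + wt b" if k: "k \<in> supp (p * q)" for k
  proof -
    obtain i j where "k = i + j" "i \<in> supp p" "j \<in> supp q" using k sub by blast
    then show ?thesis using dg_ge[of i p] dg_ge[of j q] a b by (simp add: wt_add)
  qed
  define p' where "p' = p - mon a (coef p a)"
  define q' where "q' = q - mon b (coef q b)"
  note sp = mpol_split [OF assms(1) a(1), folded p'_def]
  note sq = mpol_split [OF assms(2) b(1), folded q'_def]
  have lt: "wt k < wt a" if "k \<in> supp p'" for k
  proof -
    have "k \<noteq> a" "wt k \<le> wt a" using that sp dg_ge[of k p] a by auto
    then show ?thesis using wt_inj by (metis injD order_le_less)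
  qed
  have lt2: "wt k < wt b" if "k \<in> supp q'" for k
  proof -
    have "k \<noteq> b" "wt k \<le> wt b" using that sq dg_ge[of k q] b by auto
    then show ?thesis using wt_inj by (metis injD order_le_less)
  qed
  have 1: "a + b \<notin> supp (p' * q)"
  proof
    assume "a + b \<in> supp (p' * q)"
    then obtain k l where "a + b = k + l" "k \<in> supp p'" "l \<in> supp q"
      using keys_mult[of p' q] by blast
    then have "wt a + wt b = wt k + wt l" "wt k < wt a" "wt l \<le> wt b"
      using lt[of k] dg_ge[of l q] b wt_add by (auto simp: wt_add [symmetric])
    then show False by simp
  qed
  have 2: "a + b \<notin> supp (mon a (coef p a) * q')"
  proof
    assume "a + b \<in> supp (mon a (coef p a) * q')"
    moreover have "supp (mon a (coef p a)) \<subseteq> {a}" by (simp add: supp_mon)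
    ultimately obtain l where "a + b = a + l" "l \<in> supp q'"
      using keys_mult[of "mon a (coef p a)" q'] by blast
    then have "wt a + wt b = wt a + wt l" "wt l < wt b"
      using lt2[of l] by (auto simp: wt_add [symmetric])
    then show False by simp
  qed
  \<comment> \<open>The first summand is the product of the two top terms; the exponent
    \<open>a + b\<close> was just shown to be absent from the other two.\<close>
  have "p * q = mon (a + b) (coef p a * coef q b) + mon a (coef p a) * q' + p' * q"
    by (subst sp(3), subst sq(3)) (simp add: algebra_simps mon_mult p'_def q'_def)
  then have "coef (p * q) (a + b) = coef p a * coef q b"
    using 1 2 by (simp add: lookup_add coef_mon in_keys_iff)
  then have mem: "a + b \<in> supp (p * q)" using a b by (simp add: in_keys_iff)
  then show nz: "p * q \<noteq> 0" by auto
  show "dg (p * q) = dg p + dg q"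
    using dg_ge[OF mem] nz le a b by (intro antisym) (auto simp: dg_le_iff wt_add)
qed

lemma mult_eq_0: "p * q = 0 \<longleftrightarrow> p = 0 \<or> q = (0::mpol)"
  using mult_nonzero by fastforce

lemma dg_power: "p \<noteq> 0 \<Longrightarrow> p ^ n \<noteq> 0 \<and> dg (p ^ n) = of_nat n * dg p"
proof (induction n)
  case 0
  have "dg 1 = 0" using dg_mon[of 1 0] by (simp flip: cst_def)
  then show ?case by simp
next
  case (Suc n)
  then show ?case using dg_mult[of p "p ^ n"] by (auto simp: algebra_simps)
qed

text \<open>Equal degree means equal top exponent, again by injectivity, so a scalar suffices. Total
  degree would not allow this.\<close>

lemma cancel_top:
  assumes "dg p = dg q" "p \<noteq> 0"
  obtains c where "c \<noteq> 0" "dg (p - cst c * q) < dg p"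
proof -
  have q: "q \<noteq> 0" using assms dg_nonneg[of p] by auto
  obtain a where a: "a \<in> supp p" "dg p = wt a" by (rule dg_top [OF assms(2)])
  obtain b where b: "b \<in> supp q" "dg q = wt b" by (rule dg_top [OF q])
  have [simp]: "b = a" using assms a b wt_inj by (metis injD)
  define c where "c = coef p a / coef q a"
  have c: "c \<noteq> 0" using a b by (simp add: c_def in_keys_iff)
  have "dg (p - cst c * q) < dg p"
  proof (rule dg_lessI)
    show "-1 < dg p" using dg_nonneg [OF assms(2)] by simp
    fix k assume k: "k \<in> supp (p - cst c * q)"
    have "k \<noteq> a" using k b by (auto simp: in_keys_iff lookup_minus coef_cst_mult c_def)
    moreover have "k \<in> supp p \<or> k \<in> supp q"
      using k by (auto simp: in_keys_iff lookup_minus coef_cst_mult)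
    then have "wt k \<le> dg p" using dg_ge assms by metis
    ultimately show "wt k < dg p" using a wt_inj by (metis injD order_le_less)
  qed
  then show ?thesis using that c by blast
qed

lemma dg_der_le: "dg (der l p) \<le> dg p"
  by (rule dg_leI [OF dg_ge_m1]) (use supp_der dg_ge in blast)

definition euler :: "mpol \<Rightarrow> mpol" where
  "euler = der (\<lambda>k. of_real (wt k))"

text \<open>The Euler derivation multiplies each monomial by its weight, and the weight of the top
  monomial is nonzero here.\<close>

lemma dg_euler:
  assumes "0 < dg p"
  shows "dg (euler p) = dg p"
proof -
  have "p \<noteq> 0" using assms by auto
  then obtain a where a: "a \<in> supp p" "dg p = wt a" by (rule dg_top)
  have "a \<in> supp (euler p)"
    using a assms by (simp add: euler_def in_keys_iff coef_der)
  then have "dg p \<le> dg (euler p)" using dg_ge a by metis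
  then show ?thesis using dg_der_le unfolding euler_def by (metis antisym)
qed

definition wt_var :: "nat \<Rightarrow> real" where
  "wt_var i = (if i = 0 then wt (1,0,0) else if i = 1 then wt (0,1,0) else wt (0,0,1))"

lemma wt_scale: "wt (n * a, n * b, n * c) = of_nat n * wt (a, b, c)"
proof (induction n)
  case 0
  then show ?case using wt_0 by (simp add: zero_prod_def)
next
  case (Suc n)
  have "(Suc n * a, Suc n * b, Suc n * c) = (a,b,c) + (n * a, n * b, n * c)" by simp
  then show ?case by (simp only: wt_add Suc) (simp add: algebra_simps)
qed

lemma wt_w: "wt (a, b, c) = a * wt_var 0 + b * wt_var 1 + c * wt_var 2"
proof -
  have "(a, b, c) = (a * 1, a * 0, a * 0) + ((b * 0, b * 1, b * 0) + (c * 0, c * 0, c * 1))" by simp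
  then show ?thesis by (simp only: wt_add wt_scale) (simp add: wt_var_def)
qed

lemma euler_D: "euler p = cst (wt_var 0) * D 0 p + cst (wt_var 1) * D 1 p + cst (wt_var 2) * D 2 p"
proof (rule poly_mapping_eqI)
  fix k :: expo
  obtain a b c where k: "k = (a, b, c)" by (cases k) auto
  show "coef (euler p) k = coef (cst (wt_var 0) * D 0 p + cst (wt_var 1) * D 1 p + cst (wt_var 2) * D 2 p) k"
    by (simp only: euler_def coef_der lookup_add coef_cst_mult k wt_w) (simp add: exponent_def algebra_simps)
qed

end

subsection \<open>Differential forms\<close>

text \<open>The derivations \<^term>\<open>D i\<close> are $x_i \partial/\partial x_i$, so the triple below holds the
coefficients of $df \wedge dg$ with respect to the logarithmic forms $dx_i/x_i \wedge dx_j/x_j$.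
This makes the degree of a form the maximum of the degrees of its coefficients.\<close>

type_synonym form = "mpol \<times> mpol \<times> mpol"

definition wedge :: "mpol \<Rightarrow> mpol \<Rightarrow> form" where
  "wedge f g = (D 0 f * D 1 g - D 1 f * D 0 g, D 0 f * D 2 g - D 2 f * D 0 g, D 1 f * D 2 g - D 2 f * D 1 g)"

definition scale_form :: "mpol \<Rightarrow> form \<Rightarrow> form" where
  "scale_form h o' = (h * fst o', h * fst (snd o'), h * snd (snd o'))"

text \<open>The coefficient of \<open>df\<close> wedge \<open>o'\<close> against the logarithmic
  volume form; the minus sign comes from reordering the basis forms.\<close>

definition wedge_form :: "mpol \<Rightarrow> form \<Rightarrow> mpol" where
  "wedge_form f o' = D 0 f * snd (snd o') - D 1 f * fst (snd o') + D 2 f * fst o'"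

definition jac :: "mpol \<Rightarrow> mpol \<Rightarrow> mpol \<Rightarrow> mpol" where
  "jac x y z = wedge_form x (wedge y z)"

lemma wedge_add: "wedge (f + f') g = wedge f g + wedge f' g" "wedge g (f + f') = wedge g f + wedge g f'"
  and wedge_diff: "wedge (f - f') g = wedge f g - wedge f' g" "wedge g (f - f') = wedge g f - wedge g f'"
  and wedge_self: "wedge f f = 0"
  and wedge_swap: "wedge g f = - wedge f g"
  and wedge_cst [simp]: "wedge (cst c) g = 0" "wedge g (cst c) = 0"
  by (auto simp: wedge_def scale_form_def der_add der_diff exponent.der_cst_mult zero_prod_def algebra_simps)

lemma wedge_cst_mult: "wedge (cst c * f) g = scale_form (cst c) (wedge f g)" "wedge g (cst c * f) = scale_form (cst c) (wedge g f)"
  unfolding wedge_def scale_form_def exponent.der_cst_mult by (simp_all add: algebra_simps)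

lemma wedge_0 [simp]: "wedge 0 g = 0" "wedge g 0 = 0"
  using wedge_cst(1)[of 0 g] wedge_cst(2)[of g 0] by simp_all

text \<open>The hypothesis reads dp = h dy + h' dz. Partial derivatives of polynomial expressions
  enter all later arguments only as such coefficients.\<close>

lemma wedge_chain:
  assumes "\<And>i. D i p = h * D i y + h' * D i z"
  shows "wedge p u = scale_form h (wedge y u) + scale_form h' (wedge z u)"
  by (auto simp: wedge_def scale_form_def assms algebra_simps)

lemma scale_form_0 [simp]: "scale_form 0 o' = 0" "scale_form h 0 = 0"
  by (auto simp: scale_form_def zero_prod_def)

lemma wedge_form_scale_form: "wedge_form f (scale_form h o1) = h * wedge_form f o1"
  by (auto simp: wedge_form_def scale_form_def algebra_simps)

lemma wedge_form_0 [simp]: "wedge_form f 0 = 0"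
  by (simp add: wedge_form_def)

lemma jac_swap: "jac y x z = - jac x y z" "jac x z y = - jac x y z"
  and jac_rot: "jac y z x = jac x y z"
  and jac_diff: "jac (x - x') y z = jac x y z - jac x' y z"
  and jac_add: "jac (x + x') y z = jac x y z + jac x' y z"
  by (simp_all add: jac_def wedge_form_def wedge_def der_add der_diff exponent.der_cst_mult algebra_simps)

lemma jac_cst_mult: "jac (cst c * x) y z = cst c * jac x y z"
  unfolding jac_def wedge_form_def exponent.der_cst_mult by (simp add: algebra_simps)

lemma jac_chain:
  assumes "\<And>i. D i p = h * D i y + h' * D i z"
  shows "jac p u v = h * jac y u v + h' * jac z u v"
  by (simp add: jac_def wedge_form_def assms algebra_simps)

lemma jac_same [simp]: "jac x x y = 0" "jac x y x = 0" "jac y x x = 0"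
  by (simp_all add: jac_def wedge_form_def wedge_def algebra_simps)

context weight
begin

lemma dg_der_pos:
  assumes "D i p \<noteq> 0"
  shows "0 < dg p"
proof -
  obtain k where k: "k \<in> supp (D i p)" using supp_nonempty [OF assms] by blast
  then have "k \<noteq> 0" by (auto simp: in_keys_iff coef_der)
  moreover have "wt k \<le> dg p" using k supp_der dg_ge by blast
  ultimately show ?thesis using wt_pos[of k] by linarith
qed

lemma D_eq_0: "dg p \<le> 0 \<Longrightarrow> D i p = 0"
  using dg_der_pos by force

definition fdg :: "form \<Rightarrow> real" where
  "fdg o' = max (dg (fst o')) (max (dg (fst (snd o'))) (dg (snd (snd o'))))"

abbreviation br :: "mpol \<Rightarrow> mpol \<Rightarrow> real" where
  "br f g \<equiv> fdg (wedge f g)"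

lemma fdg_0 [simp]: "fdg 0 = -1"
  by (simp add: fdg_def)

lemma fdg_nonneg: "o' \<noteq> 0 \<Longrightarrow> 0 \<le> fdg o'"
  using dg_nonneg by (cases o') (auto simp: fdg_def zero_prod_def le_max_iff_disj)

lemma fdg_uminus [simp]: "fdg (- o') = fdg o'"
  by (simp add: fdg_def)

lemma fdg_add: "fdg (o1 + o2) \<le> max (fdg o1) (fdg o2)"
  using dg_add[of "fst o1" "fst o2"] dg_add[of "fst (snd o1)" "fst (snd o2)"]
    dg_add[of "snd (snd o1)" "snd (snd o2)"]
  unfolding fdg_def by (intro max.boundedI; simp; linarith)

lemma fdg_diff: "fdg (o1 - o2) \<le> max (fdg o1) (fdg o2)"
  using fdg_add[of o1 "- o2"] by simp

lemma fdg_add_eq: "fdg o1 < fdg o2 \<Longrightarrow> fdg (o1 + o2) = fdg o2"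
  using fdg_add[of o1 o2] fdg_diff[of "o1 + o2" o1] by (auto simp: max_def split: if_splits)

lemma fdg_add_eq2: "fdg o2 < fdg o1 \<Longrightarrow> fdg (o1 + o2) = fdg o1"
  using fdg_add_eq[of o2 o1] by (simp add: add.commute)

lemma fdg_diff_eq: "fdg o2 < fdg o1 \<Longrightarrow> fdg (o1 - o2) = fdg o1"
  using fdg_add_eq2[of "- o2" o1] by simp

lemma fdg_diff_eq2: "fdg o1 < fdg o2 \<Longrightarrow> fdg (o1 - o2) = fdg o2"
  using fdg_add_eq[of o1 "- o2"] by simp

lemma fdg_scale_form:
  assumes "h \<noteq> 0" "o' \<noteq> 0"
  shows "fdg (scale_form h o') = dg h + fdg o'"
proof -
  have a: "dg (h * p) = (if p = 0 then -1 else dg h + dg p)" for p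
    using dg_mult[OF assms(1)] by simp
  obtain p q r where o': "o' = (p, q, r)" by (cases o') auto
  have "p \<noteq> 0 \<or> q \<noteq> 0 \<or> r \<noteq> 0" using assms(2) o' by (auto simp: zero_prod_def)
  then show ?thesis
    using dg_nonneg [OF assms(1)] dg_nonneg[of p] dg_nonneg[of q] dg_nonneg[of r]
    by (auto simp: o' scale_form_def fdg_def a)
qed

lemma scale_form_eq_0: "scale_form h o' = 0 \<longleftrightarrow> h = 0 \<or> o' = 0"
  by (cases o') (auto simp: scale_form_def zero_prod_def mult_eq_0)

lemma br_swap: "br g f = br f g"
  by (subst wedge_swap) simp

lemma br_le:
  assumes "wedge f g \<noteq> 0"
  shows "br f g \<le> dg f + dg g"
proof -
  have nz: "f \<noteq> 0" "g \<noteq> 0" using assms by auto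
  have a: "dg (D i f * D j g - D j f * D i g) \<le> dg f + dg g" for i j
  proof -
    have *: "dg (D i f * D j g) \<le> dg f + dg g" for i j
      using dg_mult[of "D i f" "D j g"] dg_der_le[of "exponent i" f] dg_der_le[of "exponent j" g]
        dg_nonneg [OF nz(1)] dg_nonneg [OF nz(2)]
      by (cases "D i f = 0 \<or> D j g = 0") auto
    show ?thesis using dg_diff[of "D i f * D j g" "D j f * D i g"] *[of i j] *[of j i] by linarith
  qed
  show ?thesis using a by (simp add: fdg_def wedge_def)
qed

text \<open>Logarithmic derivatives kill constants, so every monomial of a coefficient of the form
  splits into two nonconstant ones. Beyond positivity, this yields the bound 2 on the total-degree
  scale.\<close>

lemma br_lower:
  assumes "wedge f g \<noteq> 0"
  obtains k l where "k \<noteq> 0" "l \<noteq> 0" "wt k + wt l \<le> br f g"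
proof -
  have k0: "k \<noteq> 0" if "k \<in> supp (D i p)" for k i p
    using that by (auto simp: in_keys_iff coef_der)
  have prod: "\<exists>k l. k \<noteq> 0 \<and> l \<noteq> 0 \<and> m = k + l" if "m \<in> supp (D i f * D j g)" for m i j
    using that keys_mult[of "D i f" "D j g"] k0 by blast
  have *: "\<exists>k l. k \<noteq> 0 \<and> l \<noteq> 0 \<and> wt k + wt l \<le> dg (D i f * D j g - D j f * D i g)"
    if nz: "D i f * D j g - D j f * D i g \<noteq> 0" for i j
  proof -
    obtain m where m: "m \<in> supp (D i f * D j g - D j f * D i g)" using supp_nonempty [OF nz] by blast
    then have "m \<in> supp (D i f * D j g) \<or> m \<in> supp (D j f * D i g)"
      by (auto simp: in_keys_iff lookup_minus)
    then obtain k l where "k \<noteq> 0" "l \<noteq> 0" "m = k + l" using prod by blast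
    then show ?thesis using dg_ge [OF m] wt_add by metis
  qed
  have "D 0 f * D 1 g - D 1 f * D 0 g \<noteq> 0 \<or> D 0 f * D 2 g - D 2 f * D 0 g \<noteq> 0
     \<or> D 1 f * D 2 g - D 2 f * D 1 g \<noteq> 0"
    using assms by (auto simp: wedge_def zero_prod_def)
  then show ?thesis
    using that *[of 0 1] *[of 0 2] *[of 1 2] by (fastforce simp: fdg_def wedge_def le_max_iff_disj)
qed

lemma br_pos: "wedge f g \<noteq> 0 \<Longrightarrow> 0 < br f g"
  by (erule br_lower) (smt (verit) wt_pos)

lemma br_chain:
  assumes "\<And>i. D i p = h * D i y + h' * D i z" "h \<noteq> 0" "wedge y z \<noteq> 0"
  shows "wedge p z \<noteq> 0" "br p z = dg h + br y z"
proof -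
  have "wedge p z = scale_form h (wedge y z)" using wedge_chain[OF assms(1), of z] by (simp add: wedge_self)
  then show "wedge p z \<noteq> 0" "br p z = dg h + br y z" using assms by (auto simp: scale_form_eq_0 fdg_scale_form)
qed

definition sig :: real where "sig = wt (1, 1, 1)"

text \<open>With x_i d/dx_i in place of d/dx_i, \<open>jac\<close> is the ordinary Jacobian
  determinant times the product of the variables, whose degree is \<open>sig\<close>. Degree
  \<open>sig\<close> thus says that the determinant is a nonzero constant.\<close>

definition keller :: "mpol \<Rightarrow> mpol \<Rightarrow> mpol \<Rightarrow> bool" where
  "keller x y z \<longleftrightarrow> dg (jac x y z) = sig"

lemma sig_pos: "0 < sig"
  unfolding sig_def by (rule wt_pos) (simp add: zero_prod_def)

lemma keller_jac: "keller x y z \<Longrightarrow> jac x y z \<noteq> 0"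
  using sig_pos by (auto simp: keller_def)

lemma keller_perm: "keller x y z \<Longrightarrow> keller y x z" "keller x y z \<Longrightarrow> keller x z y"
  "keller x y z \<Longrightarrow> keller y z x" "keller x y z \<Longrightarrow> keller z x y" "keller x y z \<Longrightarrow> keller z y x"
  by (simp_all add: keller_def jac_swap(1)[of y x z] jac_swap(2)[of x z y] jac_rot[of y z x] jac_rot[of x y z, symmetric] )
    (metis jac_rot jac_swap dg_uminus)+

lemma keller_wedge: "keller x y z \<Longrightarrow> wedge y z \<noteq> 0" "keller x y z \<Longrightarrow> wedge x z \<noteq> 0" "keller x y z \<Longrightarrow> wedge x y \<noteq> 0"
proof -
  have *: "wedge y z \<noteq> 0" if "keller x y z" for x y z using keller_jac [OF that] by (auto simp: jac_def)
  show "keller x y z \<Longrightarrow> wedge y z \<noteq> 0" "keller x y z \<Longrightarrow> wedge x z \<noteq> 0" "keller x y z \<Longrightarrow> wedge x y \<noteq> 0"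
    using *[of x y z] *[of y x z] *[of z x y] keller_perm by blast+
qed

lemma wedge_dg_pos: "wedge f g \<noteq> 0 \<Longrightarrow> 0 < dg f" "wedge f g \<noteq> 0 \<Longrightarrow> 0 < dg g"
proof -
  have *: "0 < dg f" if "wedge f g \<noteq> 0" for f g
  proof (rule ccontr)
    assume "\<not> 0 < dg f"
    then have "D i f = 0" for i using D_eq_0[of f i] by simp
    then show False using that by (simp add: wedge_def zero_prod_def)
  qed
  show "wedge f g \<noteq> 0 \<Longrightarrow> 0 < dg f" "wedge f g \<noteq> 0 \<Longrightarrow> 0 < dg g"
    using wedge_swap[of g f] *[of f g] *[of g f] by auto
qed

lemma keller_dg_pos: "keller x y z \<Longrightarrow> 0 < dg x" "keller x y z \<Longrightarrow> 0 < dg y" "keller x y z \<Longrightarrow> 0 < dg z"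
  using keller_wedge wedge_dg_pos by blast+

lemma wedge_form_le:
  assumes "wedge_form f o' \<noteq> 0"
  shows "dg (wedge_form f o') \<le> dg f + fdg o'"
proof -
  have nz: "f \<noteq> 0" "o' \<noteq> 0" using assms by (auto simp: wedge_form_def)
  have a: "dg (D i f * p) \<le> dg f + fdg o'" if "p \<in> {fst o', fst (snd o'), snd (snd o')}" for i p
    using dg_mult[of "D i f" p] dg_der_le[of "exponent i" f] that dg_nonneg [OF nz(1)] fdg_nonneg [OF nz(2)]
    by (cases "D i f = 0 \<or> p = 0") (auto simp: fdg_def)
  show ?thesis unfolding wedge_form_def
    by (intro order_trans [OF dg_add] order_trans [OF dg_diff] max.boundedI a) auto
qed

lemma keller_sig: "keller x y z \<Longrightarrow> sig \<le> dg x + br y z"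
  using wedge_form_le[of x "wedge y z"] keller_jac[of x y z] by (simp add: keller_def jac_def)

text \<open>Interior product of dx wedge dy wedge dz with the Euler field, computed once by the
  Leibniz rule and once as \<open>jac\<close> times the contracted volume form.\<close>

lemma euler_form:
  "scale_form (euler x) (wedge y z) - scale_form (euler y) (wedge x z) + scale_form (euler z) (wedge x y)
     = scale_form (jac x y z) (cst (wt_var 2), - cst (wt_var 1), cst (wt_var 0))"
  unfolding euler_D scale_form_def wedge_def jac_def wedge_form_def by (simp add: algebra_simps)

text \<open>Contracting $dx\wedge dy\wedge dz$ with the Euler field gives a form of minimal degree, so the
three terms of the contraction cannot have a unique one of maximal degree.\<close>
lemma two_max:
  assumes "keller x y z" "dg x + br y z < dg y + br x z"
  shows "dg z + br x y = dg y + br x z"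
proof -
  have pos: "0 < dg x" "0 < dg y" "0 < dg z" using keller_dg_pos [OF assms(1)] by auto
  have wedge: "wedge y z \<noteq> 0" "wedge x z \<noteq> 0" "wedge x y \<noteq> 0" using keller_wedge [OF assms(1)] by auto
  have e: "fdg (scale_form (euler p) o') = dg p + fdg o'" if "0 < dg p" "o' \<noteq> 0" for p o'
    using that dg_euler[of p] fdg_scale_form[of "euler p" o'] by force
  let ?a = "scale_form (euler x) (wedge y z)" and ?b = "scale_form (euler y) (wedge x z)" and ?c = "scale_form (euler z) (wedge x y)"
  let ?o = "scale_form (jac x y z) (cst (wt_var 2), - cst (wt_var 1), cst (wt_var 0))"
  have f: "fdg ?a = dg x + br y z" "fdg ?b = dg y + br x z" "fdg ?c = dg z + br x y"
    using e pos wedge by simp_all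
  have "fdg (cst (wt_var 2), - cst (wt_var 1), cst (wt_var 0)) \<le> 0"
    by (simp add: fdg_def dg_cst)
  then have "fdg ?o \<le> sig"
    using fdg_scale_form[OF keller_jac [OF assms(1)], of "(cst (wt_var 2), - cst (wt_var 1), cst (wt_var 0))"] assms(1) sig_pos
    by (cases "(cst (wt_var 2), - cst (wt_var 1), cst (wt_var 0)) = (0::form)") (auto simp: keller_def)
  then have o': "fdg ?o \<le> fdg ?a" using keller_sig [OF assms(1)] f by simp
  have eq: "?a - ?b + ?c = ?o" by (rule euler_form)
  \<comment> \<open>Solving the identity for the second and for the third term bounds each by the
    others, since \<open>?o\<close> never exceeds \<open>?a\<close>.\<close>
  have "?b = ?a + ?c - ?o" unfolding eq [symmetric] by simp
  then have 1: "fdg ?b \<le> max (max (fdg ?a) (fdg ?c)) (fdg ?o)"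
    using fdg_add[of ?a ?c] fdg_diff[of "?a + ?c" ?o] by (smt (verit))
  have "?c = ?o - ?a + ?b" unfolding eq [symmetric] by simp
  then have 2: "fdg ?c \<le> max (max (fdg ?a) (fdg ?b)) (fdg ?o)"
    using fdg_add[of "?o - ?a" ?b] fdg_diff[of ?o ?a] by (smt (verit))
  show ?thesis using 1 2 o' assms(2) unfolding f by linarith
qed

end

subsection \<open>Subalgebras\<close>

inductive_set alg :: "mpol set \<Rightarrow> mpol set" for S where
  alg_cst: "cst c \<in> alg S"
| alg_gen: "p \<in> S \<Longrightarrow> p \<in> alg S"
| alg_add: "p \<in> alg S \<Longrightarrow> q \<in> alg S \<Longrightarrow> p + q \<in> alg S"
| alg_mult: "p \<in> alg S \<Longrightarrow> q \<in> alg S \<Longrightarrow> p * q \<in> alg S"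

lemma alg_sub: "S \<subseteq> alg T \<Longrightarrow> alg S \<subseteq> alg T"
proof
  fix p assume S: "S \<subseteq> alg T" and "p \<in> alg S"
  from this(2) show "p \<in> alg T" by induction (use S in \<open>auto intro: alg.intros\<close>)
qed

lemma alg_0 [simp]: "0 \<in> alg S" and alg_1 [simp]: "1 \<in> alg S"
  using alg_cst[of 0 S] alg_cst[of 1 S] by simp_all

lemma alg_uminus: "p \<in> alg S \<Longrightarrow> - p \<in> alg S"
  using alg_mult[OF alg_cst[of "-1"], of p S] by (simp add: cst_uminus)

lemma alg_diff: "p \<in> alg S \<Longrightarrow> q \<in> alg S \<Longrightarrow> p - q \<in> alg S"
  using alg_add[of p S "- q"] alg_uminus[of q S] by simp

lemma alg_power: "p \<in> alg S \<Longrightarrow> p ^ n \<in> alg S"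
  by (induction n) (auto intro: alg_mult)

lemma alg_sum: "(\<And>i. i \<in> I \<Longrightarrow> f i \<in> alg S) \<Longrightarrow> sum f I \<in> alg S"
  by (induction I rule: infinite_finite_induct) (auto intro: alg_add)

lemmas alg_rules = alg_cst alg_add alg_mult alg_diff alg_uminus alg_power

definition ev :: "(nat \<times> nat) set \<Rightarrow> (nat \<times> nat \<Rightarrow> complex) \<Rightarrow> mpol \<Rightarrow> mpol \<Rightarrow> mpol" where
  "ev S c y z = (\<Sum>p\<in>S. cst (c p) * (y ^ fst p * z ^ snd p))"

lemma ev_restrict:
  assumes "finite S" "T \<subseteq> S" "\<And>p. p \<in> S - T \<Longrightarrow> c p = 0"
  shows "ev S c y z = ev T c y z"
  unfolding ev_def by (rule sum.mono_neutral_right) (use assms in auto)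

lemma alg2_rep:
  assumes "p \<in> alg {y, z}"
  obtains S c where "finite S" "p = ev S c y z" "\<And>k. k \<in> S \<Longrightarrow> c k \<noteq> 0"
proof -
  define R where "R = {p. \<exists>S c. finite S \<and> p = ev S c y z}"
  have add: "p + q \<in> R" if "p \<in> R" "q \<in> R" for p q
  proof -
    from that obtain S c T d where *: "finite S" "p = ev S c y z" "finite T" "q = ev T d y z"
      by (auto simp: R_def)
    define c' where "c' k = (if k \<in> S then c k else 0)" for k
    define d' where "d' k = (if k \<in> T then d k else 0)" for k
    have "p = ev S c' y z" "q = ev T d' y z"
      by (auto simp: * ev_def c'_def d'_def)
    moreover have "ev (S \<union> T) c' y z = ev S c' y z" "ev (S \<union> T) d' y z = ev T d' y z"
      using * by (auto intro!: ev_restrict simp: c'_def d'_def)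
    ultimately have "p + q = ev (S \<union> T) (\<lambda>k. c' k + d' k) y z"
      by (simp add: ev_def cst_add sum.distrib distrib_right)
    then show ?thesis using * by (auto simp: R_def)
  qed
  have mon: "cst a * (y ^ i * z ^ j) \<in> R" for a i j
    by (auto simp: R_def ev_def intro!: exI[of _ "{(i, j)}"] exI[of _ "\<lambda>_. a"])
  have sum: "sum f I \<in> R" if "\<And>i. i \<in> I \<Longrightarrow> f i \<in> R" for f and I :: "'a set"
    using that
  proof (induction I rule: infinite_finite_induct)
    case (insert i I)
    then show ?case by (simp add: add)
  qed (use mon[of 0 0 0] in simp_all)
  have mult: "p * q \<in> R" if "p \<in> R" "q \<in> R" for p q
  proof -
    from that obtain S c T d where *: "finite S" "p = ev S c y z" "finite T" "q = ev T d y z"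
      by (auto simp: R_def)
    have "p * q = (\<Sum>k\<in>S. \<Sum>l\<in>T. cst (c k * d l) * (y ^ (fst k + fst l) * z ^ (snd k + snd l)))"
      by (simp add: * ev_def sum_product cst_mult power_add algebra_simps)
    then show ?thesis by (simp only:) (intro sum mon)
  qed
  have "p \<in> R" using assms
  proof induction
    case (alg_cst c)
    then show ?case using mon[of c 0 0] by simp
  next
    case (alg_gen p)
    then show ?case using mon[of 1 1 0] mon[of 1 0 1] by auto
  qed (auto intro: add mult)
  then obtain S c where *: "finite S" "p = ev S c y z" by (auto simp: R_def)
  show ?thesis
  proof (rule that)
    show "finite {k \<in> S. c k \<noteq> 0}" using * by simp
    show "p = ev {k \<in> S. c k \<noteq> 0} c y z" unfolding * by (rule ev_restrict) (use * in auto)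
  qed auto
qed

lemma alg1_rep:
  assumes "p \<in> alg {z}"
  obtains S c where "finite S" "p = (\<Sum>j\<in>S. cst (c j) * z ^ j)" "\<And>k. k \<in> S \<Longrightarrow> c k \<noteq> 0"
proof -
  \<comment> \<open>Adjoining the generator 0 reduces to two generators; terms with a positive power
    of 0 drop out, and 0 ^ 0 = 1 keeps the rest.\<close>
  have "alg {z} \<subseteq> alg {0, z}" by (intro alg_sub) (auto intro: alg_gen)
  then have "p \<in> alg {0, z}" using assms by blast
  then obtain S c where *: "finite S" "p = ev S c 0 z" "\<And>k. k \<in> S \<Longrightarrow> c k \<noteq> 0"
    using alg2_rep by blast
  define T where "T = {j. (0, j) \<in> S}"
  have T: "finite T" "Pair 0 ` T \<subseteq> S" "finite (Pair 0 ` T)"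
    using * finite_subset[of T "snd ` S"] by (force simp: T_def image_iff)+
  have "p = (\<Sum>p\<in>Pair 0 ` T. cst (c p) * (0 ^ fst p * z ^ snd p))"
    unfolding *(2) ev_def by (rule sum.mono_neutral_right) (use * T in \<open>auto simp: T_def power_0_left image_iff\<close>)
  also have "\<dots> = (\<Sum>j\<in>T. cst (c (0, j)) * z ^ j)"
    by (subst sum.reindex) (auto simp: inj_on_def)
  finally show ?thesis using that[of T "\<lambda>j. c (0, j)"] * T by (auto simp: T_def)
qed

lemma alg1_alg2: "p \<in> alg {z} \<Longrightarrow> p \<in> alg {y, z}" "p \<in> alg {y} \<Longrightarrow> p \<in> alg {y, z}"
  using alg_sub[of "{z}" "{y, z}"] alg_sub[of "{y}" "{y, z}"] by (auto intro: alg_gen)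

lemma der_power: "D i (p ^ n) = cst (of_nat n) * (p ^ (n - 1) * D i p)"
proof (induction n)
  case (Suc n)
  have "of_nat n * (p * (p ^ (n - 1) * D i p)) = of_nat n * (p ^ n * D i p)"
    by (cases n) (simp_all add: mult.assoc)
  then show ?case using Suc
    by (simp add: exponent.der_mult cst_of_nat cst_add) (simp add: algebra_simps)
qed (use exponent.der_cst[of i 1] in simp)

lemma der_sum: "D i (sum f I) = (\<Sum>j\<in>I. D i (f j))"
  by (induction I rule: infinite_finite_induct) (auto simp: der_add)

text \<open>The two sums are the formal partial derivatives evaluated at y and z. Where the
  truncated exponent 0 - 1 occurs, its coefficient is 0.\<close>

lemma ev_chain:
  "D k (ev S c y z) = (\<Sum>p\<in>S. cst (of_nat (fst p) * c p) * (y ^ (fst p - 1) * z ^ snd p)) * D k y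
     + (\<Sum>p\<in>S. cst (of_nat (snd p) * c p) * (y ^ fst p * z ^ (snd p - 1))) * D k z"
  by (simp add: ev_def der_sum exponent.der_mult der_power cst_mult sum_distrib_left sum_distrib_right
      sum.distrib [symmetric] algebra_simps)

subsection \<open>Degrees of polynomial expressions in two polynomials\<close>

context weight
begin

lemma dg_sum_top:
  assumes "finite S" "a \<in> S" "\<And>b. b \<in> S \<Longrightarrow> b \<noteq> a \<Longrightarrow> dg (f b) < dg (f a)" "f a \<noteq> 0"
  shows "dg (sum f S) = dg (f a)"
proof -
  have "dg (sum f (S - {a})) < dg (f a)"
  proof (cases "S - {a} = {}")
    case True
    then show ?thesis using dg_nonneg [OF assms(4)] by (simp only: sum.empty dg_0)
  next
    case False
    have "dg (sum f (S - {a})) \<le> Max ((\<lambda>b. dg (f b)) ` (S - {a}))"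
      by (rule dg_sum_le) (use False assms(1) in \<open>auto intro: Max_ge order_trans [OF dg_ge_m1] simp: Max_ge_iff\<close>)
    also have "\<dots> < dg (f a)" using False assms by (subst Max_less_iff) auto
    finally show ?thesis .
  qed
  then show ?thesis using assms by (subst sum.remove[of _ a]) (auto intro: dg_add_eq2)
qed

lemma dg_monomial:
  assumes "0 < dg y" "0 < dg z" "c \<noteq> 0"
  shows "cst c * (y ^ i * z ^ j) \<noteq> 0 \<and> dg (cst c * (y ^ i * z ^ j)) = i * dg y + j * dg z"
proof -
  have nz: "y \<noteq> 0" "z \<noteq> 0" using assms by auto
  have "cst c * y \<noteq> 0" using dg_cst_mult[OF assms(3), of y] assms(1) by auto
  then have c: "cst c \<noteq> 0" by auto
  show ?thesis using dg_power[OF nz(1), of i] dg_power[OF nz(2), of j] assms(3) c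
      dg_mult(2)[of "y ^ i" "z ^ j"]
    by (simp add: mult_eq_0)
qed

text \<open>The degree of y^i z^j as a product. A combination can fall below it only if several
  monomials share the maximum; \<open>tops\<close> collects those.\<close>

definition vd :: "mpol \<Rightarrow> mpol \<Rightarrow> nat \<times> nat \<Rightarrow> real" where
  "vd y z p = real (fst p) * dg y + real (snd p) * dg z"

definition tops :: "mpol \<Rightarrow> mpol \<Rightarrow> (nat \<times> nat) set \<Rightarrow> (nat \<times> nat) set" where
  "tops y z S = {p \<in> S. vd y z p = Max (vd y z ` S)}"

lemma tops_same:
  assumes "0 < dg z" "p \<in> tops y z S" "q \<in> tops y z S" "fst p = fst q"
  shows "p = q"
proof -
  have "vd y z p = vd y z q" using assms by (simp add: tops_def)
  then have "real (snd p) * dg z = real (snd q) * dg z" using assms(4) by (simp add: vd_def)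
  then show ?thesis using assms by (simp add: prod_eq_iff)
qed

lemma ev_top1:
  assumes "0 < dg y" "0 < dg z" "finite S" "\<And>k. k \<in> S \<Longrightarrow> c k \<noteq> 0" "tops y z S = {a}"
  shows "ev S c y z \<noteq> 0 \<and> dg (ev S c y z) = Max (vd y z ` S)"
proof -
  have a: "a \<in> S" "vd y z a = Max (vd y z ` S)" using assms(5) by (auto simp: tops_def)
  have m: "cst (c k) * (y ^ fst k * z ^ snd k) \<noteq> 0 \<and>
      dg (cst (c k) * (y ^ fst k * z ^ snd k)) = vd y z k" if "k \<in> S" for k
    using dg_monomial[OF assms(1,2) assms(4)[OF that], of "fst k" "snd k"] by (simp add: vd_def)
  have "dg (ev S c y z) = vd y z a"
    unfolding ev_def
  proof (subst dg_sum_top[where a = a])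
    fix b assume b: "b \<in> S" "b \<noteq> a"
    then have "vd y z b \<le> vd y z a" "vd y z b \<noteq> vd y z a"
      using assms(3,5) a by (auto simp: tops_def)
    then show "dg (cst (c b) * (y ^ fst b * z ^ snd b)) < dg (cst (c a) * (y ^ fst a * z ^ snd a))"
      using m a b by simp
  qed (use m a assms(3) in auto)
  moreover have "0 \<le> vd y z a" using assms by (simp add: vd_def)
  ultimately show ?thesis using a by auto
qed

text \<open>The operator y d/dy - i0 multiplies the coefficient at (i, j) by i - i0. Among the top
  exponents this kills exactly \<open>p0\<close>, because on \<open>tops\<close> the first entry
  determines the pair.\<close>

lemma ev_step:
  assumes pos: "0 < dg y" "0 < dg z" and wedge: "wedge y z \<noteq> 0"
    and S: "finite S" "\<And>k. k \<in> S \<Longrightarrow> c k \<noteq> 0"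
    and p0: "p0 \<in> tops y z S" and card: "1 < card (tops y z S)"
  obtains T d where "finite T" "\<And>k. k \<in> T \<Longrightarrow> d k \<noteq> 0"
    "tops y z T = tops y z S - {p0}" "Max (vd y z ` T) = Max (vd y z ` S)"
    "ev T d y z = y * (\<Sum>p\<in>S. cst (of_nat (fst p) * c p) * (y ^ (fst p - 1) * z ^ snd p))
       - cst (of_nat (fst p0)) * ev S c y z"
proof -
  define T where "T = {p \<in> S. fst p \<noteq> fst p0}"
  define d where "d p = (of_nat (fst p) - of_nat (fst p0)) * c p" for p
  have "\<exists>p1. p1 \<in> tops y z S \<and> p1 \<noteq> p0"
  proof (rule ccontr)
    assume "\<nexists>p1. p1 \<in> tops y z S \<and> p1 \<noteq> p0"
    then have "tops y z S \<subseteq> {p0}" by blast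
    then have "card (tops y z S) \<le> 1" using card_mono[of "{p0}"] by fastforce
    then show False using card by simp
  qed
  then obtain p1 where p1: "p1 \<in> tops y z S" "p1 \<noteq> p0" by blast
  have p1T: "p1 \<in> T" using tops_same[OF pos(2) p1(1) p0] p1 by (auto simp: T_def tops_def)
  have fin: "finite T" using S by (simp add: T_def)
  have Max: "Max (vd y z ` T) = Max (vd y z ` S)"
  proof (rule antisym)
    show "Max (vd y z ` T) \<le> Max (vd y z ` S)"
      using p1T S(1) by (intro Max_mono image_mono) (force simp: T_def)+
    have "vd y z p1 \<le> Max (vd y z ` T)" using p1T fin by simp
    then show "Max (vd y z ` S) \<le> Max (vd y z ` T)" using p1 by (simp add: tops_def)
  qed
  have "tops y z T = tops y z S - {p0}"
    using Max tops_same[OF pos(2) _ p0] p0 by (auto simp: tops_def T_def)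
  moreover have "ev T d y z = ev S d y z"
    by (rule ev_restrict [symmetric]) (use S in \<open>auto simp: T_def d_def\<close>)
  moreover have "ev S d y z = y * (\<Sum>p\<in>S. cst (of_nat (fst p) * c p) * (y ^ (fst p - 1) * z ^ snd p))
       - cst (of_nat (fst p0)) * ev S c y z"
  proof -
    have "y * (cst (of_nat n * a) * (y ^ (n - 1) * v)) = cst (of_nat n * a) * (y ^ n * v)" for n a v
      by (cases n) (auto simp: algebra_simps)
    then show ?thesis
      by (simp add: ev_def d_def sum_distrib_left sum_subtractf [symmetric])
        (simp add: left_diff_distrib cst_diff cst_mult mult.assoc)
  qed
  ultimately show ?thesis using that[of T d] fin S Max by (simp add: T_def d_def)
qed

text \<open>The operator $y\,\partial_y - i_0$ removes the top term with $y$-exponent $i_0$ and costs at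
most $\deg y + \deg z - \deg dy\wedge dz$ in degree.\<close>
lemma ev_lower:
  assumes pos: "0 < dg y" "0 < dg z" and wedge: "wedge y z \<noteq> 0"
    and S: "finite S" "S \<noteq> {}" "\<And>k. k \<in> S \<Longrightarrow> c k \<noteq> 0"
  shows "ev S c y z \<noteq> 0 \<and>
    Max (vd y z ` S) - (real (card (tops y z S)) - 1) * (dg y + dg z - br y z) \<le> dg (ev S c y z)"
  using S
proof (induction "card (tops y z S)" arbitrary: S c)
  case 0
  have "Max (vd y z ` S) \<in> vd y z ` S" using 0 by (intro Max_in) auto
  then have "tops y z S \<noteq> {}" unfolding tops_def by fastforce
  moreover have "finite (tops y z S)" using 0 by (simp add: tops_def)
  ultimately show ?case using 0 by simp
next
  case (Suc n)
  show ?case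
  proof (cases n)
    case 0
    then obtain a where "tops y z S = {a}" using Suc(2) by (metis One_nat_def card_1_singletonE)
    then show ?thesis using ev_top1[OF pos, of S c a] Suc by simp
  next
    case (Suc m)
    have c: "card (tops y z S) = Suc n" using Suc.hyps(2) by simp
    have fin: "finite (tops y z S)" using Suc.prems by (simp add: tops_def)
    obtain p0 where p0: "p0 \<in> tops y z S" using c fin by (metis card.empty ex_in_conv nat.distinct(1))
    obtain T d where T: "finite T" "\<And>k. k \<in> T \<Longrightarrow> d k \<noteq> 0"
      "tops y z T = tops y z S - {p0}" "Max (vd y z ` T) = Max (vd y z ` S)" and
      evT: "ev T d y z = y * (\<Sum>p\<in>S. cst (of_nat (fst p) * c p) * (y ^ (fst p - 1) * z ^ snd p))
       - cst (of_nat (fst p0)) * ev S c y z"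
      by (rule ev_step[OF pos wedge Suc.prems(1,3) p0]) (use c Suc in auto)
    have cT: "card (tops y z T) = n" using T(3) p0 c fin by simp
    then have "T \<noteq> {}" using Suc by (auto simp: tops_def)
    then have IH: "ev T d y z \<noteq> 0"
      "Max (vd y z ` S) - (real n - 1) * (dg y + dg z - br y z) \<le> dg (ev T d y z)"
      using Suc.hyps(1)[of T d] T cT by auto
    let ?f = "ev S c y z" and ?h = "\<Sum>p\<in>S. cst (of_nat (fst p) * c p) * (y ^ (fst p - 1) * z ^ snd p)"
    let ?h' = "\<Sum>p\<in>S. cst (of_nat (snd p) * c p) * (y ^ fst p * z ^ (snd p - 1))"
    have ch: "D i ?f = ?h * D i y + ?h' * D i z" for i by (rule ev_chain)
    have br: "0 \<le> dg y + dg z - br y z" using br_le [OF wedge] by simp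
    \<comment> \<open>If f vanished, then h dy wedge dz = df wedge dz = 0 would give h = 0, and the
      operator would produce 0, against the induction hypothesis.\<close>
    have nz: "?f \<noteq> 0"
    proof
      assume "?f = 0"
      then have "scale_form ?h (wedge y z) = 0" using wedge_chain[OF ch, of z] by (simp add: wedge_self)
      then have "?h = 0" using wedge by (simp add: scale_form_eq_0)
      then show False using IH(1) evT \<open>?f = 0\<close> by simp
    qed
    have "dg (y * ?h) \<le> dg ?f + (dg y + dg z - br y z)"
    proof (cases "?h = 0")
      case True
      then show ?thesis using br dg_nonneg [OF nz] by simp
    next
      case False
      have "wedge ?f z \<noteq> 0" "br ?f z = dg ?h + br y z" using br_chain[OF ch False wedge] by auto
      \<comment> \<open>Since df wedge dz = h dy wedge dz, the degree of the derivative h is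
        controlled by that of f.\<close>
      then have "dg ?h + br y z \<le> dg ?f + dg z" using br_le[of ?f z] by simp
      moreover have "dg (y * ?h) = dg y + dg ?h" using dg_mult[of y ?h] False pos by force
      ultimately show ?thesis by simp
    qed
    then have "dg (ev T d y z) \<le> dg ?f + (dg y + dg z - br y z)"
      unfolding evT using dg_diff[of "y * ?h" "cst (of_nat (fst p0)) * ?f"]
        dg_cst_mult_le[of "of_nat (fst p0)" ?f] br by linarith
    then show ?thesis using IH(2) nz c by (simp add: algebra_simps)
  qed
qed

definition no_cancel :: "mpol \<Rightarrow> mpol \<Rightarrow> mpol \<Rightarrow> bool" where
  "no_cancel f y z \<longleftrightarrow> (\<exists>S c. finite S \<and> f = ev S c y z \<and> (\<forall>k\<in>S. c k \<noteq> 0) \<and> (\<forall>k\<in>S. vd y z k \<le> dg f) \<and>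
     (f \<noteq> 0 \<longrightarrow> (\<exists>k\<in>S. vd y z k = dg f)))"

text \<open>The last clause records a partial derivative h along the first generator: it stays large
  although f is small, because differentiating destroys the cancellation. It makes the notion
  asymmetric in y and z.\<close>

definition top_cancel :: "nat \<Rightarrow> nat \<Rightarrow> real \<Rightarrow> mpol \<Rightarrow> mpol \<Rightarrow> mpol \<Rightarrow> bool" where
  "top_cancel p q \<eta> f y z \<longleftrightarrow> coprime p q \<and> 1 \<le> p \<and> 1 \<le> q \<and> 0 < \<eta> \<and> dg y = p * \<eta> \<and> dg z = q * \<eta> \<and>
     (real p * real q - p - q) * \<eta> + br y z \<le> dg f \<and>
     (2 \<le> p \<longrightarrow> 2 \<le> q \<longrightarrow> dg f < real p * real q * \<eta> \<longrightarrow>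
       (\<exists>h h'. (\<forall>i. D i f = h * D i y + h' * D i z) \<and> h \<noteq> 0 \<and> (real p * real q - p) * \<eta> \<le> dg h))"

text \<open>Top exponents lie on a line i p + j q = const, which makes the degrees commensurable.
  Their first entries are congruent modulo q, so among n of them some first entry is at least (n -
  1) q.\<close>

lemma resonance:
  assumes "0 < dg y" "0 < dg z" "finite S" "p0 \<in> tops y z S" "p1 \<in> tops y z S" "p0 \<noteq> p1"
  obtains p q \<eta> where "coprime p q" "1 \<le> p" "1 \<le> q" "0 < \<eta>" "dg y = real p * \<eta>" "dg z = real q * \<eta>"
    "(real (card (tops y z S)) - 1) * (real p * real q * \<eta>) \<le> Max (vd y z ` S)"
proof -
  note res = that
  let ?V = "Max (vd y z ` S)"
  have main: thesis if p01: "p0 \<in> tops y z S" "p1 \<in> tops y z S" "fst p1 < fst p0" for p0 p1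
  proof -
    define m where "m = fst p0 - fst p1"
    have e: "fst p0 * dg y + snd p0 * dg z = fst p1 * dg y + snd p1 * dg z"
      using p01 by (simp add: tops_def vd_def)
    have "fst p1 * dg y < fst p0 * dg y" using p01 assms(1) by simp
    then have "snd p0 * dg z < snd p1 * dg z" using e by linarith
    then have lt: "snd p0 < snd p1" using assms(2) by simp
    define n where "n = snd p1 - snd p0"
    have mn: "m * dg y = n * dg z" "0 < m" "0 < n"
      using e p01 lt by (auto simp: m_def n_def of_nat_diff algebra_simps)
    define g where "g = gcd m n"
    have g: "0 < g" using mn by (simp add: g_def)
    obtain q p where qp: "m = q * g" "n = p * g" "coprime q p"
      using gcd_coprime_exists[of m n] g unfolding g_def by blast
    have qp0: "0 < q" "0 < p" using qp mn by auto
    define \<eta> where "\<eta> = dg y / p"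
    have eta: "0 < \<eta>" "dg y = p * \<eta>" using qp0 assms by (simp_all add: \<eta>_def)
    have "real g * (q * dg y) = real g * (p * dg z)" using mn(1) by (simp add: qp algebra_simps)
    then have "q * dg y = p * dg z" using g by simp
    then have z: "dg z = q * \<eta>" using qp0 by (simp add: \<eta>_def field_simps)
    have line: "fst k * p + snd k * q = fst p0 * p + snd p0 * q" if "k \<in> tops y z S" for k
    proof -
      have "(fst k * p + snd k * q) * \<eta> = (fst p0 * p + snd p0 * q) * \<eta>"
        using that p01(1) by (simp add: tops_def vd_def eta(2) z algebra_simps)
      then have "real (fst k * p + snd k * q) = real (fst p0 * p + snd p0 * q)" using eta(1) by simp
      then show ?thesis by linarith
    qed
    have modq: "fst k mod q = fst p0 mod q" if "k \<in> tops y z S" for k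
    proof -
      have "(fst k * p) mod q = (fst p0 * p) mod q"
        using line[OF that] by (metis mod_mult_self1)
      then have "(int (fst k) * int p) mod int q = (int (fst p0) * int p) mod int q"
        by (metis of_nat_mod of_nat_mult)
      then have "int q dvd (int (fst k) - int (fst p0)) * int p"
        by (simp add: mod_eq_dvd_iff algebra_simps)
      then have "int q dvd int (fst k) - int (fst p0)"
        using qp(3) by (simp add: coprime_dvd_mult_left_iff)
      then have "int (fst k) mod int q = int (fst p0) mod int q"
        by (simp add: mod_eq_dvd_iff)
      then show ?thesis by (metis of_nat_eq_iff of_nat_mod)
    qed
    have inj: "inj_on (\<lambda>k. fst k div q) (tops y z S)"
    proof (rule inj_onI)
      fix k l assume kl: "k \<in> tops y z S" "l \<in> tops y z S" "fst k div q = fst l div q"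
      then have "fst k = fst l" using modq[of k] modq[of l] by (metis div_mult_mod_eq)
      then show "k = l" using tops_same[OF assms(2)] kl by blast
    qed
    let ?I = "(\<lambda>k. fst k div q) ` tops y z S"
    have fin: "finite ?I" using assms(3) by (simp add: tops_def)
    have ne: "?I \<noteq> {}" using assms(4) by blast
    \<comment> \<open>As many distinct quotients as top exponents: the largest quotient is at least
      their number minus 1.\<close>
    have "?I \<subseteq> {..Max ?I}" using Max_ge[OF fin] by blast
    then have "card ?I \<le> Suc (Max ?I)" using card_mono[of "{..Max ?I}" ?I] by simp
    then have L: "card (tops y z S) - 1 \<le> Max ?I" using card_image[OF inj] by simp
    obtain k where k: "k \<in> tops y z S" "Max ?I = fst k div q" using Max_in[OF fin ne] by blast
    have "(card (tops y z S) - 1) * q \<le> fst k div q * q" using L k by simp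
    also have "\<dots> \<le> fst k" by simp
    finally have "real ((card (tops y z S) - 1) * q) \<le> real (fst k)" by (rule of_nat_mono)
    moreover have "finite (tops y z S)" "tops y z S \<noteq> {}"
      using assms by (simp add: tops_def, blast)
    then have "0 < card (tops y z S)" by (simp add: card_gt_0_iff)
    ultimately have "(real (card (tops y z S)) - 1) * real q \<le> fst k" by (simp add: of_nat_diff)
    then have "(real (card (tops y z S)) - 1) * q * dg y \<le> fst k * dg y" using assms by simp
    also have "\<dots> \<le> vd y z k" using assms by (simp add: vd_def)
    also have "\<dots> = ?V" using k by (simp add: tops_def)
    finally have "(real (card (tops y z S)) - 1) * (p * q * \<eta>) \<le> ?V"
      by (simp add: eta(2) algebra_simps)
    then show thesis
      using res[of p q \<eta>] qp qp0 eta z by (simp add: coprime_commute Suc_leI)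
  qed
  have "fst p0 \<noteq> fst p1" using tops_same[OF assms(2)] assms by blast
  then show thesis using main[of p0 p1] main[of p1 p0] assms by linarith
qed

lemma cancel:
  assumes f: "f \<in> alg {y, z}" and wedge: "wedge y z \<noteq> 0"
  shows "no_cancel f y z \<or> (\<exists>p q \<eta>. top_cancel p q \<eta> f y z)"
proof (rule disjCI)
  assume nCC: "\<nexists>p q \<eta>. top_cancel p q \<eta> f y z"
  have pos: "0 < dg y" "0 < dg z" using wedge_dg_pos [OF wedge] by auto
  obtain S c where S: "finite S" "f = ev S c y z" "\<And>k. k \<in> S \<Longrightarrow> c k \<noteq> 0"
    using alg2_rep[OF f] by blast
  show "no_cancel f y z"
  proof (cases "S = {}")
    case True
    then show ?thesis unfolding no_cancel_def using S
      by (intro exI[of _ "{}"] exI[of _ c]) (auto simp: ev_def)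
  next
    case False
    let ?V = "Max (vd y z ` S)" and ?T = "tops y z S"
    have Vin: "?V \<in> vd y z ` S" using S False by (intro Max_in) auto
    then obtain p0 where p0: "p0 \<in> ?T" by (auto simp: tops_def)
    have fin: "finite ?T" using S by (simp add: tops_def)
    have low: "f \<noteq> 0" "?V - (real (card ?T) - 1) * (dg y + dg z - br y z) \<le> dg f"
      using ev_lower[OF pos wedge S(1) False, of c] S(2,3) by auto
    have br: "0 \<le> dg y + dg z - br y z" using br_le [OF wedge] by simp
    show ?thesis
    proof (cases "dg f = ?V")
      case True
      then have "\<forall>k\<in>S. vd y z k \<le> dg f" "\<exists>k\<in>S. vd y z k = dg f" using S Vin by auto
      then show ?thesis using S unfolding no_cancel_def by (intro exI[of _ S] exI[of _ c]) auto
    next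
      case ne: False
      have "?T \<noteq> {p0}" using ne ev_top1[OF pos S(1), of c p0] S(2,3) by blast
      then obtain p1 where p1: "p1 \<in> ?T" "p0 \<noteq> p1" using p0 by blast
      obtain p q \<eta> where pq: "coprime p q" "1 \<le> p" "1 \<le> q" "0 < \<eta>" "dg y = real p * \<eta>" "dg z = real q * \<eta>"
        "(real (card ?T) - 1) * (real p * real q * \<eta>) \<le> ?V"
        by (rule resonance[OF pos S(1) p0 p1])
      define L where "L = real (card ?T) - 1"
      note low' = low(2)[folded L_def]
      have "card {p0, p1} \<le> card ?T" using p0 p1 fin by (intro card_mono) auto
      then have L: "1 \<le> L" and card: "1 < card ?T" using p1 by (auto simp: L_def)
      have V: "L * (p * q * \<eta>) \<le> ?V" using pq by (simp add: L_def)
      \<comment> \<open>Each of the \<open>L\<close> operator steps costs the bracketed amount,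
        while the virtual degree provides p q eta per step.\<close>
      have b: "L * (p * q * \<eta> - (dg y + dg z - br y z)) \<le> dg f"
        using low' V by (simp add: algebra_simps)
      have "p * q * \<eta> - (dg y + dg z - br y z) \<le> dg f"
      proof (cases "p * q * \<eta> - (dg y + dg z - br y z) \<le> 0")
        case True
        then show ?thesis using dg_nonneg[OF low(1)] by linarith
      next
        case False
        then have "1 * (p * q * \<eta> - (dg y + dg z - br y z)) \<le> L * (p * q * \<eta> - (dg y + dg z - br y z))"
          using L by (intro mult_right_mono) auto
        then show ?thesis using b by simp
      qed
      then have c1: "(real p * real q - p - q) * \<eta> + br y z \<le> dg f"
        using pq by (simp add: algebra_simps)
      have c2: "\<exists>h h'. (\<forall>i. D i f = h * D i y + h' * D i z) \<and> h \<noteq> 0 \<and> (real p * real q - p) * \<eta> \<le> dg h"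
        if ge: "2 \<le> p" "2 \<le> q" and lt: "dg f < real p * real q * \<eta>"
      proof -
        have "real p + real q \<le> real p * real q"
        proof -
          have "(1::real) * 1 \<le> (real p - 1) * (real q - 1)" using ge by (intro mult_mono) auto
          then show ?thesis by (simp add: algebra_simps)
        qed
        then have "(real p + real q) * \<eta> \<le> real p * real q * \<eta>" using pq(4) by (intro mult_right_mono) auto
        moreover have "0 \<le> br y z" using br_pos [OF wedge] by simp
        ultimately have nab: "dg y + dg z - br y z \<le> real p * real q * \<eta>" using pq by (simp add: algebra_simps)
        let ?h = "\<Sum>p\<in>S. cst (of_nat (fst p) * c p) * (y ^ (fst p - 1) * z ^ snd p)"
        let ?h' = "\<Sum>p\<in>S. cst (of_nat (snd p) * c p) * (y ^ fst p * z ^ (snd p - 1))"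
        have ch: "D i f = ?h * D i y + ?h' * D i z" for i unfolding S(2) by (rule ev_chain)
        obtain T d where T: "finite T" "\<And>k. k \<in> T \<Longrightarrow> d k \<noteq> 0"
          "tops y z T = ?T - {p0}" "Max (vd y z ` T) = ?V" and
          evT: "ev T d y z = y * ?h - cst (of_nat (fst p0)) * f"
          by (rule ev_step[OF pos wedge S(1) _ p0 card, where c = c]) (use S(2,3) in auto)
        have "p1 \<in> T" using T(3) p1 by (auto simp: tops_def)
        then have T0: "T \<noteq> {}" by blast
        have "card (tops y z T) = card ?T - 1" using T(3) p0 fin by simp
        then have "real (card (tops y z T)) - 1 = L - 1" using card by (simp add: L_def of_nat_diff)
        then have "?V - (L - 1) * (dg y + dg z - br y z) \<le> dg (ev T d y z)"
          using ev_lower[OF pos wedge T(1) T0 T(2)] T(4) by simp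
        moreover have "(L - 1) * (dg y + dg z - br y z) \<le> (L - 1) * (real p * real q * \<eta>)"
          using nab L by (intro mult_left_mono) auto
        \<comment> \<open>After one operator step, \<open>L - 1\<close> losses remain, so p q eta
          survives. As f itself is smaller, this degree must come from y h.\<close>
        ultimately have A: "real p * real q * \<eta> \<le> dg (ev T d y z)" using V by (simp add: algebra_simps)
        have B: "dg (y * ?h) \<ge> real p * real q * \<eta>"
          using A lt dg_diff[of "y * ?h" "cst (of_nat (fst p0)) * f"]
            dg_cst_mult_le[of "of_nat (fst p0)" f] unfolding evT by linarith
        moreover have "0 < real p * real q * \<eta>" using ge pq by simp
        ultimately have nz: "?h \<noteq> 0" by auto
        then have "dg (y * ?h) = dg y + dg ?h" using dg_mult[of y ?h] pos by force
        then have "(real p * real q - p) * \<eta> \<le> dg ?h" using B pq by (simp add: algebra_simps)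
        then show ?thesis using ch nz by blast
      qed
      have "top_cancel p q \<eta> f y z" unfolding top_cancel_def using pq c1 c2 by blast
      then show ?thesis using nCC by blast
    qed
  qed
qed

text \<open>Distinct powers of z have distinct degrees because \<open>dg z\<close> is positive, so
  cancellation cannot occur with one generator.\<close>

lemma alg1_deg:
  assumes "f \<in> alg {z}" "0 < dg z" "f \<noteq> 0"
  obtains n h where "dg f = real n * dg z" "\<And>i. D i f = h * D i z"
    "n = 0 \<Longrightarrow> h = 0" "0 < n \<Longrightarrow> h \<noteq> 0 \<and> dg h = (real n - 1) * dg z"
proof -
  obtain S c where S: "finite S" "f = (\<Sum>j\<in>S. cst (c j) * z ^ j)" "\<And>k. k \<in> S \<Longrightarrow> c k \<noteq> 0"
    using assms(1) by (rule alg1_rep) blast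
  have red_line1_move: "S \<noteq> {}" using assms(3) S(2) by auto
  define n where "n = Max S"
  have n: "n \<in> S" "\<And>k. k \<in> S \<Longrightarrow> k \<le> n" using S red_line1_move by (auto simp: n_def)
  have m: "cst a * z ^ k \<noteq> 0 \<and> dg (cst a * z ^ k) = k * dg z" if "a \<noteq> 0" for a k
    using dg_monomial[OF assms(2,2) that, of k 0] by simp
  have dgf: "dg f = real n * dg z"
    unfolding S(2)
  proof (subst dg_sum_top[where a = n])
    fix b assume "b \<in> S" "b \<noteq> n"
    then have "b < n" using n by (simp add: order_less_le)
    then show "dg (cst (c b) * z ^ b) < dg (cst (c n) * z ^ n)"
      using m[OF S(3)[OF \<open>b \<in> S\<close>], of b] m[OF S(3)[OF n(1)], of n] \<open>b < n\<close> assms(2) by simp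
  qed (use m S n in auto)
  define h where "h = (\<Sum>j\<in>S. cst (of_nat j * c j) * z ^ (j - 1))"
  have ch: "D i f = h * D i z" for i
    unfolding S(2) h_def der_sum exponent.der_cst_mult der_power cst_mult sum_distrib_right
    by (rule sum.cong) (simp_all add: algebra_simps)
  show thesis
  proof (rule that[of n h])
    show "n = 0 \<Longrightarrow> h = 0" using n(2) by (fastforce simp: h_def intro!: sum.neutral)
    assume pos: "0 < n"
    have "dg h = dg (cst (of_nat n * c n) * z ^ (n - 1))"
      unfolding h_def
    proof (rule dg_sum_top)
      fix b assume b: "b \<in> S" "b \<noteq> n"
      then have "b < n" using n by (simp add: order_less_le)
      show "dg (cst (of_nat b * c b) * z ^ (b - 1)) < dg (cst (of_nat n * c n) * z ^ (n - 1))"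
      proof (cases "b = 0")
        case True
        then show ?thesis using m[of "of_nat n * c n" "n - 1"] S(3)[OF n(1)] pos assms(2)
          by (simp add: dg_nonneg order_less_le_trans[of "-1" 0])
      next
        case False
        then show ?thesis
          using m[of "of_nat n * c n" "n - 1"] m[of "of_nat b * c b" "b - 1"] S(3)[OF n(1)] S(3)[OF b(1)]
            pos assms(2) \<open>b < n\<close> by simp
      qed
    qed (use S n m[of "of_nat n * c n" "n - 1"] pos in auto)
    also have "\<dots> = (real n - 1) * dg z"
      using m[of "of_nat n * c n" "n - 1"] S(3)[OF n(1)] pos by (simp add: of_nat_diff)
    finally show "h \<noteq> 0 \<and> dg h = (real n - 1) * dg z"
      using pos assms(2) by (smt (verit) dg_0 mult_nonneg_nonneg of_nat_0_less_iff of_nat_1 of_nat_le_iff One_nat_def Suc_leI)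
  qed (use dgf ch in auto)
qed

end

subsection \<open>Elementary moves\<close>

definition line :: "mpol \<Rightarrow> mpol \<Rightarrow> mpol \<Rightarrow> mpol \<Rightarrow> bool" where
  "line x' x y z \<longleftrightarrow> (\<exists>c P. c \<noteq> 0 \<and> P \<in> alg {y, z} \<and> x' = cst c * x + P)"

definition line1 :: "mpol \<Rightarrow> mpol \<Rightarrow> mpol \<Rightarrow> bool" where
  "line1 x' x z \<longleftrightarrow> (\<exists>c P. c \<noteq> 0 \<and> P \<in> alg {z} \<and> x' = cst c * x + P)"

lemma lineI: "c \<noteq> 0 \<Longrightarrow> P \<in> alg {y, z} \<Longrightarrow> x' = cst c * x + P \<Longrightarrow> line x' x y z"
  unfolding line_def by blast

lemma line1I: "c \<noteq> 0 \<Longrightarrow> P \<in> alg {z} \<Longrightarrow> x' = cst c * x + P \<Longrightarrow> line1 x' x z"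
  unfolding line1_def by blast

lemma line_commute: "line x' x z y = line x' x y z"
  by (simp add: line_def insert_commute)

lemma line1_line: "line1 x' x z \<Longrightarrow> line x' x y z" "line1 x' x y \<Longrightarrow> line x' x y z"
  unfolding line1_def line_def using alg1_alg2 by blast+

lemma line_sym: "line x' x y z \<Longrightarrow> line x x' y z"
proof -
  assume "line x' x y z"
  then obtain c P where *: "c \<noteq> 0" "P \<in> alg {y, z}" "x' = cst c * x + P" by (auto simp: line_def)
  then have "x = cst (inverse c) * x' + - (cst (inverse c) * P)" by (simp add: distrib_left)
  then show ?thesis using * by (intro lineI[of "inverse c" "- (cst (inverse c) * P)"]) (auto intro: alg_rules)
qed

lemma line1_sym: "line1 x' x z \<Longrightarrow> line1 x x' z"
proof -
  assume "line1 x' x z"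
  then obtain c P where *: "c \<noteq> 0" "P \<in> alg {z}" "x' = cst c * x + P" by (auto simp: line1_def)
  then have "x = cst (inverse c) * x' + - (cst (inverse c) * P)" by (simp add: distrib_left)
  then show ?thesis using * by (intro line1I[of "inverse c" "- (cst (inverse c) * P)"]) (auto intro: alg_rules)
qed

lemma line_trans: "line x'' x' y z \<Longrightarrow> line x' x y z \<Longrightarrow> line x'' x y z"
proof -
  assume "line x'' x' y z" "line x' x y z"
  then obtain c P d Q where *: "c \<noteq> 0" "P \<in> alg {y, z}" "x'' = cst c * x' + P"
    "d \<noteq> 0" "Q \<in> alg {y, z}" "x' = cst d * x + Q" by (auto simp: line_def)
  then have "x'' = cst (c * d) * x + (cst c * Q + P)" by (simp add: cst_mult algebra_simps)
  then show ?thesis using * by (intro lineI[of "c * d"]) (auto intro: alg_rules)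
qed

lemma alg2_eqI: "y \<in> alg {y', z'} \<Longrightarrow> z \<in> alg {y', z'} \<Longrightarrow> y' \<in> alg {y, z} \<Longrightarrow> z' \<in> alg {y, z} \<Longrightarrow>
  alg {y, z} = alg {y', z'}"
  using alg_sub[of "{y, z}" "{y', z'}"] alg_sub[of "{y', z'}" "{y, z}"] by auto

lemma line1_alg: "line1 y' y z \<Longrightarrow> y' \<in> alg {y, z}"
proof -
  assume "line1 y' y z"
  then obtain c P where *: "c \<noteq> 0" "P \<in> alg {z}" "y' = cst c * y + P" by (auto simp: line1_def)
  have "y \<in> alg {y, z}" by (rule alg_gen) simp
  then show ?thesis using * alg1_alg2(1)[of P z y] by (auto intro: alg_rules)
qed

lemma line1_alg_eq: "line1 y' y z \<Longrightarrow> alg {y', z} = alg {y, z}"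
  using line1_alg[of y' y z] line1_alg[of y y' z] line1_sym[of y' y z]
  by (intro alg2_eqI) (auto intro: alg_gen)

lemma line_alg_cong: "line x' x y z \<Longrightarrow> alg {y, z} = alg {y', z'} \<Longrightarrow> line x' x y' z'"
  by (simp add: line_def)

text \<open>Changing y by a polynomial in z preserves the algebra generated by y and z, hence the
  moves of x over the pair. Interchanging moves rests on this.\<close>

lemma line_line1: "line x' x y z \<Longrightarrow> line1 y' y z \<Longrightarrow> line x' x y' z"
  by (rule line_alg_cong) (auto simp: line1_alg_eq)

lemma alg2_chain:
  assumes "p \<in> alg {y, z}"
  obtains h h' where "\<And>i. D i p = h * D i y + h' * D i z"
proof -
  obtain S c where p: "p = ev S c y z" using alg2_rep[OF assms] by blast
  show ?thesis by (rule that) (unfold p, rule ev_chain)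
qed

context weight
begin

text \<open>For P in the algebra of y and z, dP is a combination of dy and dz and contributes
  nothing to the Jacobian.\<close>

lemma keller_line: "keller x y z \<Longrightarrow> line x' x y z \<Longrightarrow> keller x' y z"
proof -
  assume a: "keller x y z" and "line x' x y z"
  then obtain c P where *: "c \<noteq> 0" "P \<in> alg {y, z}" "x' = cst c * x + P" by (auto simp: line_def)
  obtain h h' where "\<And>i. D i P = h * D i y + h' * D i z" using alg2_chain[OF *(2)] by blast
  then have "jac P y z = 0" using jac_chain[of P h y h' z y z] by simp
  then have "jac x' y z = cst c * jac x y z" by (simp add: * jac_add jac_cst_mult)
  then show ?thesis using a * by (simp add: keller_def)
qed

lemma dg_move: "c \<noteq> 0 \<Longrightarrow> dg x' < dg x \<Longrightarrow> x = cst c * x' + P \<Longrightarrow> dg P = dg x"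
  using dg_diff_eq[of "cst c * x'" x] by simp

text \<open>Mostly used contrapositively: where no such reduction is possible, \<open>dg x\<close>
  is not a multiple of \<open>dg z\<close>.\<close>

lemma power_red:
  assumes "dg x = real n * dg z" "0 < dg z" "0 < dg x"
  obtains x' where "line1 x' x z" "dg x' < dg x"
proof -
  have "x \<noteq> 0" "z \<noteq> 0" using assms by auto
  then have "dg x = dg (z ^ n)" using dg_power[of z n] assms by simp
  then obtain c where c: "c \<noteq> 0" "dg (x - cst c * z ^ n) < dg x"
    using cancel_top[of x "z ^ n"] \<open>x \<noteq> 0\<close> by metis
  have "line1 (x - cst c * z ^ n) x z"
    by (rule line1I[of 1 "- (cst c * z ^ n)"]) (auto intro!: alg_rules intro: alg_gen)
  then show ?thesis using that c by blast
qed

lemma alg1_chain: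
  assumes "p \<in> alg {z}" "0 < dg z"
  obtains h where "\<And>i. D i p = h * D i z" "h \<noteq> 0 \<Longrightarrow> dg h = dg p - dg z"
proof (cases "p = 0")
  case True
  then show ?thesis using that[of 0] by simp
next
  case False
  obtain n h where "dg p = real n * dg z" "\<And>i. D i p = h * D i z"
    "n = 0 \<Longrightarrow> h = 0" "0 < n \<Longrightarrow> h \<noteq> 0 \<and> dg h = (real n - 1) * dg z"
    using alg1_deg[OF assms False] by blast
  then show ?thesis using that[of h] by (cases n) (auto simp: algebra_simps)
qed

lemma alg1_linear:
  assumes "p \<in> alg {z}" "0 < dg z" "dg p < 2 * dg z"
  obtains a b where "p = cst a * z + cst b"
proof -
  have const: "\<exists>b. q = cst b" if q: "q \<in> alg {z}" "dg q < dg z" for q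
  proof (cases "q = 0")
    case True
    then show ?thesis by (metis cst_0)
  next
    case False
    obtain n where "dg q = real n * dg z" using alg1_deg[OF q(1) assms(2) False] by metis
    have "n = 0"
    proof -
      have "real n * dg z < 1 * dg z" using q(2) assms(2) \<open>dg q = real n * dg z\<close> by simp
      then have "real n < 1" using assms(2) mult_less_cancel_right_pos by blast
      then show ?thesis by simp
    qed
    then have dq: "dg q = dg (cst 1)" using \<open>dg q = real n * dg z\<close> dg_mon[of 1 0] by (simp add: cst_def)
    obtain c where c: "dg (q - cst c * cst 1) < dg q" using cancel_top[OF dq False] by metis
    then have "dg (q - cst c) < 0" using dq dg_mon[of 1 0] by (simp flip: cst_def)
    then have "q - cst c = 0" using dg_nonneg[of "q - cst c"] by force
    then show ?thesis by auto
  qed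
  show ?thesis
  proof (cases "dg p < dg z")
    case True
    then show ?thesis using const[OF assms(1)] that[of 0] by auto
  next
    case False
    then have nz: "p \<noteq> 0" using assms(2) by auto
    obtain n where n: "dg p = real n * dg z" using alg1_deg[OF assms(1,2) nz] by metis
    then have "real n < 2" "\<not> real n < 1" using False assms by auto
    then have "n = 1" by linarith
    then obtain c where c: "dg (p - cst c * z) < dg p" using cancel_top[of p z] nz n by auto
    have "p - cst c * z \<in> alg {z}" using assms(1) by (auto intro!: alg_rules intro: alg_gen)
    then obtain b where "p - cst c * z = cst b" using const c n \<open>n = 1\<close> by auto
    then show ?thesis using that[of c b] by (metis add.commute diff_add_cancel)
  qed
qed

text \<open>Degrees lie in a discrete set, so real degrees can serve as a termination measure.\<close>

definition rk :: "real \<Rightarrow> nat" where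
  "rk r = card {a. wt a \<le> r}"

lemma rk_less: "r < wt a \<Longrightarrow> rk r < rk (wt a)"
  unfolding rk_def
proof (rule psubset_card_mono[OF wt_finite], rule psubsetI)
  assume "r < wt a"
  then show "{b. wt b \<le> r} \<subseteq> {b. wt b \<le> wt a}" by auto
  have "a \<in> {b. wt b \<le> wt a}" "a \<notin> {b. wt b \<le> r}" using \<open>r < wt a\<close> by auto
  then show "{b. wt b \<le> r} \<noteq> {b. wt b \<le> wt a}" by blast
qed

lemma min_dg:
  assumes "x \<in> X"
  obtains m where "m \<in> X" "\<And>y. y \<in> X \<Longrightarrow> dg m \<le> dg y"
proof -
  obtain m where m: "m \<in> X" "\<And>y. y \<in> X \<Longrightarrow> rk (dg m) \<le> rk (dg y)"
    using ex_has_least_nat[of "\<lambda>x. x \<in> X" x "\<lambda>x. rk (dg x)"] assms by blast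
  have "dg m \<le> dg y" if y: "y \<in> X" for y
  proof (rule ccontr)
    assume "\<not> dg m \<le> dg y"
    moreover have "m \<noteq> 0" using calculation dg_ge_m1[of y] by auto
    then obtain a where "dg m = wt a" by (rule dg_top)
    ultimately have "rk (dg y) < rk (dg m)" using rk_less[of "dg y" a] by simp
    then show False using m(2)[OF y] by simp
  qed
  then show ?thesis using that m by blast
qed

subsection \<open>Reducible triples\<close>

text \<open>\<open>hub\<close> collects the conditions of a Shestakov--Umirbaev reduction on the triple
\<open>(f, g1, g2)\<close>, and \<open>mates\<close> those on its companions \<open>(f, f1, f2)\<close>. The lower bound on \<open>br f g2\<close>
says that \<open>df \<and> dg2\<close> is as large as if \<open>f\<close> were a polynomial in \<open>g1\<close>, \<open>g2\<close>.\<close>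

definition hub :: "real \<Rightarrow> nat \<Rightarrow> mpol \<Rightarrow> mpol \<Rightarrow> mpol \<Rightarrow> bool" where
  "hub \<delta> s f g1 g2 \<longleftrightarrow> 0 < \<delta> \<and> odd s \<and> 3 \<le> s \<and> dg g1 = s * \<delta> \<and> dg g2 = 2 * \<delta> \<and>
     (real s - 2) * \<delta> + br g1 g2 \<le> dg f \<and> dg f < s * \<delta> \<and> (\<forall>j::nat. dg f \<noteq> 2 * real j * \<delta>) \<and>
     s * \<delta> + br g1 g2 \<le> br f g2"

definition mates :: "real \<Rightarrow> nat \<Rightarrow> mpol \<Rightarrow> mpol \<Rightarrow> mpol \<Rightarrow> mpol \<Rightarrow> mpol \<Rightarrow> complex \<Rightarrow> complex \<Rightarrow> complex \<Rightarrow> bool" where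
  "mates \<delta> s f g1 g2 f1 f2 \<alpha> \<beta> \<gamma> \<longleftrightarrow> (\<exists>c1 c2 c0 \<chi>. c1 \<noteq> 0 \<and> c2 \<noteq> 0 \<and> \<chi> \<in> alg {g2} \<and> dg \<chi> \<le> s * \<delta> \<and>
     f1 = cst c1 * g1 + cst \<alpha> * (f * f) + cst \<beta> * f + \<chi> \<and> f2 = cst c2 * g2 + cst \<gamma> * f + cst c0 \<and>
     dg f1 \<le> s * \<delta> \<and> dg f2 \<le> 2 * \<delta>)"

text \<open>A Shestakov-Umirbaev step is thus a chain of moves: g3 to f, then g1 to f1 over (f, g2),
  then g2 to f2 over (f, f1).\<close>

lemma mates_lines:
  assumes "mates \<delta> s f g1 g2 f1 f2 \<alpha> \<beta> \<gamma>"
  shows "line f1 g1 f g2" "line f2 g2 f f1"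
proof -
  obtain c1 c2 c0 \<chi> where *: "c1 \<noteq> 0" "c2 \<noteq> 0" "\<chi> \<in> alg {g2}"
    "f1 = cst c1 * g1 + (cst \<alpha> * (f * f) + cst \<beta> * f + \<chi>)" "f2 = cst c2 * g2 + (cst \<gamma> * f + cst c0)"
    using assms by (auto simp: mates_def add.assoc)
  have f: "f \<in> alg {f, g2}" "f \<in> alg {f, f1}" by (auto intro: alg_gen)
  show "line f1 g1 f g2" using f(1) alg1_alg2(1)[OF *(3), of f] by (intro lineI[OF *(1) _ *(4)] alg_rules)
  show "line f2 g2 f f1" using f(2) by (intro lineI[OF *(2) _ *(5)] alg_rules)
qed

text \<open>Read from conclusion to premise, each rule descends. The base case has the degree sum of
  the variables, and \<open>red_su\<close> bundles several moves because the intermediate ones need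
  not lower the degree.\<close>

inductive red :: "mpol \<Rightarrow> mpol \<Rightarrow> mpol \<Rightarrow> bool" where
  red_base: "keller x y z \<Longrightarrow> dg x + dg y + dg z \<le> sig \<Longrightarrow> red x y z"
| red_swap: "red x y z \<Longrightarrow> red y x z"
| red_rot: "red x y z \<Longrightarrow> red y z x"
| red_elem: "red x' y z \<Longrightarrow> line x x' y z \<Longrightarrow> dg x' < dg x \<Longrightarrow> red x y z"
| red_su: "red g3 g1 g2 \<Longrightarrow> line f g3 g1 g2 \<Longrightarrow> dg g3 < dg f \<Longrightarrow> hub \<delta> s f g1 g2 \<Longrightarrow>
    mates \<delta> s f g1 g2 f1 f2 \<alpha> \<beta> \<gamma> \<Longrightarrow> red f f1 f2"

lemma red_perm: "red x y z \<Longrightarrow> red x z y" "red x y z \<Longrightarrow> red y x z" "red x y z \<Longrightarrow> red y z x"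
  "red x y z \<Longrightarrow> red z x y" "red x y z \<Longrightarrow> red z y x"
  by (blast intro: red_swap red_rot)+

lemma mates_keller:
  assumes "keller f g1 g2" "mates \<delta> s f g1 g2 f1 f2 \<alpha> \<beta> \<gamma>"
  shows "keller f f1 f2"
  using assms mates_lines[OF assms(2)] keller_line keller_perm by metis

lemma red_keller: "red x y z \<Longrightarrow> keller x y z"
proof (induction rule: red.induct)
  case (red_su g3 g1 g2 f \<delta> s f1 f2 \<alpha> \<beta> \<gamma>)
  then show ?case using mates_keller keller_line by metis
qed (auto intro: keller_line keller_perm)

definition su_red :: "mpol \<Rightarrow> mpol \<Rightarrow> mpol \<Rightarrow> bool" where
  "su_red f f1 f2 \<longleftrightarrow> (\<exists>\<delta> s g1 g2 g3 \<alpha> \<beta> \<gamma>. red g3 g1 g2 \<and> line f g3 g1 g2 \<and> dg g3 < dg f \<and>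
     hub \<delta> s f g1 g2 \<and> mates \<delta> s f g1 g2 f1 f2 \<alpha> \<beta> \<gamma>)"

definition el_red :: "mpol \<Rightarrow> mpol \<Rightarrow> mpol \<Rightarrow> bool" where
  "el_red x y z \<longleftrightarrow> (\<exists>x'. red x' y z \<and> line x x' y z \<and> dg x' < dg x)"

lemma el_red_commute: "el_red x y z \<Longrightarrow> el_red x z y"
  unfolding el_red_def using red_perm line_commute by metis

text \<open>Inversion up to permutation of the triple. To show that a triple cannot be reducible,
  each of these alternatives is refuted.\<close>

lemma red_cases:
  assumes "red x y z"
  shows "dg x + dg y + dg z \<le> sig \<or> el_red x y z \<or> el_red y x z \<or> el_red z x y \<or>
    su_red x y z \<or> su_red x z y \<or> su_red y x z \<or> su_red y z x \<or> su_red z x y \<or> su_red z y x"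
  using assms
proof (induction rule: red.induct)
  case (red_swap x y z)
  then show ?case using el_red_commute[of x y z] el_red_commute[of y x z] el_red_commute[of z x y]
    by (auto simp: algebra_simps)
next
  case (red_rot x y z)
  then show ?case using el_red_commute[of x y z] el_red_commute[of y x z] el_red_commute[of z x y]
    by (auto simp: algebra_simps)
next
  case (red_elem x' y z x)
  then have "el_red x y z" unfolding el_red_def by blast
  then show ?case by blast
next
  case (red_su g3 g1 g2 f \<delta> s f1 f2 \<alpha> \<beta> \<gamma>)
  then have "su_red f f1 f2" unfolding su_red_def by blast
  then show ?case by blast
qed simp

text \<open>The bounds on \<open>dg f1\<close> and \<open>dg f2\<close> leave little room for f in
  the companions: f or f^2 can disturb the expected degrees only for s = 3. The brackets follow from
  \<open>two_max\<close> for (f, g1, g2) and from expanding the wedge products. A nontrivial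
  companion makes \<open>br f1 f2\<close> large.\<close>

lemma su_red_facts:
  assumes a: "keller f g1 g2" and h: "hub \<delta> s f g1 g2" and c: "mates \<delta> s f g1 g2 f1 f2 \<alpha> \<beta> \<gamma>"
  shows "dg f2 = 2 * \<delta>"
    and "\<gamma> \<noteq> 0 \<Longrightarrow> dg f < 2 * \<delta> \<and> s = 3"
    and "\<alpha> \<noteq> 0 \<Longrightarrow> dg f \<le> 3/2 * \<delta> \<and> s = 3"
    and "dg f1 = s * \<delta> \<or> s = 3 \<and> dg f = 3/2 * \<delta> \<and> \<alpha> \<noteq> 0"
    and "br f f2 = br f g2"
    and "br f g1 = (real s - 2) * \<delta> + br f g2"
    and "br f f1 = (real s - 2) * \<delta> + br f g2"
    and "\<alpha> = 0 \<Longrightarrow> \<beta> = 0 \<Longrightarrow> \<gamma> = 0 \<Longrightarrow> br f1 f2 = br g1 g2"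
    and "\<alpha> \<noteq> 0 \<or> \<beta> \<noteq> 0 \<or> \<gamma> \<noteq> 0 \<Longrightarrow> br f g2 \<le> br f1 f2"
    and "\<alpha> \<noteq> 0 \<Longrightarrow> dg f + br f g2 \<le> br f1 f2"
proof -
  obtain c1 c2 c0 \<chi> where c1: "c1 \<noteq> 0" and c2: "c2 \<noteq> 0" and chi: "\<chi> \<in> alg {g2}" "dg \<chi> \<le> s * \<delta>"
    and f1: "f1 = cst c1 * g1 + cst \<alpha> * (f * f) + cst \<beta> * f + \<chi>"
    and f2: "f2 = cst c2 * g2 + cst \<gamma> * f + cst c0"
    and le: "dg f1 \<le> s * \<delta>" "dg f2 \<le> 2 * \<delta>"
    using c by (auto simp: mates_def)
  have d: "0 < \<delta>" and s: "odd s" "3 \<le> s" and g: "dg g1 = s * \<delta>" "dg g2 = 2 * \<delta>"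
    and lo: "(real s - 2) * \<delta> + br g1 g2 \<le> dg f" and hi: "dg f < s * \<delta>"
    and odd: "\<And>j::nat. dg f \<noteq> 2 * real j * \<delta>" and gen: "s * \<delta> + br g1 g2 \<le> br f g2"
    using h by (auto simp: hub_def)
  have wedge: "wedge g1 g2 \<noteq> 0" "wedge f g2 \<noteq> 0" "wedge f g1 \<noteq> 0" using keller_wedge[OF a] by auto
  have eps: "0 < br g1 g2" using br_pos wedge by blast
  have f0: "0 < dg f" "f \<noteq> 0" using keller_dg_pos[OF a] by auto
  have slt: "s = 3" if "(real s - 2) * \<delta> < r * \<delta>" "r \<le> 2" for r
  proof -
    have "real s - 2 < 2" using that d by (smt (verit) mult_right_less_imp_less)
    then have "s < 4" by linarith
    then show ?thesis using s by simp
  qed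
  have pos: "0 < (real s - 2) * \<delta>" using s d by simp
  show gam: "dg f < 2 * \<delta> \<and> s = 3" if "\<gamma> \<noteq> 0"
  proof -
    have "\<not> 2 * \<delta> < dg f"
    proof
      assume "2 * \<delta> < dg f"
      then have "dg (cst c2 * g2 + cst \<gamma> * f) = dg f" using g c2 that by (simp add: dg_add_eq)
      then have "dg f2 = dg f" unfolding f2 using dg_cst[of c0] f0 by (simp add: dg_add_eq2)
      then show False using le \<open>2 * \<delta> < dg f\<close> by simp
    qed
    moreover have "dg f \<noteq> 2 * \<delta>" using odd[of 1] by simp
    ultimately show ?thesis using slt[of 2] lo eps by auto
  qed
  show dgf2: "dg f2 = 2 * \<delta>"
  proof -
    have "dg (cst \<gamma> * f + cst c0) < 2 * \<delta>"
      using dg_add[of "cst \<gamma> * f" "cst c0"] dg_cst[of c0] gam d by (cases "\<gamma> = 0") auto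
    then show ?thesis unfolding f2 add.assoc using c2 g by (simp add: dg_add_eq2)
  qed
  have dgff: "dg (f * f) = 2 * dg f" using dg_mult[OF f0(2) f0(2)] by simp
  \<comment> \<open>Degrees of polynomials in g2 are even multiples of delta, while s is
    odd.\<close>
  have chi_lt: "dg \<chi> < s * \<delta>"
  proof (cases "\<chi> = 0")
    case True
    then show ?thesis using f0 hi by simp
  next
    case False
    obtain n where "dg \<chi> = real n * dg g2" using alg1_deg[OF chi(1) _ False] g d by auto
    moreover have "real s \<noteq> real (2 * n)" using s(1) by (metis dvd_triv_left of_nat_eq_iff)
    ultimately show ?thesis using chi(2) g d by (auto simp: order_less_le)
  qed
  show alp: "dg f \<le> 3/2 * \<delta> \<and> s = 3" if "\<alpha> \<noteq> 0"
  proof -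
    \<comment> \<open>Otherwise the term in f^2 would be the top term of f1 and violate its degree
      bound. With the lower bound on \<open>dg f\<close> this leaves s = 3.\<close>
    have "\<not> s * \<delta> < 2 * dg f"
    proof
      assume *: "s * \<delta> < 2 * dg f"
      have "dg (cst c1 * g1 + cst \<alpha> * (f * f)) = 2 * dg f"
        using that c1 g * dgff by (simp add: dg_add_eq)
      then have "dg (cst c1 * g1 + cst \<alpha> * (f * f) + cst \<beta> * f) = 2 * dg f"
        using dg_cst_mult_le[of \<beta> f] f0 by (simp add: dg_add_eq2)
      then have "dg f1 = 2 * dg f" unfolding f1 using chi * by (simp add: dg_add_eq2)
      then show False using le * by simp
    qed
    moreover from this have "2 * ((real s - 2) * \<delta>) < s * \<delta>" using lo eps by linarith
    then have "(real s - 2) * \<delta> < 2 * \<delta>" by (simp add: algebra_simps)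
    then have "s = 3" using slt[of 2] by simp
    ultimately show ?thesis by simp
  qed
  show "dg f1 = s * \<delta> \<or> s = 3 \<and> dg f = 3/2 * \<delta> \<and> \<alpha> \<noteq> 0"
  proof (rule disjCI)
    assume n: "\<not> (s = 3 \<and> dg f = 3/2 * \<delta> \<and> \<alpha> \<noteq> 0)"
    have "dg (cst \<alpha> * (f * f)) < s * \<delta>"
    proof (cases "\<alpha> = 0")
      case True
      then show ?thesis using f0 hi by simp
    next
      case False
      then show ?thesis using n alp dgff by auto
    qed
    then have "dg (cst c1 * g1 + cst \<alpha> * (f * f)) = s * \<delta>" using c1 g by (simp add: dg_add_eq2)
    then have "dg (cst c1 * g1 + cst \<alpha> * (f * f) + cst \<beta> * f) = s * \<delta>"
      using dg_cst_mult_le[of \<beta> f] hi by (simp add: dg_add_eq2)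
    then show "dg f1 = s * \<delta>" unfolding f1 using chi_lt by (simp add: dg_add_eq2)
  qed
  have Wf2: "wedge p f2 = scale_form (cst c2) (wedge p g2) + scale_form (cst \<gamma>) (wedge p f)" for p
    by (simp add: f2 wedge_add wedge_cst_mult)
  have nzc: "cst c2 \<noteq> 0" "cst c1 \<noteq> 0" "dg (cst c2) = 0" "dg (cst c1) = 0"
    using c1 c2 dg_mon[of c1 0] dg_mon[of c2 0] by (auto simp: cst_def mon_def dest: arg_cong[where f = supp])
  have fsm: "fdg (scale_form (cst c) o') = fdg o'" if "c \<noteq> 0" for c o'
    using that by (simp add: fdg_def scale_form_def)
  have br2: "br p f2 = br p g2" if "\<gamma> = 0" for p using that c2 by (simp add: Wf2 fsm)
  show "br f f2 = br f g2" by (simp add: Wf2 wedge_self fsm c2)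
  \<comment> \<open>The bound on \<open>br f g2\<close> makes the g1 term dominate the f term in
    \<open>two_max\<close>, so the g2 term must match it.\<close>
  have tm: "dg f + br g1 g2 < dg g1 + br f g2" using hi gen g eps f0(1) by linarith
  then have "dg g2 + br f g1 = dg g1 + br f g2" by (rule two_max[OF a])
  then show fg1: "br f g1 = (real s - 2) * \<delta> + br f g2" using g s by (simp add: algebra_simps of_nat_diff)
  obtain k where k: "\<And>i. D i \<chi> = k * D i g2" "k \<noteq> 0 \<Longrightarrow> dg k = dg \<chi> - dg g2"
    using alg1_chain[OF chi(1)] g d by auto
  have Wchi: "wedge \<chi> u = scale_form k (wedge g2 u)" "wedge u \<chi> = scale_form k (wedge u g2)" for u
    by (auto simp: wedge_def scale_form_def k algebra_simps)
  have kf: "fdg (scale_form k (wedge f g2)) < br f g1"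
  proof (cases "k = 0")
    case True
    then show ?thesis using br_pos[OF wedge(3)] by simp
  next
    case False
    then have "fdg (scale_form k (wedge f g2)) = dg \<chi> - 2 * \<delta> + br f g2" using k(2) wedge g by (simp add: fdg_scale_form)
    then show ?thesis using fg1 chi_lt s by (simp add: algebra_simps of_nat_diff)
  qed
  define m where "m = cst (\<alpha> + \<alpha>) * f + cst \<beta>"
  have Df1: "D i f1 = cst c1 * D i g1 + m * D i f + k * D i g2" for i
    unfolding f1 der_add exponent.der_cst_mult exponent.der_mult k(1) m_def cst_add
    by (simp add: algebra_simps)
  have "wedge f f1 = scale_form (cst c1) (wedge f g1) + scale_form k (wedge f g2)"
    unfolding wedge_def Df1 scale_form_def by (simp add: algebra_simps)
  then have ff1: "br f f1 = br f g1" using kf by (simp add: fdg_add_eq2 fsm c1)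
  then show "br f f1 = (real s - 2) * \<delta> + br f g2" using fg1 by simp
  have Wf1: "wedge f1 g2 = scale_form (cst c1) (wedge g1 g2) + scale_form m (wedge f g2)"
    unfolding wedge_def Df1 scale_form_def by (simp add: algebra_simps)
  have m0: "m = 0" if "\<alpha> = 0" "\<beta> = 0" using that by (simp add: m_def)
  show "br f1 f2 = br g1 g2" if "\<alpha> = 0" "\<beta> = 0" "\<gamma> = 0"
    using that br2[of f1] Wf1 m0 by (simp add: fsm c1)
  have mdg: "m \<noteq> 0 \<and> dg m = (if \<alpha> \<noteq> 0 then dg f else 0)" if "\<alpha> \<noteq> 0 \<or> \<beta> \<noteq> 0"
  proof (cases "\<alpha> = 0")
    case True
    then show ?thesis using that dg_mon[of \<beta> 0] by (auto simp: m_def cst_def mon_def dest: arg_cong[where f = supp])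
  next
    case False
    then have "\<alpha> + \<alpha> \<noteq> 0" by simp
    then have "dg m = dg f" unfolding m_def using dg_cst[of \<beta>] f0 by (simp add: dg_add_eq2)
    then show ?thesis using False f0 by auto
  qed
  have brf1: "br f1 g2 = (if \<alpha> \<noteq> 0 then dg f else 0) + br f g2" if "\<alpha> \<noteq> 0 \<or> \<beta> \<noteq> 0"
  proof -
    have *: "fdg (scale_form m (wedge f g2)) = (if \<alpha> \<noteq> 0 then dg f else 0) + br f g2"
      using mdg[OF that] wedge by (simp add: fdg_scale_form)
    \<comment> \<open>The genericity clause of \<open>hub\<close> makes dg1 wedge dg2 negligible
      against df wedge dg2.\<close>
    moreover have "br g1 g2 < br f g2" using gen hi lo f0 by linarith
    then have "fdg (scale_form (cst c1) (wedge g1 g2)) < fdg (scale_form m (wedge f g2))"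
      using f0 unfolding * fsm[OF c1] by auto
    ultimately show ?thesis unfolding Wf1 by (simp add: fdg_add_eq)
  qed
  have brf1': "br f1 g2 < (real s - 2) * \<delta> + br f g2" if "\<alpha> = 0"
  proof (cases "\<beta> = 0")
    case True
    then have "br f1 g2 = br g1 g2" using Wf1 m0 that fsm[OF c1, of "wedge g1 g2"] by simp
    moreover have "br g1 g2 < br f g2" using gen hi lo f0 by linarith
    ultimately show ?thesis using pos by linarith
  next
    case False
    then show ?thesis using brf1 that pos by simp
  qed
  have s2: "real (s - 2) = real s - 2" using s by (simp add: of_nat_diff)
  have Wf12: "wedge f1 f2 = scale_form (cst c2) (wedge f1 g2) - scale_form (cst \<gamma>) (wedge f f1)"
    using wedge_swap[of f1 f] by (simp add: Wf2 scale_form_def)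
  have main: "br f1 f2 = (if \<alpha> \<noteq> 0 then dg f + br f g2 else if \<gamma> \<noteq> 0 then (real s - 2) * \<delta> + br f g2 else br f g2)"
    if "\<alpha> \<noteq> 0 \<or> \<beta> \<noteq> 0 \<or> \<gamma> \<noteq> 0"
  proof (cases "\<gamma> = 0")
    case True
    then show ?thesis using br2[OF True, of f1] brf1 that by auto
  next
    case g: False
    have 1: "fdg (scale_form (cst \<gamma>) (wedge f f1)) = (real s - 2) * \<delta> + br f g2"
      using g ff1 fg1 s2 by (simp add: fsm)
    show ?thesis
    proof (cases "\<alpha> = 0")
      case True
      then show ?thesis unfolding Wf12 using brf1'[OF True] 1 g c2 by (simp add: fdg_diff_eq2 fsm)
    next
      case False
      then have "br f1 g2 = dg f + br f g2" using brf1 by simp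
      then show ?thesis unfolding Wf12 using 1 g c2 lo eps False by (simp add: fdg_diff_eq fsm)
    qed
  qed
  show "br f g2 \<le> br f1 f2" if "\<alpha> \<noteq> 0 \<or> \<beta> \<noteq> 0 \<or> \<gamma> \<noteq> 0"
    using main[OF that] f0 pos by auto
  show "dg f + br f g2 \<le> br f1 f2" if "\<alpha> \<noteq> 0" using main that by auto
qed

section \<open>Closure below a degree bound as induction hypothesis, and numerical tests for
  reductions\<close>

definition closed :: "real \<Rightarrow> bool" where
  "closed d \<longleftrightarrow> (\<forall>x y z x'. red x y z \<longrightarrow> dg x + dg y + dg z < d \<longrightarrow> line x' x y z \<longrightarrow> red x' y z)"

lemma closedD:
  assumes "closed d" "red x y z" "dg x + dg y + dg z < d"
  shows "line x' x y z \<Longrightarrow> red x' y z" "line y' y x z \<Longrightarrow> red x y' z" "line z' z x y \<Longrightarrow> red x y z'"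
proof -
  show "line x' x y z \<Longrightarrow> red x' y z" using assms by (auto simp: closed_def)
  show "red x y' z" if "line y' y x z"
  proof -
    have "red y x z" "dg y + dg x + dg z < d" using red_perm(2)[OF assms(2)] assms(3) by auto
    then have "red y' x z" using assms(1) that unfolding closed_def by blast
    then show ?thesis by (rule red_perm(2))
  qed
  show "red x y z'" if "line z' z x y"
  proof -
    have "red z x y" "dg z + dg x + dg y < d" using red_perm(4)[OF assms(2)] assms(3) by auto
    then have "red z' x y" using assms(1) that unfolding closed_def by blast
    then show ?thesis by (rule red_perm(3))
  qed
qed

lemma closed_mono: "closed d \<Longrightarrow> d' \<le> d \<Longrightarrow> closed d'"
  unfolding closed_def by fastforce

text \<open>Equations between degrees contain products of an unknown natural number with a degree.
  Splitting the factor into 0, 1, 2 and at least 3 makes them linear, and here that always decides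
  them.\<close>

lemma of_nat_mult_cases: "0 \<le> x \<Longrightarrow> n = 0 \<and> real n * x = 0 \<or> n = 1 \<and> real n * x = x \<or> n = 2 \<and> real n * x = 2 * x \<or>
    3 \<le> n \<and> 3 * x \<le> real n * x"
  using mult_right_mono[of 3 "real n" x] by (cases "3 \<le> n") (auto simp: numeral_eq_Suc le_Suc_eq not_le less_Suc_eq)

lemma of_nat_mult_casesE:
  assumes "0 \<le> x"
  obtains "n = 0" "real n * x = 0" | "n = 1" "real n * x = x" | "n = 2" "real n * x = 2 * x" |
    "3 \<le> n" "3 * x \<le> real n * x"
  using of_nat_mult_cases[OF assms, of n] by blast

lemma coprime_small: "coprime (3::nat) 4" "coprime (2::nat) 3" "coprime (3::nat) 2"
  using coprime_Suc_right_nat[of 3] coprime_Suc_right_nat[of 2] coprime_Suc_left_nat[of 2] by simp_all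

lemma coprime_ratio:
  assumes "coprime p q" "coprime a b" "0 < \<eta>" "0 < \<delta>" "real p * \<eta> = real a * \<delta>" "real q * \<eta> = real b * \<delta>"
    "0 < a" "0 < b"
  shows "p = a \<and> q = b \<and> \<eta> = \<delta>"
proof -
  have "(real p * real b) * (\<eta> * \<delta>) = (real q * real a) * (\<eta> * \<delta>)"
    using arg_cong2[OF assms(5) assms(6)[symmetric], of "(*)"] by (simp add: algebra_simps)
  then have "real (p * b) = real (q * a)" using assms by simp
  then have e: "p * b = q * a" by linarith
  have "p dvd a" using e assms(1) by (metis coprime_dvd_mult_right_iff dvd_triv_left)
  moreover have "a dvd p" using e assms(2) by (metis coprime_dvd_mult_left_iff dvd_triv_right)
  ultimately have pa: "p = a" by (rule dvd_antisym)
  then have "\<eta> = \<delta>" using assms by simp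
  then show ?thesis using pa assms by simp
qed

text \<open>If p and q are at least 2, then (p - 1) (q - 1) is at least 1 and the gap p q - p - q is
  nonnegative. If one of them is 1, the gap is -1.\<close>

lemma top_cancel_cases:
  assumes "top_cancel p q \<eta> P y z"
  shows "p = 1 \<and> 1 \<le> q \<and> dg z = real q * dg y \<and> br y z - dg y \<le> dg P \<or>
    q = 1 \<and> 1 \<le> p \<and> dg y = real p * dg z \<and> br y z - dg z \<le> dg P \<or>
    2 \<le> p \<and> 2 \<le> q \<and> br y z \<le> dg P"
proof -
  note c = assms[unfolded top_cancel_def]
  consider "p = 1" | "q = 1" | "2 \<le> p" "2 \<le> q" using c by force
  then show ?thesis
  proof cases
    case 3
    have "(1::real) * 1 \<le> (real p - 1) * (real q - 1)" using 3 by (intro mult_mono) auto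
    then have "0 \<le> (real p * real q - p - q) * \<eta>" using c by (intro mult_nonneg_nonneg) (auto simp: algebra_simps)
    then show ?thesis using c 3 by linarith
  qed (use c in auto)
qed

lemma alg2_dg_cases:
  assumes "P \<in> alg {y, z}" "wedge y z \<noteq> 0" "P \<noteq> 0"
  shows "(\<exists>i j. dg P = real i * dg y + real j * dg z) \<or>
    (\<exists>n\<ge>1. dg z = real n * dg y \<and> br y z - dg y \<le> dg P) \<or>
    (\<exists>n\<ge>1. dg y = real n * dg z \<and> br y z - dg z \<le> dg P) \<or> br y z \<le> dg P"
proof -
  consider "no_cancel P y z" | p q \<eta> where "top_cancel p q \<eta> P y z" using cancel[OF assms(1,2)] by blast
  then show ?thesis
  proof cases
    case 1
    then obtain k where "vd y z k = dg P" using assms(3) unfolding no_cancel_def by blast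
    then have "dg P = real (fst k) * dg y + real (snd k) * dg z" by (simp add: vd_def)
    then show ?thesis by blast
  next
    case 2
    then show ?thesis using top_cancel_cases[OF 2] by blast
  qed
qed

text \<open>A necessary numerical condition for an elementary reduction; later proofs exclude
  \<open>el_red\<close> by contradicting the four alternatives.\<close>

lemma el_red_dg_cases:
  assumes "el_red x y z" "keller x y z"
  shows "(\<exists>i j. dg x = real i * dg y + real j * dg z) \<or>
    (\<exists>n\<ge>1. dg z = real n * dg y \<and> br y z - dg y \<le> dg x) \<or>
    (\<exists>n\<ge>1. dg y = real n * dg z \<and> br y z - dg z \<le> dg x) \<or> br y z \<le> dg x"
proof -
  obtain x' c P where *: "c \<noteq> 0" "P \<in> alg {y, z}" "x = cst c * x' + P" "dg x' < dg x"
    using assms(1) by (auto simp: el_red_def line_def)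
  have "dg P = dg x" by (rule dg_move[OF *(1,4,3)])
  moreover from this have "P \<noteq> 0" using keller_dg_pos[OF assms(2)] by auto
  ultimately show ?thesis using alg2_dg_cases[OF *(2) keller_wedge(1)[OF assms(2)]] by simp
qed

lemma no_cancel_quadratic:
  assumes "no_cancel P y z" "0 < dg y" "0 < dg z" "dg P < 3 * dg y" "dg P < dg y + dg z"
  obtains e2 e1 \<chi> where "P = cst e2 * (y * y) + cst e1 * y + \<chi>" "\<chi> \<in> alg {z}" "dg \<chi> \<le> dg P"
    "dg P < 2 * dg y \<Longrightarrow> e2 = 0" "dg P < dg y \<Longrightarrow> e1 = 0 \<and> e2 = 0"
proof -
  obtain S c where S: "finite S" "P = ev S c y z" "\<And>k. k \<in> S \<Longrightarrow> vd y z k \<le> dg P"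
    using assms(1) unfolding no_cancel_def by blast
  define c' where "c' k = (if k \<in> S then c k else 0)" for k
  define T where "T = {k \<in> S. fst k = 0}"
  have sub: "S \<subseteq> {(2, 0), (1, 0)} \<union> T"
  proof
    fix k assume k: "k \<in> S"
    obtain i j where ij: "k = (i, j)" by fastforce
    have *: "real i * dg y + real j * dg z \<le> dg P" using S(3)[OF k] by (simp add: vd_def ij)
    have "i \<noteq> 0 \<Longrightarrow> j = 0 \<and> (i = 1 \<or> i = 2)"
      using assms * by - (rule of_nat_mult_casesE[of "dg y" i]; rule of_nat_mult_casesE[of "dg z" j]; linarith)
    then show "k \<in> {(2, 0), (1, 0)} \<union> T" using k ij by (cases "i = 0") (auto simp: T_def)
  qed
  have fin: "finite T" using S by (simp add: T_def)
  have "P = ev S c' y z" by (simp add: S(2) ev_def c'_def)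
  also have "\<dots> = ev ({(2, 0), (1, 0)} \<union> T) c' y z"
    by (rule ev_restrict[symmetric]) (use sub fin in \<open>auto simp: c'_def\<close>)
  also have "\<dots> = ev {(2, 0), (1, 0)} c' y z + ev T c' y z"
    unfolding ev_def by (rule sum.union_disjoint) (use fin in \<open>auto simp: T_def\<close>)
  also have "ev {(2, 0), (1, 0)} c' y z = cst (c' (2, 0)) * (y * y) + cst (c' (1, 0)) * y"
    by (simp add: ev_def power2_eq_square)
  finally have P: "P = cst (c' (2, 0)) * (y * y) + cst (c' (1, 0)) * y + ev T c' y z" .
  show thesis
  proof (rule that[OF P])
    show "ev T c' y z \<in> alg {z}"
      unfolding ev_def by (intro alg_sum) (auto simp: T_def intro!: alg_rules intro: alg_gen)
    show "dg (ev T c' y z) \<le> dg P"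
      unfolding ev_def
    proof (rule dg_sum_le[OF dg_ge_m1])
      fix k assume k: "k \<in> T"
      then have "vd y z k \<le> dg P" using S by (simp add: T_def)
      then show "dg (cst (c' k) * (y ^ fst k * z ^ snd k)) \<le> dg P"
        using dg_monomial[OF assms(2,3), of "c' k" "fst k" "snd k"] dg_ge_m1[of P]
        by (cases "c' k = 0") (auto simp: vd_def)
    qed
    have "(2, 0) \<in> S \<Longrightarrow> 2 * dg y \<le> dg P" "(1, 0) \<in> S \<Longrightarrow> dg y \<le> dg P"
      using S(3)[of "(2, 0)"] S(3)[of "(1, 0)"] by (auto simp: vd_def)
    then show "dg P < 2 * dg y \<Longrightarrow> c' (2, 0) = 0" "dg P < dg y \<Longrightarrow> c' (1, 0) = 0 \<and> c' (2, 0) = 0"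
      using assms(2) by (auto simp: c'_def)
  qed
qed

lemma alg1_deg_odd:
  assumes "f \<in> alg {z}" "dg z = 2 * \<delta>" "0 < \<delta>" "odd s" "dg f \<le> real s * \<delta>"
  shows "dg f < real s * \<delta>"
proof (cases "f = 0")
  case True
  have "0 < s" using assms(4) by (cases s) auto
  then have "0 < real s * \<delta>" using assms(3) by simp
  then show ?thesis using True by simp
next
  case False
  obtain n where "dg f = real n * dg z" using alg1_deg[OF assms(1) _ False] assms by auto
  moreover have "real s \<noteq> real (2 * n)" using assms(4) by (metis dvd_triv_left of_nat_eq_iff)
  ultimately show ?thesis using assms by (auto simp: order_less_le)
qed

text \<open>The numerical trace of a Shestakov-Umirbaev reduction, from which most instances are
  refuted by comparing brackets.\<close>

lemma su_red_data:
  assumes "su_red f f1 f2"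
  obtains \<delta> s where "0 < \<delta>" "3 \<le> s" "odd s" "dg f2 = 2 * \<delta>" "br f f1 = (real s - 2) * \<delta> + br f f2"
    "real s * \<delta> < br f f2" "(real s - 2) * \<delta> < dg f" "dg f < real s * \<delta>"
proof -
  obtain \<delta> s g1 g2 g3 \<alpha> \<beta> \<gamma> where *: "red g3 g1 g2" "line f g3 g1 g2" "hub \<delta> s f g1 g2"
    "mates \<delta> s f g1 g2 f1 f2 \<alpha> \<beta> \<gamma>" using assms unfolding su_red_def by blast
  have a: "keller f g1 g2" using red_keller[OF *(1)] *(2) keller_line by blast
  note f = su_red_facts[OF a *(3,4)]
  have "0 < br g1 g2" using keller_wedge[OF a] br_pos by blast
  then show ?thesis using that[of \<delta> s] f *(3) by (auto simp: hub_def)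
qed

text \<open>Without f in the companions, they generate the same algebra as g1 and g2, and the
  reduction of f becomes an elementary one.\<close>

lemma mates_trivial:
  assumes "mates \<delta> s f g1 g2 f1 f2 0 0 0"
  shows "line1 f1 g1 g2" "line1 f2 g2 u" "alg {f1, f2} = alg {g1, g2}"
proof -
  obtain c1 c2 c0 \<chi> where *: "c1 \<noteq> 0" "c2 \<noteq> 0" "\<chi> \<in> alg {g2}" "f1 = cst c1 * g1 + \<chi>" "f2 = cst c2 * g2 + cst c0"
    using assms by (auto simp: mates_def)
  show 1: "line1 f1 g1 g2" using * by (intro line1I[of c1 \<chi>])
  have 2: "line1 f2 g2 u" for u using * by (intro line1I[of c2 "cst c0"] alg_cst)
  then show "line1 f2 g2 u" by blast
  have "alg {f1, f2} = alg {f1, g2}" using line1_alg_eq[OF 2, of f1] by (simp add: insert_commute)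
  then show "alg {f1, f2} = alg {g1, g2}" using line1_alg_eq[OF 1] by simp
qed

text \<open>A move of x by z alone commutes with the descent of y: perform it at the smaller triple
  with y0, then raise y0 to y.\<close>

lemma red_line1_move:
  assumes cl: "closed d" and r: "red x y0 z" and y: "line y y0 x z" "dg y0 < dg y"
    and d: "dg x + dg y + dg z \<le> d" and x': "line1 x' x z" "dg x' \<le> dg x"
  shows "red x' y z"
proof -
  have "red x' y0 z" using closedD(1)[OF cl r] y d line1_line(1)[OF x'(1)] by simp
  moreover have "line y y0 x' z" using line_line1[OF y(1) x'(1)] .
  ultimately show ?thesis using closedD(2)[OF cl, of x' y0 z y] y d x' by simp
qed

text \<open>If y can also be lowered by z alone, the move of x is carried out at that lower y', over
  the same algebra, and y is restored afterwards.\<close>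

lemma red_line_move:
  assumes cl: "closed d" and r: "red x y0 z" and y: "line y y0 x z" "dg y0 < dg y"
    and d: "dg x + dg y + dg z \<le> d" and y': "line1 y' y z" "dg y' < dg y"
    and x': "line x' x y z" "dg x' \<le> dg x"
  shows "red x' y z"
proof -
  have "line y' y0 x z" using line_trans[OF line1_line(1)[OF y'(1)] y(1)] .
  then have r1: "red x y' z" using closedD(2)[OF cl r] y d by simp
  have "line x' x y' z" using line_line1[OF x'(1) y'(1)] .
  then have r2: "red x' y' z" using closedD(1)[OF cl r1] y' d by simp
  have "line y y' x' z" using line1_line(1)[OF line1_sym[OF y'(1)]] .
  then show ?thesis using closedD(2)[OF cl r2] y' d x' by simp
qed

section \<open>The exceptional degrees 3/2, 3, 2, where a square has the degree of another
  component\<close>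

lemma square_chain:
  assumes "g1 = cst c * u + cst e * (v * v) + cst e1 * v + \<chi>" "\<chi> \<in> alg {w}" "0 < dg w" "e \<noteq> 0" "0 < dg v"
  obtains m k where "\<And>i. D i g1 = cst c * D i u + m * D i v + k * D i w" "m \<noteq> 0" "dg m = dg v"
    "k \<noteq> 0 \<Longrightarrow> dg k = dg \<chi> - dg w"
proof -
  obtain k where k: "\<And>i. D i \<chi> = k * D i w" "k \<noteq> 0 \<Longrightarrow> dg k = dg \<chi> - dg w"
    using alg1_chain[OF assms(2,3)] by blast
  define m where "m = cst (e + e) * v + cst e1"
  have "D i g1 = cst c * D i u + m * D i v + k * D i w" for i
    unfolding assms(1) der_add exponent.der_cst_mult exponent.der_mult k(1) m_def cst_add
    by (simp add: algebra_simps)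
  moreover have "e + e \<noteq> 0" using assms(4) by simp
  then have "dg m = dg v" unfolding m_def using dg_cst[of e1] assms(5) by (simp add: dg_add_eq2)
  moreover from this have "m \<noteq> 0" using assms(5) by auto
  ultimately show ?thesis using that k by blast
qed

text \<open>Here dg1 wedge dw is too small to absorb the contribution m dv wedge dw of the square,
  so du wedge dw has to compensate it.\<close>

lemma square_forms:
  assumes "\<And>i. D i g1 = cst c * D i u + m * D i v + k * D i w" "c \<noteq> 0" "m \<noteq> 0" "wedge v w \<noteq> 0"
    "br g1 w < dg m + br v w"
  shows "br u w = dg m + br v w"
proof -
  have "scale_form (cst c) (wedge u w) = wedge g1 w - scale_form m (wedge v w)"
    by (auto simp: wedge_def scale_form_def assms(1) algebra_simps)
  moreover have "fdg (scale_form m (wedge v w)) = dg m + br v w" using assms by (simp add: fdg_scale_form)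
  ultimately have "fdg (scale_form (cst c) (wedge u w)) = dg m + br v w" using assms(5) by (simp add: fdg_diff_eq2)
  then show ?thesis using assms(2) by (simp add: fdg_def scale_form_def)
qed

text \<open>With u of minimal degree, brackets exclude every reduction of (u, v, w) except one with
  hub v and companions u, w. Then g1 and w are also companions, and the smallness of
  \<open>br g1 w\<close> forces them to be trivial, so v descends over (g1, w). The constant 13/2 is
  the degree sum 3/2 + 3 + 2.\<close>

lemma exceptional_partner:
  assumes cl: "closed d" and \<delta>: "0 < \<delta>" and r: "red u v w" and v: "dg v = 3/2 * \<delta>" and w: "dg w = 2 * \<delta>"
    and u: "dg u < 3 * \<delta>" and g1: "g1 = cst c * u + cst e * (v * v) + cst e1 * v + \<chi>"
    and c: "c \<noteq> 0" and e: "e \<noteq> 0" and chi: "\<chi> \<in> alg {w}" "dg \<chi> \<le> 3 * \<delta>" and dg1: "dg g1 = 3 * \<delta>"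
    and eps: "br g1 w \<le> \<delta> / 2" and kap: "3/2 * \<delta> < br v w" and d: "13/2 * \<delta> \<le> d"
  shows "\<exists>v'. red v' g1 w \<and> line v v' g1 w \<and> dg v' < dg v"
proof -
  \<comment> \<open>Minimality of u in this set excludes that its top term is cancelled by a
    multiple of v or w: these changes only alter \<open>e1\<close> and
    \<open>\<chi>\<close>.\<close>
  define U where "U = {u. red u v w \<and> dg u < 3 * \<delta> \<and> (\<exists>c e1 \<chi>. c \<noteq> 0 \<and> \<chi> \<in> alg {w} \<and> dg \<chi> \<le> 3 * \<delta> \<and>
     g1 = cst c * u + cst e * (v * v) + cst e1 * v + \<chi>)}"
  have "u \<in> U" using r u g1 c chi unfolding U_def by blast
  then obtain u where uU: "u \<in> U" and umin: "\<And>y. y \<in> U \<Longrightarrow> dg u \<le> dg y" using min_dg by metis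
  obtain c e1 \<chi> where r: "red u v w" and u: "dg u < 3 * \<delta>" and c: "c \<noteq> 0" and chi: "\<chi> \<in> alg {w}" "dg \<chi> \<le> 3 * \<delta>"
    and g1: "g1 = cst c * u + cst e * (v * v) + cst e1 * v + \<chi>"
    using uU unfolding U_def by blast
  define k where "k = br v w"
  have a: "keller u v w" by (rule red_keller[OF r])
  have wedge: "wedge v w \<noteq> 0" "wedge u w \<noteq> 0" "wedge u v \<noteq> 0" using keller_wedge[OF a] by auto
  have vw: "v \<in> alg {v, w}" "\<chi> \<in> alg {v, w}" using chi(1) by (auto intro: alg_gen alg1_alg2)
  have "line g1 u v w"
    using c vw by (intro lineI[of c "cst e * (v * v) + cst e1 * v + \<chi>"] alg_rules) (auto simp: g1 add.assoc)
  then have "keller g1 v w" using a keller_line by blast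
  then have ag: "keller v g1 w" by (rule keller_perm)
  obtain m h where mh: "\<And>i. D i g1 = cst c * D i u + m * D i v + h * D i w" "m \<noteq> 0" "dg m = dg v"
    "h \<noteq> 0 \<Longrightarrow> dg h = dg \<chi> - dg w"
    using square_chain[OF g1 chi(1)] w v \<delta> e by auto
  have uw: "br u w = 3/2 * \<delta> + k"
    using square_forms[OF mh(1) c mh(2) wedge(1)] mh(3) v eps kap \<delta> by (simp add: k_def)
  have "dg v + br g1 w < dg g1 + br v w" using v dg1 eps kap \<delta> by linarith
  then have "dg w + br v g1 = dg g1 + br v w" by (rule two_max[OF ag])
  then have vg: "br v g1 = \<delta> + k" using w dg1 by (simp add: k_def)
  have uv: "br u v = \<delta> + k"
  proof -
    have eq: "scale_form (cst c) (wedge u v) = wedge g1 v - scale_form h (wedge w v)"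
      by (auto simp: wedge_def scale_form_def mh(1) algebra_simps)
    have "fdg (scale_form h (wedge w v)) < br g1 v"
    proof (cases "h = 0")
      case True
      then show ?thesis using vg br_swap[of g1 v] kap \<delta> by (simp add: k_def)
    next
      case False
      then have "fdg (scale_form h (wedge w v)) = dg h + k" using wedge fdg_scale_form[of h "wedge w v"] wedge_swap[of w v] br_swap[of w v]
        by (auto simp: k_def)
      moreover have "dg \<chi> < 3 * \<delta>" using alg1_deg_odd[OF chi(1) w \<delta>, of 3] chi(2) by simp
      ultimately show ?thesis using mh(4)[OF False] vg w br_swap[of g1 v] by simp
    qed
    then have "fdg (scale_form (cst c) (wedge u v)) = br g1 v" unfolding eq by (rule fdg_diff_eq)
    then show ?thesis using c vg br_swap[of g1 v] by (simp add: fdg_def scale_form_def)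
  qed
  have "br u w \<le> dg u + dg w" by (rule br_le[OF wedge(2)])
  \<comment> \<open>The bracket \<open>br u w\<close> is 3/2 delta + \<open>k\<close> with
    \<open>k\<close> above 3/2 delta; since it is at most \<open>dg u + dg w\<close>, it bounds
    \<open>dg u\<close> from below.\<close>
  then have tu: "\<delta> < dg u" using uw w kap by (simp add: k_def)
  have dlow: "dg u + dg v + dg w < d" using u v w d by simp
  have n1: "dg u \<noteq> 3/2 * \<delta>"
  proof
    assume "dg u = 3/2 * \<delta>"
    then have "dg u = dg v" "u \<noteq> 0" using v tu \<delta> by auto
    then obtain b where b: "b \<noteq> 0" "dg (u - cst b * v) < dg u" by (rule cancel_top)
    have "red (u - cst b * v) v w"
      by (rule closedD(1)[OF cl r dlow], rule lineI[of 1 "- (cst b * v)"]) (auto intro!: alg_rules vw)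
    moreover have "g1 = cst c * (u - cst b * v) + cst e * (v * v) + cst (e1 + c * b) * v + \<chi>"
      unfolding g1 cst_add cst_mult by (simp add: algebra_simps)
    ultimately have "u - cst b * v \<in> U" using c chi b u unfolding U_def by fastforce
    then show False using umin b by fastforce
  qed
  have n2: "dg u \<noteq> 2 * \<delta>"
  proof
    assume "dg u = 2 * \<delta>"
    then have "dg u = dg w" "u \<noteq> 0" using w tu \<delta> by auto
    then obtain b where b: "b \<noteq> 0" "dg (u - cst b * w) < dg u" by (rule cancel_top)
    have "red (u - cst b * w) v w"
      by (rule closedD(1)[OF cl r dlow], rule lineI[of 1 "- (cst b * w)"]) (auto intro!: alg_rules intro: alg_gen)
    moreover have "g1 = cst c * (u - cst b * w) + cst e * (v * v) + cst e1 * v + (\<chi> + cst (c * b) * w)"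
      unfolding g1 cst_mult by (simp add: algebra_simps)
    moreover have "\<chi> + cst (c * b) * w \<in> alg {w}" using chi by (auto intro!: alg_rules intro: alg_gen)
    moreover have "dg (\<chi> + cst (c * b) * w) \<le> 3 * \<delta>"
      using dg_add[of \<chi> "cst (c * b) * w"] dg_cst_mult_le[of "c * b" w] chi w \<delta> by simp
    ultimately have "u - cst b * w \<in> U" using c b u unfolding U_def by fastforce
    then show False using umin b by fastforce
  qed
  have sig: "sig \<le> 2 * \<delta>" using keller_sig[OF ag] v eps by simp
  have E1: "\<not> el_red u v w"
  proof
    assume "el_red u v w"
    then obtain u' b P where *: "b \<noteq> 0" "P \<in> alg {v, w}" "u = cst b * u' + P" "dg u' < dg u"
      by (auto simp: el_red_def line_def)
    have dP: "dg P = dg u" by (rule dg_move[OF *(1,4,3)])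
    then have P0: "P \<noteq> 0" using tu \<delta> by auto
    consider "no_cancel P v w" | p q \<eta> where "top_cancel p q \<eta> P v w" using cancel[OF *(2) wedge(1)] by blast
    then show False
    proof cases
      case 1
      then obtain i j where ij: "real i * dg v + real j * dg w = dg u" using P0 dP by (auto simp: no_cancel_def vd_def)
      have "0 \<le> dg v" "0 \<le> dg w" using v w \<delta> by auto
      then show False using ij v w n1 n2 u tu \<delta>
        by - (rule of_nat_mult_casesE[of "dg v" i]; rule of_nat_mult_casesE[of "dg w" j]; linarith)
    next
      case 2
      note C = 2[unfolded top_cancel_def]
      have "real p * \<eta> = real 3 * (\<delta> / 2)" "real q * \<eta> = real 4 * (\<delta> / 2)" using C v w by auto
      then have "p = 3 \<and> q = 4 \<and> \<eta> = \<delta> / 2"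
        using C \<delta> coprime_small(1) by (intro coprime_ratio) auto
      then show False using C dP u kap by (auto simp: k_def)
    qed
  qed
  have E2: "\<not> el_red v u w"
  proof
    assume "el_red v u w"
    then have "(\<exists>i j. dg v = real i * dg u + real j * dg w) \<or>
      (\<exists>n\<ge>1. dg w = real n * dg u \<and> br u w - dg u \<le> dg v) \<or>
      (\<exists>n\<ge>1. dg u = real n * dg w \<and> br u w - dg w \<le> dg v) \<or> br u w \<le> dg v"
      using el_red_dg_cases keller_perm(1)[OF a] by blast
    then show False
    proof (elim disjE exE conjE)
      fix i j assume "dg v = real i * dg u + real j * dg w"
      then show False using v w n1 n2 u tu \<delta> by - (rule of_nat_mult_casesE[of "dg u" i]; rule of_nat_mult_casesE[of "dg w" j]; linarith)
    next
      fix n :: nat assume "1 \<le> n" "dg w = real n * dg u" "br u w - dg u \<le> dg v"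
      then show False using v w n2 u tu \<delta> uw kap[folded k_def] by - (rule of_nat_mult_casesE[of "dg u" n]; linarith)
    next
      fix n :: nat assume "1 \<le> n" "dg u = real n * dg w" "br u w - dg w \<le> dg v"
      then show False using v w n2 u tu \<delta> uw kap[folded k_def] by - (rule of_nat_mult_casesE[of "dg w" n]; linarith)
    qed (use uw v \<delta> kap[folded k_def] in linarith)
  qed
  have E3: "\<not> el_red w u v"
  proof
    assume "el_red w u v"
    then have "(\<exists>i j. dg w = real i * dg u + real j * dg v) \<or>
      (\<exists>n\<ge>1. dg v = real n * dg u \<and> br u v - dg u \<le> dg w) \<or>
      (\<exists>n\<ge>1. dg u = real n * dg v \<and> br u v - dg v \<le> dg w) \<or> br u v \<le> dg w"
      using el_red_dg_cases keller_perm(4)[OF a] by blast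
    then show False
    proof (elim disjE exE conjE)
      fix i j assume "dg w = real i * dg u + real j * dg v"
      then show False using v w n1 n2 u tu \<delta> by - (rule of_nat_mult_casesE[of "dg u" i]; rule of_nat_mult_casesE[of "dg v" j]; linarith)
    next
      fix n :: nat assume "1 \<le> n" "dg v = real n * dg u" "br u v - dg u \<le> dg w"
      then show False using v w n1 u tu \<delta> uv kap[folded k_def] by - (rule of_nat_mult_casesE[of "dg u" n]; linarith)
    next
      fix n :: nat assume "1 \<le> n" "dg u = real n * dg v" "br u v - dg v \<le> dg w"
      then show False using v w n1 u tu \<delta> uv kap[folded k_def] by - (rule of_nat_mult_casesE[of "dg v" n]; linarith)
    qed (use uv w \<delta> kap[folded k_def] in linarith)
  qed
  have br: "br v w = k" "br w v = k" "br w u = 3/2 * \<delta> + k" "br v u = \<delta> + k"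
    using uw uv br_swap[of w v] br_swap[of w u] br_swap[of v u] by (auto simp: k_def)
  have pos: "0 < (real s - 2) * e" "e \<le> (real s - 2) * e" if "3 \<le> s" "0 < e" for s :: nat and e :: real
  proof -
    have "1 * e \<le> (real s - 2) * e" using that by (intro mult_right_mono) auto
    then show "0 < (real s - 2) * e" "e \<le> (real s - 2) * e" using that by auto
  qed
  have "su_red v u w"
  proof -
    have "\<not> su_red u v w"
    proof
      assume "su_red u v w"
      then obtain \<delta>' s where "0 < \<delta>'" "3 \<le> s" "br u v = (real s - 2) * \<delta>' + br u w"
        by (rule su_red_data)
      then show False using pos(1)[of s \<delta>'] uv uw \<delta> by linarith
    qed
    moreover have "\<not> su_red u w v"
    proof
      assume "su_red u w v"
      then obtain \<delta>' s where "0 < \<delta>'" "3 \<le> s" "dg v = 2 * \<delta>'" "br u w = (real s - 2) * \<delta>' + br u v"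
        by (rule su_red_data)
      then show False using pos(2)[of s \<delta>'] uv uw v \<delta> by linarith
    qed
    moreover have "\<not> su_red v w u"
    proof
      assume "su_red v w u"
      then obtain \<delta>' s where "0 < \<delta>'" "3 \<le> s" "br v w = (real s - 2) * \<delta>' + br v u"
        by (rule su_red_data)
      then show False using pos(1)[of s \<delta>'] br \<delta> by linarith
    qed
    moreover have "\<not> su_red w u v"
    proof
      assume "su_red w u v"
      then obtain \<delta>' s where *: "0 < \<delta>'" "odd s" "dg v = 2 * \<delta>'" "br w u = (real s - 2) * \<delta>' + br w v"
        by (rule su_red_data)
      \<comment> \<open>The bracket difference is 3/2 delta, which is also \<open>dg v\<close> = 2
        delta'. This would make s even.\<close>
      then have "(real s - 2) * \<delta>' = 2 * \<delta>'" using br v by linarith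
      then have "s = 4" using * by simp
      then show False using * by simp
    qed
    moreover have "\<not> su_red w v u"
    proof
      assume "su_red w v u"
      then obtain \<delta>' s where "0 < \<delta>'" "3 \<le> s" "br w v = (real s - 2) * \<delta>' + br w u"
        by (rule su_red_data)
      then show False using pos(1)[of s \<delta>'] br \<delta> by linarith
    qed
    moreover have "\<not> dg u + dg v + dg w \<le> sig" using sig tu v w \<delta> by linarith
    ultimately show ?thesis using red_cases[OF r] E1 E2 E3 by blast
  qed
  then obtain \<delta>' s g1' g2' g3 \<alpha> \<beta> \<gamma> where su: "red g3 g1' g2'" "line v g3 g1' g2'" "dg g3 < dg v"
    "hub \<delta>' s v g1' g2'" "mates \<delta>' s v g1' g2' u w \<alpha> \<beta> \<gamma>" unfolding su_red_def by blast
  have a': "keller v g1' g2'" using red_keller[OF su(1)] su(2) keller_line by blast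
  note F = su_red_facts[OF a' su(4,5)]
  have \<delta>': "\<delta>' = \<delta>" using F(1) w by simp
  have s3: "s = 3" using F(5,7) br \<delta> by (simp add: \<delta>')
  obtain c1 c2 c0 \<chi>' where ma: "c1 \<noteq> 0" "c2 \<noteq> 0" "\<chi>' \<in> alg {g2'}" "dg \<chi>' \<le> 3 * \<delta>"
    "u = cst c1 * g1' + cst \<alpha> * (v * v) + cst \<beta> * v + \<chi>'" "w = cst c2 * g2' + cst \<gamma> * v + cst c0"
    using su(5) unfolding mates_def s3 \<delta>' by auto
  have dg2': "dg g2' = 2 * \<delta>" "dg g1' = 3 * \<delta>" using su(4) by (auto simp: hub_def \<delta>' s3)
  \<comment> \<open>A polynomial in w of degree at most 3 delta is affine, since w^2 has degree 4
    delta. So it can be rewritten through g2' and v.\<close>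
  obtain a1 b1 where lin: "\<chi> = cst a1 * w + cst b1"
    using alg1_linear[OF chi(1)] chi(2) w \<delta> by auto
  define \<chi>2 where "\<chi>2 = cst c * \<chi>' + cst (a1 * c2) * g2' + cst (a1 * c0 + b1)"
  have chi2: "\<chi>2 \<in> alg {g2'}" "dg \<chi>2 \<le> 3 * \<delta>"
  proof -
    show "\<chi>2 \<in> alg {g2'}" unfolding \<chi>2_def using ma(3) by (auto intro!: alg_rules intro: alg_gen)
    have "dg (cst c * \<chi>') \<le> 3 * \<delta>" "dg (cst (a1 * c2) * g2') \<le> 3 * \<delta>" "dg (cst (a1 * c0 + b1)) \<le> 3 * \<delta>"
      using dg_cst_mult_le[of c \<chi>'] dg_cst_mult_le[of "a1 * c2" g2'] dg_cst[of "a1 * c0 + b1"] ma(4) dg2' \<delta> by auto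
    then show "dg \<chi>2 \<le> 3 * \<delta>" unfolding \<chi>2_def
      using dg_add[of "cst c * \<chi>' + cst (a1 * c2) * g2'" "cst (a1 * c0 + b1)"] dg_add[of "cst c * \<chi>'" "cst (a1 * c2) * g2'"]
      by linarith
  qed
  have g1eq: "g1 = cst (c * c1) * g1' + cst (c * \<alpha> + e) * (v * v) + cst (c * \<beta> + a1 * \<gamma> + e1) * v + \<chi>2"
    unfolding g1 lin \<chi>2_def cst_add cst_mult ma(5,6) by (simp add: algebra_simps)
  have ma2: "mates \<delta> 3 v g1' g2' g1 w (c * \<alpha> + e) (c * \<beta> + a1 * \<gamma> + e1) \<gamma>"
    unfolding mates_def
    by (intro exI[of _ "c * c1"] exI[of _ c2] exI[of _ c0] exI[of _ \<chi>2])
      (use c ma chi2 g1eq dg1 w in auto)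
  note F2 = su_red_facts[OF a' su(4)[unfolded \<delta>' s3] ma2]
  \<comment> \<open>A nontrivial companion would make \<open>br g1 w\<close> at least
    \<open>br v g2'\<close>, so all coefficients of v and v^2 vanish.\<close>
  have "br g1 w < br v g2'" using F2(5) eps kap \<delta> by simp
  then have z: "c * \<alpha> + e = 0 \<and> c * \<beta> + a1 * \<gamma> + e1 = 0 \<and> \<gamma> = 0" using F2(9) by linarith
  then have ma3: "mates \<delta> 3 v g1' g2' g1 w 0 0 0" using ma2 by metis
  note tr = mates_trivial[OF ma3]
  have d3: "dg g3 + dg g1' + dg g2' < d" using su(3) v dg2' d by simp
  have "red g3 g1 g2'" using closedD(2)[OF cl su(1) d3] line1_line(1)[OF tr(1)] by blast
  then have "red g3 g1 w" using closedD(3)[OF cl, of g3 g1 g2' w] d3 dg2' dg1 line1_line(1)[OF tr(2)] by simp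
  moreover have "line v g3 g1 w" using line_alg_cong[OF su(2)] tr(3) by simp
  ultimately show ?thesis using su(3) by blast
qed

section \<open>Genericity of hubs\<close>

lemma odd_mult_bounds:
  assumes "3 \<le> (s::nat)" "0 < (\<delta>::real)"
  shows "\<delta> \<le> (real s - 2) * \<delta>" "3 * \<delta> \<le> real s * \<delta>" "(real s - 2) * \<delta> = real s * \<delta> - 2 * \<delta>"
  using mult_right_mono[of 3 "real s" \<delta>] mult_right_mono[of 1 "real s - 2" \<delta>] assms by (auto simp: algebra_simps)

text \<open>If df wedge dz is smaller than its summand h dy wedge dz, that summand must be cancelled
  by dg wedge dz.\<close>

lemma br_combine:
  assumes "\<And>i. D i f = cst c * D i g + h * D i y + h' * D i z" "c \<noteq> 0" "h \<noteq> 0" "wedge y z \<noteq> 0"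
    "br f z < dg h + br y z"
  shows "br g z = dg h + br y z"
proof -
  have "scale_form (cst c) (wedge g z) = wedge f z - scale_form h (wedge y z)"
    by (auto simp: wedge_def scale_form_def assms(1) algebra_simps)
  moreover have "fdg (scale_form h (wedge y z)) = dg h + br y z" using assms by (simp add: fdg_scale_form)
  ultimately have "fdg (scale_form (cst c) (wedge g z)) = dg h + br y z" using assms(5) by (simp add: fdg_diff_eq2)
  then show ?thesis using assms(2) by (simp add: fdg_def scale_form_def)
qed

text \<open>Genericity is automatic: otherwise \<open>dg3 \<and> dg2\<close> would be large, and then
\<open>(g3, g1, g2)\<close> could not be reduced.\<close>

lemma hub_generic:
  assumes cl: "closed (dg g3 + dg g1 + dg g2)" and r: "red g3 g1 g2"
    and irr: "\<And>g. line g g3 g1 g2 \<Longrightarrow> dg g3 \<le> dg g"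
    and \<delta>: "0 < \<delta>" and s: "odd s" "3 \<le> s" and g: "dg g1 = real s * \<delta>" "dg g2 = 2 * \<delta>"
    and f: "line f g3 g1 g2" "dg g3 < dg f" "dg f < real s * \<delta>" "\<And>j::nat. dg f \<noteq> 2 * real j * \<delta>"
  shows "hub \<delta> s f g1 g2"
proof -
  have a3: "keller g3 g1 g2" by (rule red_keller[OF r])
  then have af: "keller f g1 g2" using f(1) keller_line by blast
  have wedge: "wedge g1 g2 \<noteq> 0" "wedge g3 g2 \<noteq> 0" "wedge g3 g1 \<noteq> 0" using keller_wedge[OF a3] by auto
  define \<epsilon> where "\<epsilon> = br g1 g2"
  have eps: "0 < \<epsilon>" using br_pos[OF wedge(1)] by (simp add: \<epsilon>_def)
  have s\<delta>: "\<delta> \<le> (real s - 2) * \<delta>" "3 * \<delta> \<le> real s * \<delta>" "(real s - 2) * \<delta> = real s * \<delta> - 2 * \<delta>"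
    by (rule odd_mult_bounds[OF s(2) \<delta>])+
  obtain c P where P: "c \<noteq> 0" "P \<in> alg {g1, g2}" "f = cst c * g3 + P" using f(1) by (auto simp: line_def)
  have dP: "dg P = dg f" by (rule dg_move[OF P(1) f(2) P(3)])
  have f0: "0 < dg f" using keller_dg_pos[OF af] by simp
  have sne: "dg p \<noteq> real n * dg p" if "2 \<le> n" "0 < dg p" for n p using that by simp
  \<comment> \<open>Below s delta only powers of g2 are available, and \<open>dg f\<close> is not a
    multiple of 2 delta.\<close>
  have "\<not> no_cancel P g1 g2"
  proof
    assume "no_cancel P g1 g2"
    moreover have "P \<noteq> 0" using dP f0 by auto
    ultimately obtain k where "vd g1 g2 k = dg f" unfolding no_cancel_def dP by blast
    then have e: "real (fst k) * dg g1 + real (snd k) * dg g2 = dg f" by (simp add: vd_def)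
    have "fst k = 0"
      using e f(3) g \<delta> s\<delta> by - (rule of_nat_mult_casesE[of "dg g1" "fst k"]; rule of_nat_mult_casesE[of "dg g2" "snd k"]; linarith)
    then show False using e f(4)[of "snd k"] g by simp
  qed
  then obtain p q \<eta> where top_cancel: "top_cancel p q \<eta> P g1 g2" using cancel[OF P(2) wedge(1)] by blast
  note C = top_cancel[unfolded top_cancel_def]
  have "p = s \<and> q = 2 \<and> \<eta> = \<delta>"
    using C \<delta> g s by (intro coprime_ratio) (auto simp: coprime_right_2_iff_odd)
  then have pq: "p = s" "q = 2" "\<eta> = \<delta>" by auto
  have lo: "(real s - 2) * \<delta> + \<epsilon> \<le> dg f"
    using C dP by (simp add: pq \<epsilon>_def algebra_simps)
  have "real s * real 2 * \<delta> = 2 * (real s * \<delta>)" by simp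
  \<comment> \<open>This bound activates the derivative clause of \<open>top_cancel\<close>, the
    source of the large factor h.\<close>
  then have lt: "dg P < real s * real 2 * \<delta>" using dP f(3) s\<delta> \<delta> by linarith
  then obtain h h' where h: "\<And>i. D i P = h * D i g1 + h' * D i g2" "h \<noteq> 0" "(real s * 2 - s) * \<delta> \<le> dg h"
    using C s unfolding pq by auto
  have dh: "real s * \<delta> \<le> dg h" using h(3) by (simp add: algebra_simps)
  have "real s * \<delta> + \<epsilon> \<le> br f g2"
  proof (rule ccontr)
    assume n: "\<not> real s * \<delta> + \<epsilon> \<le> br f g2"
    define \<nu> where "\<nu> = br g3 g2"
    define t where "t = dg g3"
    have Df: "D i f = cst c * D i g3 + h * D i g1 + h' * D i g2" for i
      by (simp add: P(3) der_add exponent.der_cst_mult h(1))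
    have lam: "real s * \<delta> + \<epsilon> \<le> \<nu>"
      using br_combine[OF Df P(1) h(2) wedge(1)] n dh by (simp add: \<epsilon>_def \<nu>_def)
    have eps2: "\<epsilon> < 2 * \<delta>" using lo f(3) s\<delta> by linarith
    have ts: "t < real s * \<delta>" using f by (simp add: t_def)
    have t0: "0 < t" using keller_dg_pos[OF a3] by (simp add: t_def)
    have "dg g3 + br g1 g2 < dg g1 + br g3 g2" using ts t0 lam eps g unfolding t_def \<nu>_def \<epsilon>_def by linarith
    then have g31: "br g3 g1 = (real s - 2) * \<delta> + \<nu>" using two_max[OF a3] g s\<delta> by (simp add: \<nu>_def)
    have tl: "\<nu> \<le> t + 2 * \<delta>" using br_le[OF wedge(2)] g by (simp add: \<nu>_def t_def)
    have tlo: "(real s - 2) * \<delta> + \<epsilon> \<le> t" using tl lam s\<delta> by linarith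
    have even: "t \<noteq> real n * (2 * \<delta>)" for n
    proof
      assume "t = real n * (2 * \<delta>)"
      then obtain x' where "line1 x' g3 g2" "dg x' < dg g3"
        using power_red[of g3 n g2] g t0 \<delta> by (auto simp: t_def)
      then show False using irr[of x'] line1_line(1) by fastforce
    qed
    have t2: "t \<noteq> 2 * \<delta>" using even[of 1] by simp
    have nEL3: "\<not> el_red g3 g1 g2"
      unfolding el_red_def using irr line_sym by fastforce
    \<comment> \<open>Only s = 3 with \<open>dg g3\<close> = 3/2 delta passes the numerical test.
      There the square of g3 cancels the top of g1, and \<open>exceptional_partner\<close> lowers g3
      over (g1, g2), against its minimality.\<close>
    have nEL1: "\<not> el_red g1 g3 g2"
    proof
      assume el_red: "el_red g1 g3 g2"
      then have "(\<exists>i j. dg g1 = real i * dg g3 + real j * dg g2) \<or>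
        (\<exists>n\<ge>1. dg g2 = real n * dg g3 \<and> br g3 g2 - dg g3 \<le> dg g1) \<or>
        (\<exists>n\<ge>1. dg g3 = real n * dg g2 \<and> br g3 g2 - dg g2 \<le> dg g1) \<or> br g3 g2 \<le> dg g1"
        using el_red_dg_cases keller_perm(1)[OF a3] by blast
      then have "s = 3 \<and> t = 3/2 * \<delta>"
      proof (elim disjE exE conjE)
        fix i j assume ij: "dg g1 = real i * dg g3 + real j * dg g2"
        have "i \<noteq> 0"
        proof
          assume "i = 0"
          then have "real s * \<delta> = real (2 * j) * \<delta>" using ij g by (simp add: mult.commute[of 2])
          then have "s = 2 * j" using \<delta> by (metis mult_right_cancel of_nat_eq_iff less_irrefl)
          then show False using s by simp
        qed
        then have "2 * t = real s * \<delta>"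
          using ij[folded t_def] g ts tlo eps s\<delta> \<delta>
          by - (rule of_nat_mult_casesE[of t i]; rule of_nat_mult_casesE[of "dg g2" j]; linarith)
        moreover from this have "real s * \<delta> < 4 * \<delta>" using tlo eps s\<delta> by linarith
        then have "s < 4" using \<delta> by simp
        then have "s = 3" using s by simp
        ultimately show ?thesis by simp
      next
        fix n :: nat assume "1 \<le> n" "dg g2 = real n * dg g3"
        then have False using g t2 tlo eps s\<delta> \<delta> unfolding t_def[symmetric] by - (rule of_nat_mult_casesE[of t n]; linarith)
        then show ?thesis ..
      next
        fix n :: nat assume "dg g3 = real n * dg g2"
        then show ?thesis using even[of n] g by (simp add: t_def)
      next
        assume "br g3 g2 \<le> dg g1"
        then show ?thesis using lam eps g by (simp add: \<nu>_def)
      qed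
      then have s3: "s = 3" and t: "t = 3/2 * \<delta>" by auto
      obtain u b Q where u: "red u g3 g2" "b \<noteq> 0" "Q \<in> alg {g3, g2}" "g1 = cst b * u + Q" "dg u < dg g1"
        using el_red by (auto simp: el_red_def line_def)
      have dQ: "dg Q = 3 * \<delta>" using dg_move[OF u(2,5,4)] g s3 by simp
      consider "no_cancel Q g3 g2" | p q \<eta> where "top_cancel p q \<eta> Q g3 g2" using cancel[OF u(3) wedge(2)] by blast
      then show False
      proof cases
        case 1
        obtain e e1 \<chi> where Q: "Q = cst e * (g3 * g3) + cst e1 * g3 + \<chi>" "\<chi> \<in> alg {g2}" "dg \<chi> \<le> dg Q"
        proof -
          have "0 < dg g3" "0 < dg g2" "dg Q < 3 * dg g3" "dg Q < dg g3 + dg g2"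
            using dQ t g \<delta> by (auto simp: t_def)
          then show ?thesis using no_cancel_quadratic[OF 1] that by metis
        qed
        have chi: "dg \<chi> < 3 * \<delta>" using alg1_deg_odd[OF Q(2) g(2) \<delta>, of 3] Q(3) dQ by simp
        have e: "e \<noteq> 0"
        proof
          assume "e = 0"
          then have "dg Q \<le> max (dg (cst e1 * g3)) (dg \<chi>)" using Q(1) dg_add[of "cst e1 * g3" \<chi>] by simp
          then show False using chi dQ t dg_cst_mult_le[of e1 g3] \<delta> by (simp add: t_def)
        qed
        have "\<exists>v'. red v' g1 g2 \<and> line g3 v' g1 g2 \<and> dg v' < dg g3"
        proof (rule exceptional_partner[OF cl \<delta> u(1)])
          show "g1 = cst b * u + cst e * (g3 * g3) + cst e1 * g3 + \<chi>" unfolding u(4) Q(1) by (simp add: algebra_simps)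
          show "br g1 g2 \<le> \<delta> / 2" using lam tl t s3 by (simp add: \<epsilon>_def)
          show "3/2 * \<delta> < br g3 g2" using lam s3 eps \<delta> by (simp add: \<nu>_def)
        qed (use t g u chi e Q s3 \<delta> in \<open>auto simp: t_def\<close>)
        then show False using irr line_sym by fastforce
      next
        case 2
        show False using top_cancel_cases[OF 2]
        proof (elim disjE conjE)
          assume "dg g2 = real q * dg g3"
          then show False using g t \<delta> unfolding t_def[symmetric] by - (rule of_nat_mult_casesE[of t q]; linarith)
        next
          assume "dg g3 = real p * dg g2"
          then show False using even[of p] g by (simp add: t_def)
        next
          assume "br g3 g2 \<le> dg Q"
          then show False using lam eps dQ s3 by (simp add: \<nu>_def)
        qed
      qed
    qed
    have nEL2: "\<not> el_red g2 g3 g1"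
    proof
      assume "el_red g2 g3 g1"
      then have "(\<exists>i j. dg g2 = real i * dg g3 + real j * dg g1) \<or>
        (\<exists>n\<ge>1. dg g1 = real n * dg g3 \<and> br g3 g1 - dg g3 \<le> dg g2) \<or>
        (\<exists>n\<ge>1. dg g3 = real n * dg g1 \<and> br g3 g1 - dg g1 \<le> dg g2) \<or> br g3 g1 \<le> dg g2"
        using el_red_dg_cases keller_perm(4)[OF a3] by blast
      then show False unfolding t_def[symmetric]
      proof (elim disjE exE conjE)
        fix i j assume ij: "dg g2 = real i * t + real j * dg g1"
        then show False using g t2 tlo eps s\<delta> \<delta> t0
          by - (rule of_nat_mult_casesE[of t i]; rule of_nat_mult_casesE[of "dg g1" j]; linarith)
      next
        fix n :: nat assume n: "1 \<le> n" "dg g1 = real n * t" "br g3 g1 - t \<le> dg g2"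
        then have "t \<ge> 2 * (real s * \<delta>) - 4 * \<delta> + \<epsilon>" using g31 lam g s\<delta> by linarith
        then show False using n g ts s\<delta> eps \<delta> t0 by - (rule of_nat_mult_casesE[of t n]; linarith)
      next
        fix n :: nat assume "1 \<le> n" "t = real n * dg g1"
        then show False using g ts s\<delta> \<delta> by - (rule of_nat_mult_casesE[of "dg g1" n]; linarith)
      next
        assume "br g3 g1 \<le> dg g2"
        then show False using g31 lam eps g s\<delta> \<delta> by linarith
      qed
    qed
    have br: "br g1 g2 = \<epsilon>" "br g2 g1 = \<epsilon>" "br g3 g2 = \<nu>" "br g2 g3 = \<nu>" "br g1 g3 = (real s - 2) * \<delta> + \<nu>"
      using g31 br_swap[of g1 g2] br_swap[of g3 g2] br_swap[of g1 g3] by (auto simp: \<epsilon>_def \<nu>_def)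
    have n2: "\<not> su_red g3 g2 g1" "\<not> su_red g1 g2 g3" "\<not> su_red g2 g1 g3"
    proof -
      show "\<not> su_red g3 g2 g1"
      proof
        assume "su_red g3 g2 g1"
        then obtain \<delta>' s' where "0 < \<delta>'" "3 \<le> s'" "br g3 g2 = (real s' - 2) * \<delta>' + br g3 g1" by (rule su_red_data)
        then show False using odd_mult_bounds(1)[of s' \<delta>'] br g31 s\<delta> \<delta> by linarith
      qed
      show "\<not> su_red g1 g2 g3"
      proof
        assume "su_red g1 g2 g3"
        then obtain \<delta>' s' where "0 < \<delta>'" "3 \<le> s'" "br g1 g2 = (real s' - 2) * \<delta>' + br g1 g3" by (rule su_red_data)
        then show False using odd_mult_bounds(1)[of s' \<delta>'] br g31 s\<delta> \<delta> lam by linarith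
      qed
      show "\<not> su_red g2 g1 g3"
      proof
        assume "su_red g2 g1 g3"
        then obtain \<delta>' s' where "0 < \<delta>'" "3 \<le> s'" "br g2 g1 = (real s' - 2) * \<delta>' + br g2 g3" by (rule su_red_data)
        then show False using odd_mult_bounds(1)[of s' \<delta>'] br s\<delta> \<delta> lam by linarith
      qed
    qed
    have n3: "\<not> su_red g1 g3 g2" "\<not> su_red g2 g3 g1"
    proof -
      show "\<not> su_red g1 g3 g2"
      proof
        assume "su_red g1 g3 g2"
        then obtain \<delta>' s' where "0 < \<delta>'" "3 \<le> s'" "dg g2 = 2 * \<delta>'" "real s' * \<delta>' < br g1 g2" by (rule su_red_data)
        then show False using odd_mult_bounds(2)[of s' \<delta>'] br g eps2 \<delta> by linarith
      qed
      show "\<not> su_red g2 g3 g1"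
      proof
        assume "su_red g2 g3 g1"
        then obtain \<delta>' s' where "0 < \<delta>'" "3 \<le> s'" "dg g1 = 2 * \<delta>'" "real s' * \<delta>' < br g2 g1" by (rule su_red_data)
        then show False using odd_mult_bounds(2)[of s' \<delta>'] br g eps2 s\<delta> \<delta> by linarith
      qed
    qed
    have n1: "\<not> su_red g3 g1 g2"
    proof
      assume "su_red g3 g1 g2"
      then obtain \<delta>' s' h1 h2 h3 \<alpha> \<beta> \<gamma> where su: "red h3 h1 h2" "line g3 h3 h1 h2" "dg h3 < dg g3"
        "hub \<delta>' s' g3 h1 h2" "mates \<delta>' s' g3 h1 h2 g1 g2 \<alpha> \<beta> \<gamma>" unfolding su_red_def by blast
      have a': "keller g3 h1 h2" using red_keller[OF su(1)] su(2) keller_line by blast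
      note F = su_red_facts[OF a' su(4,5)]
      \<comment> \<open>The bracket of the companions g1, g2 is too small for nontrivial companions,
        so g3 would descend over (g1, g2) itself.\<close>
      have "br g1 g2 < br g3 h2" using F(5) br lam eps2 s\<delta> \<delta> by linarith
      then have "\<alpha> = 0 \<and> \<beta> = 0 \<and> \<gamma> = 0" using F(9) by linarith
      then have "mates \<delta>' s' g3 h1 h2 g1 g2 0 0 0" using su(5) by metis
      then have "alg {g1, g2} = alg {h1, h2}" by (rule mates_trivial(3))
      then have "line g3 h3 g1 g2" using line_alg_cong[OF su(2)] by simp
      then show False using irr[OF line_sym] su(3) by fastforce
    qed
    have "\<not> dg g3 + dg g1 + dg g2 \<le> sig"
      using keller_sig[OF a3] br g eps2 s\<delta> \<delta> by linarith
    then show False using red_cases[OF r] nEL1 nEL2 nEL3 n1 n2 n3 by blast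
  qed
  then show ?thesis using \<delta> s g f lo by (simp add: hub_def \<epsilon>_def)
qed

text \<open>Substituting one move into the other gives jac(x', y0, z) = (h m + c') jac(x, y0, z).
  Hence large derivatives h and m force \<open>dg x'\<close> or \<open>br y0 z\<close> to be large:
  the third estimate, besides \<open>cancel\<close> and \<open>two_max\<close>.\<close>

lemma jac_two_moves:
  assumes x': "x' = cst c' * x + \<psi>" "\<And>i. D i \<psi> = h * D i y + h' * D i z" "h \<noteq> 0"
    and y: "\<And>i. D i y = cst c * D i y0 + m * D i x + k * D i z" "m \<noteq> 0"
    and a: "keller x y0 z" and pos: "0 < dg h + dg m" and wedge': "wedge y0 z \<noteq> 0"
  shows "dg h + dg m + sig \<le> dg x' + br y0 z"
proof -
  have e1: "jac \<psi> y0 z = h * m * jac x y0 z"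
  proof -
    have "jac \<psi> y0 z = h * jac y y0 z + h' * jac z y0 z" by (rule jac_chain) (rule x'(2))
    moreover have "jac y y0 z = m * jac x y0 z"
      by (simp add: jac_def wedge_form_def y(1) wedge_def algebra_simps)
    ultimately show ?thesis by (simp add: mult.assoc)
  qed
  have "jac \<psi> y0 z = jac x' y0 z - cst c' * jac x y0 z" by (simp add: x'(1) jac_add jac_cst_mult)
  then have e2: "jac x' y0 z = h * m * jac x y0 z + cst c' * jac x y0 z" using e1 by simp
  have nz: "jac x y0 z \<noteq> 0" "h * m \<noteq> 0" using keller_jac[OF a] x'(3) y(2) by (auto simp: mult_eq_0)
  have d: "dg (h * m * jac x y0 z) = dg h + dg m + sig"
    using dg_mult(2)[OF nz(2,1)] dg_mult(2)[OF x'(3) y(2)] a by (simp add: keller_def)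
  have "dg (cst c' * jac x y0 z) \<le> sig" using dg_cst_mult_le[of c' "jac x y0 z"] a by (simp add: keller_def)
  then have j: "dg (jac x' y0 z) = dg h + dg m + sig"
    unfolding e2 using d pos by (simp add: dg_add_eq2)
  then have "jac x' y0 z \<noteq> 0" using pos sig_pos by auto
  then show ?thesis using wedge_form_le[of x' "wedge y0 z"] j by (simp add: jac_def)
qed

text \<open>Cancellation over the degrees 3 delta and 2 delta bounds \<open>br g1 w\<close> above,
  and the Jacobian bounds \<open>br x w\<close> below. So \<open>exceptional_partner\<close>
  applies, x descends over (g1, w), and x' is reached from the smaller triple.\<close>

lemma exceptional_move:
  assumes cl: "closed d" and \<delta>: "0 < \<delta>" and r: "red x u w" and x: "dg x = 3/2 * \<delta>" and w: "dg w = 2 * \<delta>"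
    and u: "dg u < 3 * \<delta>" and g1: "g1 = cst c * u + cst e * (x * x) + cst e1 * x + \<chi>"
    and c: "c \<noteq> 0" and e: "e \<noteq> 0" and chi: "\<chi> \<in> alg {w}" "dg \<chi> \<le> 3 * \<delta>" and dg1: "dg g1 = 3 * \<delta>"
    and d: "13/2 * \<delta> \<le> d" and x': "x' = cst c' * x + \<psi>" "c' \<noteq> 0" "\<psi> \<in> alg {g1, w}" "dg x' \<le> dg x"
    and top_cancel: "top_cancel p q \<eta> \<psi> g1 w"
  shows "red x' g1 w"
proof -
  have a: "keller x u w" by (rule red_keller[OF r])
  have wedge: "wedge u w \<noteq> 0" "wedge x w \<noteq> 0" using keller_wedge[OF a] by auto
  have dpsi: "dg \<psi> \<le> 3/2 * \<delta>"
  proof -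
    have "\<psi> = x' - cst c' * x" using x' by simp
    then show ?thesis using dg_diff[of x' "cst c' * x"] x x' by simp
  qed
  note C = top_cancel[unfolded top_cancel_def]
  have "p = 3 \<and> q = 2 \<and> \<eta> = \<delta>"
    using C \<delta> dg1 w coprime_small by (intro coprime_ratio) auto
  then have pq: "p = 3" "q = 2" "\<eta> = \<delta>" by auto
  have eps: "br g1 w \<le> \<delta> / 2" using C dpsi by (simp add: pq)
  have "dg \<psi> < real 3 * real 2 * \<delta>" using dpsi \<delta> by simp
  then obtain h h' where h: "\<And>i. D i \<psi> = h * D i g1 + h' * D i w" "h \<noteq> 0" "3 * \<delta> \<le> dg h"
    using C unfolding pq by auto
  obtain m k where m: "\<And>i. D i g1 = cst c * D i u + m * D i x + k * D i w" "m \<noteq> 0" "dg m = dg x"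
  proof -
    have "0 < dg w" "0 < dg x" using w x \<delta> by auto
    then show ?thesis using square_chain[OF g1 chi(1) _ e] that by metis
  qed
  have jac: "dg h + dg m + sig \<le> dg x' + br u w"
    by (rule jac_two_moves[OF x'(1) h(1,2) m(1,2) a _ wedge(1)]) (use h m x \<delta> in auto)
  have "0 < br x w" by (rule br_pos[OF wedge(2)])
  then have "br u w = dg m + br x w"
    using eps m(3) x \<delta> by (intro square_forms[OF m(1) c m(2) wedge(2)]) auto
  \<comment> \<open>In the Jacobian inequality the derivative m of the square occurs on both sides
    and drops out.\<close>
  then have kap: "3/2 * \<delta> < br x w" using jac h(3) x' x m(3) sig_pos by linarith
  obtain v' where v': "red v' g1 w" "line x v' g1 w" "dg v' < dg x"
    using exceptional_partner[OF cl \<delta> red_perm(2)[OF r] x w u g1 c e chi dg1 eps kap d] by blast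
  have "line x' x g1 w" using x' by (intro lineI[of c' \<psi>])
  then have "line x' v' g1 w" using v'(2) line_trans by blast
  then show ?thesis using closedD(1)[OF cl v'(1)] v'(3) x w dg1 d by simp
qed

text \<open>Both moves cancel top terms here, with (p, q) = (2, 3) and (3, 2). The Jacobian forces a
  large \<open>br x z\<close>; with y0 of minimal degree, no alternative of \<open>red_cases\<close>
  is then left for (x, y0, z).\<close>

lemma exceptional_4_3:
  assumes \<delta>: "0 < \<delta>" and r: "red x y0 z" and x: "dg x = 4/3 * \<delta>" and y: "dg y = 3 * \<delta>" and z: "dg z = 2 * \<delta>"
    and y0: "y = cst c * y0 + \<phi>" "c \<noteq> 0" "\<phi> \<in> alg {x, z}" "dg y0 < dg y"
    and irr: "\<And>g. line g y0 x z \<Longrightarrow> dg y0 \<le> dg g"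
    and x': "x' = cst c' * x + \<psi>" "\<psi> \<in> alg {y, z}" "dg x' \<le> dg x" "c' \<noteq> 0"
    and top_cancel1: "top_cancel p q \<eta> \<phi> x z" and top_cancel2: "top_cancel p' q' \<eta>' \<psi> y z"
  shows False
proof -
  have a: "keller x y0 z" by (rule red_keller[OF r])
  have wedge: "wedge y0 z \<noteq> 0" "wedge x z \<noteq> 0" "wedge x y0 \<noteq> 0" using keller_wedge[OF a] by auto
  have dphi: "dg \<phi> = 3 * \<delta>" using dg_move[OF y0(2,4,1)] y by simp
  have dpsi: "dg \<psi> \<le> 4/3 * \<delta>"
  proof -
    have "\<psi> = x' - cst c' * x" using x' by simp
    then show ?thesis using dg_diff[of x' "cst c' * x"] x x' by simp
  qed
  note C1 = top_cancel1[unfolded top_cancel_def]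
  have "dg x = real p * \<eta>" "dg z = real q * \<eta>" using C1 by blast+
  then have "real p * \<eta> = real 2 * (2/3 * \<delta>)" "real q * \<eta> = real 3 * (2/3 * \<delta>)"
    unfolding of_nat_numeral using x z by linarith+
  then have "p = 2 \<and> q = 3 \<and> \<eta> = 2/3 * \<delta>"
    using coprime_ratio[OF _ coprime_small(2), of p q \<eta> "2/3 * \<delta>"] C1 \<delta> by linarith
  then have pq: "p = 2" "q = 3" "\<eta> = 2/3 * \<delta>" by auto
  note C2 = top_cancel2[unfolded top_cancel_def]
  have "p' = 3 \<and> q' = 2 \<and> \<eta>' = \<delta>"
    using C2 \<delta> y z coprime_small by (intro coprime_ratio) auto
  then have pq': "p' = 3" "q' = 2" "\<eta>' = \<delta>" by auto
  define \<kappa> where "\<kappa> = br x z"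
  define \<mu> where "\<mu> = br y0 z"
  define t where "t = dg y0"
  have eps: "br y z \<le> \<delta> / 3" using C2 dpsi by (simp add: pq')
  have kle: "2/3 * \<delta> + \<kappa> \<le> 3 * \<delta>" using C1 dphi by (simp add: pq \<kappa>_def)
  have "dg \<phi> < real 2 * real 3 * (2/3 * \<delta>)" using dphi \<delta> by simp
  then obtain k k' where k: "\<And>i. D i \<phi> = k * D i x + k' * D i z" "k \<noteq> 0" "8/3 * \<delta> \<le> dg k"
    using C1 unfolding pq by auto
  have "dg \<psi> < real 3 * real 2 * \<delta>" using dpsi \<delta> by simp
  then obtain h h' where h: "\<And>i. D i \<psi> = h * D i y + h' * D i z" "h \<noteq> 0" "3 * \<delta> \<le> dg h"
    using C2 unfolding pq' by auto
  have Dy: "D i y = cst c * D i y0 + k * D i x + k' * D i z" for i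
    by (simp add: y0(1) der_add exponent.der_cst_mult k(1))
  have kpos: "0 < \<kappa>" using br_pos[OF wedge(2)] by (simp add: \<kappa>_def)
  have mu: "\<mu> = dg k + \<kappa>" unfolding \<mu>_def \<kappa>_def
    by (rule br_combine[OF Dy y0(2) k(2) wedge(2)]) (use eps k kpos \<delta> in \<open>simp add: \<kappa>_def\<close>)
  have "dg h + dg k + sig \<le> dg x' + br y0 z"
    by (rule jac_two_moves[OF x'(1) h(1,2) Dy k(2) a _ wedge(1)]) (use h k \<delta> in auto)
  then have kap: "5/3 * \<delta> + sig \<le> \<kappa>" using h(3) x'(3) x mu by (simp add: \<mu>_def)
  have tl: "7/3 * \<delta> < t" using br_le[OF wedge(1)] z mu k(3) kap sig_pos by (simp add: t_def \<mu>_def)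
  have tu: "t < 3 * \<delta>" using y0 y by (simp add: t_def)
  have "dg y0 + br x z < dg x + br y0 z" using tu mu k(3) x \<delta> unfolding t_def \<kappa>_def \<mu>_def by linarith
  then have xy: "br x y0 = \<mu> - 2/3 * \<delta>"
    using two_max[OF keller_perm(1)[OF a]] x z br_swap[of y0 x] by (simp add: \<mu>_def)
  have br: "br x z = \<kappa>" "br z x = \<kappa>" "br y0 z = \<mu>" "br z y0 = \<mu>" "br y0 x = \<mu> - 2/3 * \<delta>"
    using xy br_swap[of x z] br_swap[of y0 z] br_swap[of y0 x] by (auto simp: \<kappa>_def \<mu>_def)
  have ml: "8/3 * \<delta> + \<kappa> \<le> \<mu>" using mu k(3) by simp
  note num = x z tl tu t_def ml kap sig_pos br xy \<delta>
  have "\<not> el_red x y0 z"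
  proof
    assume "el_red x y0 z"
    note el_red_dg_cases[OF this a]
    then show False unfolding t_def[symmetric]
    proof (elim disjE exE conjE)
      fix i j assume ij: "dg x = real i * t + real j * dg z"
      then show False using num by - (rule of_nat_mult_casesE[of t i]; rule of_nat_mult_casesE[of "dg z" j]; linarith)
    qed (use num in linarith)+
  qed
  moreover have "\<not> el_red y0 x z" unfolding el_red_def using irr line_sym by fastforce
  moreover have "\<not> el_red z x y0"
  proof
    assume "el_red z x y0"
    note el_red_dg_cases[OF this keller_perm(4)[OF a]]
    then show False unfolding t_def[symmetric]
    proof (elim disjE exE conjE)
      fix i j assume ij: "dg z = real i * dg x + real j * t"
      then show False using num by - (rule of_nat_mult_casesE[of "dg x" i]; rule of_nat_mult_casesE[of t j]; linarith)
    next
      fix n :: nat assume "1 \<le> n" "dg x = real n * t"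
      then show False using num by - (rule of_nat_mult_casesE[of t n]; linarith)
    qed (use num in linarith)+
  qed
  moreover have "\<not> su_red x y0 z"
  proof
    assume "su_red x y0 z"
    then obtain \<delta>' s where "dg z = 2 * \<delta>'" "br x y0 = (real s - 2) * \<delta>' + br x z" "(real s - 2) * \<delta>' < dg x"
      by (rule su_red_data)
    then show False using num by linarith
  qed
  moreover have "\<not> su_red x z y0"
  proof
    assume "su_red x z y0"
    then obtain \<delta>' s where "0 < \<delta>'" "3 \<le> s" "br x z = (real s - 2) * \<delta>' + br x y0" by (rule su_red_data)
    then show False using odd_mult_bounds(1)[of s \<delta>'] num by linarith
  qed
  moreover have "\<not> su_red y0 z x"
  proof
    assume "su_red y0 z x"
    then obtain \<delta>' s where "0 < \<delta>'" "3 \<le> s" "dg x = 2 * \<delta>'" "br y0 z = (real s - 2) * \<delta>' + br y0 x"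
      "dg y0 < real s * \<delta>'"
      by (rule su_red_data)
    then show False using odd_mult_bounds(3)[of s \<delta>'] num by linarith
  qed
  moreover have "\<not> su_red y0 x z"
  proof
    assume "su_red y0 x z"
    then obtain \<delta>' s where "0 < \<delta>'" "3 \<le> s" "br y0 x = (real s - 2) * \<delta>' + br y0 z" by (rule su_red_data)
    then show False using odd_mult_bounds(1)[of s \<delta>'] num by linarith
  qed
  moreover have "\<not> su_red z y0 x"
  proof
    assume "su_red z y0 x"
    then obtain \<delta>' s where "br z y0 = (real s - 2) * \<delta>' + br z x" "(real s - 2) * \<delta>' < dg z"
      by (rule su_red_data)
    then show False using num by linarith
  qed
  moreover have "\<not> su_red z x y0"
  proof
    assume "su_red z x y0"
    then obtain \<delta>' s where "0 < \<delta>'" "3 \<le> s" "br z x = (real s - 2) * \<delta>' + br z y0" by (rule su_red_data)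
    then show False using odd_mult_bounds(1)[of s \<delta>'] num by linarith
  qed
  moreover have "\<not> dg x + dg y0 + dg z \<le> sig" using num kle by linarith
  ultimately show False using red_cases[OF r] by blast
qed

section \<open>Moves of a triple that has a Shestakov-Umirbaev reduction\<close>

lemma alg1_const:
  assumes "p \<in> alg {z}" "0 < dg z" "dg p < dg z"
  obtains b where "p = cst b"
proof -
  obtain a b where p: "p = cst a * z + cst b" using alg1_linear[OF assms(1,2)] assms(2,3) by auto
  have "a = 0"
  proof (rule ccontr)
    assume "a \<noteq> 0"
    then have "dg (cst a * z + cst b) = dg z" using dg_cst[of b] assms(2) by (simp add: dg_add_eq2)
    then show False using assms(3) p by simp
  qed
  then show ?thesis using p that by simp
qed

lemma mates_refl:
  assumes "dg g1 = real s * \<delta>" "dg g2 = 2 * \<delta>" "0 < \<delta>"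
  shows "mates \<delta> s f g1 g2 g1 g2 0 0 0"
proof -
  have "0 \<le> real s * \<delta>" using assms by simp
  then have "dg 0 \<le> real s * \<delta>" unfolding dg_0 by linarith
  then show ?thesis unfolding mates_def using assms
    by (intro exI[of _ 1] exI[of _ 0] exI[of _ "0::mpol"]) simp
qed

lemma odd_neq_even_mult:
  assumes "odd s" "0 < (\<delta>::real)"
  shows "real s * \<delta> \<noteq> real n * (2 * \<delta>)"
proof
  assume "real s * \<delta> = real n * (2 * \<delta>)"
  then have "real s * \<delta> = real (2 * n) * \<delta>" by (simp only: of_nat_mult of_nat_numeral mult.assoc mult.left_commute)
  then have "s = 2 * n" using assms(2) by (metis mult_right_cancel of_nat_eq_iff less_irrefl)
  then show False using assms(1) by simp
qed

lemma no_cancel_commute: "no_cancel f y z \<Longrightarrow> no_cancel f z y"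
proof -
  assume "no_cancel f y z"
  then obtain S c where S: "finite S" "f = ev S c y z" "\<forall>k\<in>S. c k \<noteq> 0" "\<forall>k\<in>S. vd y z k \<le> dg f"
    "f \<noteq> 0 \<longrightarrow> (\<exists>k\<in>S. vd y z k = dg f)" unfolding no_cancel_def by blast
  have i: "inj_on prod.swap S" by simp
  have "f = ev (prod.swap ` S) (c \<circ> prod.swap) z y"
    unfolding S(2) ev_def sum.reindex[OF i] by (rule sum.cong) (simp_all add: mult.commute)
  moreover have v: "vd z y (prod.swap k) = vd y z k" for k by (simp add: vd_def)
  ultimately show ?thesis unfolding no_cancel_def using S
    by (intro exI[of _ "prod.swap ` S"] exI[of _ "c \<circ> prod.swap"]) (simp add: v)
qed

text \<open>Low degree and large brackets rule out cancellation in the moving polynomial. A changed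
  f1 or f2 is again a companion of the same g1, g2. A changed f is a new hub over them, unless the
  companions are trivial, in which case f descends elementarily.\<close>

lemma su_red_closed:
  assumes cl: "closed d" and su: "red g3 g1 g2" "line f g3 g1 g2" "dg g3 < dg f" and hub: "hub \<delta> s f g1 g2"
    and ma: "mates \<delta> s f g1 g2 f1 f2 \<alpha> \<beta> \<gamma>" and d: "dg f + dg f1 + dg f2 \<le> d"
  shows "line f1' f1 f f2 \<Longrightarrow> dg f1' \<le> dg f1 \<Longrightarrow> red f f1' f2"
    and "line f2' f2 f f1 \<Longrightarrow> dg f2' \<le> dg f2 \<Longrightarrow> red f f1 f2'"
    and "line f' f f1 f2 \<Longrightarrow> dg f' \<le> dg f \<Longrightarrow> red f' f1 f2"
proof -
  have af: "keller f g1 g2" using red_keller[OF su(1)] su(2) keller_line by blast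
  have aff: "keller f f1 f2" using mates_keller[OF af ma] .
  note F = su_red_facts[OF af hub ma]
  have wedge: "wedge f g2 \<noteq> 0" "wedge g1 g2 \<noteq> 0" "wedge f f2 \<noteq> 0" "wedge f f1 \<noteq> 0" "wedge f1 f2 \<noteq> 0"
    using keller_wedge[OF af] keller_wedge[OF aff] by auto
  define \<epsilon> where "\<epsilon> = br g1 g2"
  define \<kappa> where "\<kappa> = br f g2"
  have eps: "0 < \<epsilon>" using br_pos[OF wedge(2)] by (simp add: \<epsilon>_def)
  have \<delta>: "0 < \<delta>" and s: "odd s" "3 \<le> s" and g: "dg g1 = real s * \<delta>" "dg g2 = 2 * \<delta>"
    and lo: "(real s - 2) * \<delta> + \<epsilon> \<le> dg f" and hi: "dg f < real s * \<delta>"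
    and odd: "\<And>j::nat. dg f \<noteq> 2 * real j * \<delta>" and kap: "real s * \<delta> + \<epsilon> \<le> \<kappa>"
    using hub by (auto simp: hub_def \<epsilon>_def \<kappa>_def)
  note s\<delta> = odd_mult_bounds[OF s(2) \<delta>]
  obtain c1 c2 c0 \<chi> where c1: "c1 \<noteq> 0" and c2: "c2 \<noteq> 0" and chi: "\<chi> \<in> alg {g2}" "dg \<chi> \<le> real s * \<delta>"
    and f1: "f1 = cst c1 * g1 + cst \<alpha> * (f * f) + cst \<beta> * f + \<chi>"
    and f2: "f2 = cst c2 * g2 + cst \<gamma> * f + cst c0"
    and le: "dg f1 \<le> real s * \<delta>" "dg f2 \<le> 2 * \<delta>"
    using ma by (auto simp: mates_def)
  have a2: "dg f \<noteq> 2 * \<delta>" using odd[of 1] by simp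
  have fd: "\<delta> < dg f" using lo eps s\<delta> by linarith
  have scale_form: "s = 3" if "real s * \<delta> < 4 * \<delta>" using that \<delta> s by simp
  have df1: "5/2 * \<delta> \<le> dg f1"
  proof (cases "dg f1 = real s * \<delta>")
    case True
    then show ?thesis using s\<delta> \<delta> by linarith
  next
    case False
    then have "dg f + \<kappa> \<le> br f1 f2" "dg f = 3/2 * \<delta>" "s = 3" using F(4,10) by (auto simp: \<kappa>_def)
    then show ?thesis using br_le[OF wedge(5)] F(1) kap eps by simp
  qed
  have d1: "dg f1 = real s * \<delta> \<or> s = 3 \<and> dg f = 3/2 * \<delta> \<and> dg f1 < 3 * \<delta> \<and> \<alpha> \<noteq> 0"
    using F(4) le(1) by auto
  \<comment> \<open>Polynomials in f2 must be rewritten in g2 to fit \<open>mates\<close>. If f2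
    contains f, then s = 3 and they are affine, which adds only a multiple of f.\<close>
  have conv: "\<exists>\<chi>'' b. \<chi>' = \<chi>'' + cst b * f \<and> \<chi>'' \<in> alg {g2} \<and> dg \<chi>'' \<le> real s * \<delta>"
    if x: "\<chi>' \<in> alg {f2}" "dg \<chi>' \<le> real s * \<delta>" for \<chi>'
  proof (cases "\<gamma> = 0")
    case True
    have "f2 \<in> alg {g2}" unfolding f2 True by (auto intro!: alg_rules intro: alg_gen)
    then have "\<chi>' \<in> alg {g2}" using x alg_sub[of "{f2}" "{g2}"] by auto
    then show ?thesis using x by (intro exI[of _ \<chi>'] exI[of _ 0]) simp
  next
    case False
    then have s3: "s = 3" using F(2) by simp
    obtain a1 b1 where l: "\<chi>' = cst a1 * f2 + cst b1"
      using alg1_linear[OF x(1)] x(2) F(1) \<delta> s3 by auto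
    let ?c = "cst (a1 * c2) * g2 + cst (a1 * c0 + b1)"
    have "\<chi>' = ?c + cst (a1 * \<gamma>) * f" unfolding l f2 cst_add cst_mult by (simp add: algebra_simps)
    moreover have "?c \<in> alg {g2}" by (auto intro!: alg_rules intro: alg_gen)
    moreover have "dg ?c \<le> real s * \<delta>"
      using dg_add[of "cst (a1 * c2) * g2" "cst (a1 * c0 + b1)"] dg_cst_mult_le[of "a1 * c2" g2]
        dg_cst[of "a1 * c0 + b1"] g s\<delta> \<delta> by linarith
    ultimately show ?thesis by blast
  qed
  show "red f f1' f2" if l: "line f1' f1 f f2" "dg f1' \<le> dg f1"
  proof -
    obtain c P where P: "c \<noteq> 0" "P \<in> alg {f, f2}" "f1' = cst c * f1 + P" using l(1) by (auto simp: line_def)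
    have dP: "dg P \<le> real s * \<delta>"
    proof -
      have "P = f1' - cst c * f1" using P by simp
      then show ?thesis using dg_diff[of f1' "cst c * f1"] dg_cst_mult_le[of c f1] l(2) le by simp
    qed
    have "no_cancel P f f2"
    proof (rule ccontr)
      assume "\<not> no_cancel P f f2"
      then obtain p q \<eta> where top_cancel: "top_cancel p q \<eta> P f f2" using cancel[OF P(2) wedge(3)] by blast
      show False using top_cancel_cases[OF top_cancel]
      proof (elim disjE conjE)
        assume "dg f2 = real q * dg f" "1 \<le> q"
        then show False using F(1) fd a2 \<delta> by - (rule of_nat_mult_casesE[of "dg f" q]; linarith)
      next
        assume "dg f = real p * dg f2"
        then show False using odd[of p] F(1) by simp
      next
        assume "br f f2 \<le> dg P"
        then show False using F(5) kap eps dP by (simp add: \<kappa>_def)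
      qed
    qed
    moreover have "0 < dg f" "0 < dg f2" "dg P < 3 * dg f" "dg P < dg f + dg f2"
      using fd \<delta> F(1) dP lo s\<delta> eps by linarith+
    ultimately obtain e2 e1 \<chi>' where Q: "P = cst e2 * (f * f) + cst e1 * f + \<chi>'" "\<chi>' \<in> alg {f2}" "dg \<chi>' \<le> dg P"
      using no_cancel_quadratic by metis
    obtain \<chi>'' b where x: "\<chi>' = \<chi>'' + cst b * f" "\<chi>'' \<in> alg {g2}" "dg \<chi>'' \<le> real s * \<delta>"
      using conv[OF Q(2)] Q(3) dP by force
    have "dg (cst c * \<chi> + \<chi>'') \<le> real s * \<delta>"
      using dg_add[of "cst c * \<chi>" \<chi>''] dg_cst_mult_le[of c \<chi>] chi x by simp
    moreover have "cst c * \<chi> + \<chi>'' \<in> alg {g2}" using chi x by (auto intro!: alg_rules)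
    moreover have "f1' = cst (c * c1) * g1 + cst (c * \<alpha> + e2) * (f * f) + cst (c * \<beta> + e1 + b) * f + (cst c * \<chi> + \<chi>'')"
      unfolding P(3) Q(1) x(1) f1 cst_add cst_mult by (simp add: algebra_simps)
    moreover have "dg f1' \<le> real s * \<delta>" using l(2) le by simp
    ultimately have "mates \<delta> s f g1 g2 f1' f2 (c * \<alpha> + e2) (c * \<beta> + e1 + b) \<gamma>"
      unfolding mates_def using P(1) c1 c2 f2 le
      by (intro exI[of _ "c * c1"] exI[of _ c2] exI[of _ c0] exI[of _ "cst c * \<chi> + \<chi>''"]) auto
    then show ?thesis using red_su[OF su hub] by blast
  qed
  show "red f f1 f2'" if l: "line f2' f2 f f1" "dg f2' \<le> dg f2"
  proof -
    obtain c P where P: "c \<noteq> 0" "P \<in> alg {f, f1}" "f2' = cst c * f2 + P" using l(1) by (auto simp: line_def)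
    have dP: "dg P \<le> 2 * \<delta>"
    proof -
      have "P = f2' - cst c * f2" using P by simp
      then show ?thesis using dg_diff[of f2' "cst c * f2"] dg_cst_mult_le[of c f2] l(2) le by simp
    qed
    have br: "br f f1 = (real s - 2) * \<delta> + \<kappa>" using F(7) by (simp add: \<kappa>_def)
    have "no_cancel P f f1"
    proof (rule ccontr)
      assume "\<not> no_cancel P f f1"
      then obtain p q \<eta> where top_cancel: "top_cancel p q \<eta> P f f1" using cancel[OF P(2) wedge(4)] by blast
      show False using top_cancel_cases[OF top_cancel]
      proof (elim disjE conjE)
        assume *: "dg f1 = real q * dg f" "1 \<le> q" "br f f1 - dg f \<le> dg P"
        then have "dg f \<ge> 2 * (real s * \<delta>) - 4 * \<delta> + \<epsilon>" using br kap dP s\<delta> by linarith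
        moreover from this have "s = 3" using hi eps s\<delta> by (intro scale_form) linarith
        ultimately show False using * d1 hi eps \<delta> by - (rule of_nat_mult_casesE[of "dg f" q]; auto)
      next
        assume "dg f = real p * dg f1" "1 \<le> p"
        then show False using d1 hi df1 \<delta> by - (rule of_nat_mult_casesE[of "dg f1" p]; auto)
      next
        assume "br f f1 \<le> dg P"
        then show False using br kap eps dP s\<delta> \<delta> by linarith
      qed
    qed
    moreover have "0 < dg f" "0 < dg f1" "dg P < 3 * dg f" "dg P < dg f + dg f1" "dg P < 2 * dg f"
      using fd \<delta> dP df1 by linarith+
    ultimately obtain e1 \<chi>' where Q: "P = cst e1 * f + \<chi>'" "\<chi>' \<in> alg {f1}" "dg \<chi>' \<le> dg P"
      using no_cancel_quadratic[of P f f1] by (metis cst_0 mult_zero_left add_0)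
    obtain b where b: "\<chi>' = cst b" using alg1_const[OF Q(2)] df1 Q(3) dP \<delta> by force
    have "f2' = cst (c * c2) * g2 + cst (c * \<gamma> + e1) * f + cst (c * c0 + b)"
      unfolding P(3) Q(1) b f2 cst_add cst_mult by (simp add: algebra_simps)
    moreover have "dg f2' \<le> 2 * \<delta>" using l(2) le by simp
    ultimately have "mates \<delta> s f g1 g2 f1 f2' \<alpha> \<beta> (c * \<gamma> + e1)"
      unfolding mates_def using P(1) c1 c2 f1 le chi
      by (intro exI[of _ c1] exI[of _ "c * c2"] exI[of _ "c * c0 + b"] exI[of _ \<chi>]) auto
    then show ?thesis using red_su[OF su hub] by blast
  qed
  show "red f' f1 f2" if l: "line f' f f1 f2" "dg f' \<le> dg f"
  proof (cases "\<alpha> = 0 \<and> \<beta> = 0 \<and> \<gamma> = 0")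
    case True
    then have "mates \<delta> s f g1 g2 f1 f2 0 0 0" using ma by simp
    note tr = mates_trivial[OF this]
    have df: "dg f1 = real s * \<delta>" using d1 True by simp
    have lt: "dg g3 + dg g1 + dg g2 < d" using su(3) d df F(1) g by simp
    have "red g3 f1 g2" using closedD(2)[OF cl su(1) lt] line1_line(1)[OF tr(1)] by blast
    then have "red g3 f1 f2" using closedD(3)[OF cl, of g3 f1 g2 f2] lt df g line1_line(1)[OF tr(2)] by simp
    moreover have "line f g3 f1 f2" using line_alg_cong[OF su(2)] tr(3) by simp
    then have "line f' g3 f1 f2" using l(1) line_trans by blast
    ultimately show ?thesis using closedD(1)[OF cl, of g3 f1 f2 f'] su(3) d by simp
  next
    case False
    then have br: "\<kappa> \<le> br f1 f2" using F(9) by (auto simp: \<kappa>_def)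
    obtain c P where P: "c \<noteq> 0" "P \<in> alg {f1, f2}" "f' = cst c * f + P" using l(1) by (auto simp: line_def)
    have dP: "dg P \<le> dg f"
    proof -
      have "P = f' - cst c * f" using P by simp
      then show ?thesis using dg_diff[of f' "cst c * f"] dg_cst_mult_le[of c f] l(2) by simp
    qed
    have lt1: "dg f < dg f1" using d1 df1 hi \<delta> by auto
    have "no_cancel P f1 f2"
    proof (rule ccontr)
      assume "\<not> no_cancel P f1 f2"
      then obtain p q \<eta> where top_cancel: "top_cancel p q \<eta> P f1 f2" using cancel[OF P(2) wedge(5)] by blast
      show False using top_cancel_cases[OF top_cancel]
      proof (elim disjE conjE)
        assume "dg f2 = real q * dg f1" "1 \<le> q"
        then show False using F(1) df1 \<delta> by - (rule of_nat_mult_casesE[of "dg f1" q]; linarith)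
      next
        assume *: "dg f1 = real p * dg f2" "br f1 f2 - dg f2 \<le> dg P"
        show False
        proof (cases "dg f1 = real s * \<delta>")
          case True
          then show False using odd_neq_even_mult[OF s(1) \<delta>, of p] * F(1) by simp
        next
          case False
          then have "dg f + \<kappa> \<le> br f1 f2" "dg f = 3/2 * \<delta>" "s = 3" using d1 F(10) by (auto simp: \<kappa>_def)
          then show False using * kap eps dP F(1) \<delta> by simp
        qed
      next
        assume "br f1 f2 \<le> dg P"
        then show False using br kap eps dP hi by simp
      qed
    qed
    moreover have "0 < dg f1" "0 < dg f2" "dg P < 3 * dg f1" "dg P < dg f1 + dg f2" "dg P < dg f1"
      using fd \<delta> dP lt1 F(1) by linarith+
    \<comment> \<open>As \<open>dg P\<close> is below \<open>dg f1\<close>, no power of f1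
      occurs.\<close>
    ultimately have Pf2: "P \<in> alg {f2}"
      using no_cancel_quadratic[of P f1 f2] by (metis cst_0 mult_zero_left add_0)
    have const: "\<exists>b. P = cst b" if "dg f < 2 * \<delta>"
      using alg1_const[OF Pf2] F(1) dP \<delta> that by force
    have Pg2: "P \<in> alg {g2}"
    proof (cases "\<gamma> = 0")
      case True
      have "f2 \<in> alg {g2}" unfolding f2 True by (auto intro!: alg_rules intro: alg_gen)
      then show ?thesis using Pf2 alg_sub[of "{f2}" "{g2}"] by auto
    next
      case False
      then show ?thesis using F(2) const by (auto intro: alg_cst)
    qed
    \<comment> \<open>Equality is excluded because \<open>dg P\<close> is a multiple of 2 delta and
      \<open>dg f\<close> is not. Hence f' keeps the degree of f, as \<open>hub\<close>
      requires.\<close>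
    have Plt: "dg P < dg f"
    proof (cases "P = 0")
      case True
      then show ?thesis using fd \<delta> by simp
    next
      case False
      obtain n where "dg P = real n * dg g2" using alg1_deg[OF Pg2 _ False] g \<delta> by auto
      then show ?thesis using odd[of n] g dP by (auto simp: order_less_le)
    qed
    have df': "dg f' = dg f" unfolding P(3) using P(1) Plt by (simp add: dg_add_eq2)
    obtain k where k: "\<And>i. D i P = k * D i g2" using alg1_chain[OF Pg2] g \<delta> by auto
    have "wedge f' g2 = scale_form (cst c) (wedge f g2)"
      unfolding P(3) wedge_def scale_form_def der_add exponent.der_cst_mult k by (simp add: algebra_simps)
    then have "br f' g2 = br f g2" using P(1) by (simp add: fdg_def scale_form_def)
    then have hub': "hub \<delta> s f' g1 g2" using hub df' by (simp add: hub_def)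
    have line': "line f' g3 g1 g2"
      using line_trans[OF _ su(2)] lineI[OF P(1) _ P(3)] Pg2 alg1_alg2(1) by blast
    have f: "f = cst (inverse c) * f' - cst (inverse c) * P"
      using cst_cancel(1)[OF P(1), of f] by (simp add: P(3) distrib_left)
    define i where "i = inverse c"
    have fi: "f = cst i * f' - cst i * P" using f by (simp add: i_def)
    have "\<exists>\<alpha>' \<beta>' \<chi>'. f1 = cst c1 * g1 + cst \<alpha>' * (f' * f') + cst \<beta>' * f' + \<chi>' \<and> \<chi>' \<in> alg {g2} \<and> dg \<chi>' \<le> real s * \<delta>"
    proof (cases "\<alpha> = 0")
      case True
      have "f1 = cst c1 * g1 + cst 0 * (f' * f') + cst (\<beta> * i) * f' + (\<chi> - cst (\<beta> * i) * P)"
        unfolding f1 True cst_mult by (subst fi) (simp add: algebra_simps)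
      moreover have "\<chi> - cst (\<beta> * i) * P \<in> alg {g2}" using chi Pg2 by (auto intro!: alg_rules)
      moreover have "dg (\<chi> - cst (\<beta> * i) * P) \<le> real s * \<delta>"
        using dg_diff[of \<chi> "cst (\<beta> * i) * P"] dg_cst_mult_le[of "\<beta> * i" P] chi Plt hi by simp
      ultimately show ?thesis by blast
    next
      case False
      \<comment> \<open>A square term forces \<open>dg f\<close> below 2 delta, so P is constant and
        completing the expression in f' changes only the lower coefficients.\<close>
      then obtain b where b: "P = cst b" using const F(3) \<delta> by force
      have "f1 = cst c1 * g1 + cst (\<alpha> * i * i) * (f' * f') + cst (\<beta> * i - (\<alpha> + \<alpha>) * i * i * b) * f'
         + (\<chi> + cst (\<alpha> * i * i * b * b - \<beta> * i * b))"
        unfolding f1 cst_mult cst_add cst_diff fi b by (simp add: algebra_simps)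
      moreover have "\<chi> + cst (\<alpha> * i * i * b * b - \<beta> * i * b) \<in> alg {g2}" using chi by (auto intro!: alg_rules)
      moreover have "dg (\<chi> + cst (\<alpha> * i * i * b * b - \<beta> * i * b)) \<le> real s * \<delta>"
        using dg_add[of \<chi> "cst (\<alpha> * i * i * b * b - \<beta> * i * b)"] dg_cst[of "\<alpha> * i * i * b * b - \<beta> * i * b"]
          chi hi fd \<delta> by linarith
      ultimately show ?thesis by blast
    qed
    then obtain \<alpha>' \<beta>' \<chi>' where n1: "f1 = cst c1 * g1 + cst \<alpha>' * (f' * f') + cst \<beta>' * f' + \<chi>'"
      "\<chi>' \<in> alg {g2}" "dg \<chi>' \<le> real s * \<delta>" by blast
    have "\<exists>c0'. f2 = cst c2 * g2 + cst (\<gamma> * i) * f' + cst c0'"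
    proof (cases "\<gamma> = 0")
      case True
      then show ?thesis using f2 by auto
    next
      case False
      then obtain b where b: "P = cst b" using const F(2) by blast
      have "f2 = cst c2 * g2 + cst (\<gamma> * i) * f' + cst (c0 - \<gamma> * i * b)"
        unfolding f2 cst_mult cst_diff fi b by (simp add: algebra_simps)
      then show ?thesis by blast
    qed
    then obtain c0' where n2: "f2 = cst c2 * g2 + cst (\<gamma> * i) * f' + cst c0'" by blast
    have "mates \<delta> s f' g1 g2 f1 f2 \<alpha>' \<beta>' (\<gamma> * i)"
      unfolding mates_def using c1 c2 n1 n2 le
      by (intro exI[of _ c1] exI[of _ c2] exI[of _ c0'] exI[of _ \<chi>']) auto
    then show ?thesis using red_su[OF su(1) line' _ hub'] su(3) df' by simp
  qed
qed

section \<open>Two competing elementary reductions\<close>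

lemma gap_small:
  assumes "2 \<le> p" "2 \<le> q" "0 < \<eta>" "(real p * real q - p - q) * \<eta> < real p * \<eta>"
  shows "q = 2 \<or> p = 2 \<and> q = 3"
proof -
  have "real p * real q - p - q < p" using assms(3,4) by (simp add: mult_less_cancel_right)
  then have "real (p * q) < real (2 * p + q)" by simp
  then have l: "p * q < 2 * p + q" by linarith
  obtain j k where "p = 2 + j" "q = 2 + k" using assms(1,2) by (metis le_Suc_ex)
  then have "k + j * k < 2" using l by (simp add: algebra_simps)
  then have "k = 0 \<or> k = 1 \<and> j = 0" by (cases k; cases j) auto
  then show ?thesis using \<open>p = 2 + j\<close> \<open>q = 2 + k\<close> by auto
qed

text \<open>Cleared of eta, the last hypothesis reads (2 p - 3) (q - 1) < 3; coprimality removes (2,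
  2). In \<open>gap_small\<close> the analogous form is (p - 1) (q - 2) < 2.\<close>

lemma gap_small2:
  assumes "2 \<le> p" "2 \<le> q" "coprime p q" "0 < \<eta>" "(real p * real q - p - q) * \<eta> < real q * \<eta> / 2"
  shows "p = 2 \<and> q = 3"
proof -
  have "(2 * (real p * real q - p - q)) * \<eta> < real q * \<eta>" using assms(5) by linarith
  then have "2 * (real p * real q - p - q) < q" using assms(4) by (rule mult_right_less_imp_less[OF _ less_imp_le])
  then have "real (2 * (p * q)) < real (2 * p + 3 * q)" by simp
  then have l: "2 * (p * q) < 2 * p + 3 * q" by linarith
  obtain j k where jk: "p = 2 + j" "q = 2 + k" using assms(1,2) by (metis le_Suc_ex)
  then have "2 * j + k + 2 * (j * k) < 2" using l by (simp add: algebra_simps)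
  then have "j = 0 \<and> k < 2" by (cases j) auto
  moreover have "k \<noteq> 0"
  proof
    assume "k = 0"
    then have "p = 2" "q = 2" using calculation jk by auto
    then show False using assms(3) by simp
  qed
  ultimately show ?thesis using jk by auto
qed

text \<open>By contradiction: every detour through smaller triples must fail, which excludes
  coincidences of degrees. Then the cases are whether top terms cancel in \<psi>, the move of x, and
  in \<phi>, the descent of y. Cancellation in \<phi> alone produces a Shestakov-Umirbaev reduction
  with hub y; cancellation in \<psi> ends in the exceptional degrees, a detour or a
  contradiction.\<close>

lemma el_red_closed:
  assumes cl: "closed d" and r0: "red x y1 z" and y1: "line y y1 x z" "dg y1 < dg y"
    and d: "dg x + dg y + dg z \<le> d" and x': "line x' x y z" "dg x' \<le> dg x"
  shows "red x' y z"
proof (rule ccontr)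
  assume neg: "\<not> red x' y z"
  \<comment> \<open>A y0 of minimal degree is what \<open>hub_generic\<close> and
    \<open>exceptional_4_3\<close> require.\<close>
  define Y where "Y = {g. red x g z \<and> line y g x z}"
  have "y1 \<in> Y" using r0 y1 by (simp add: Y_def)
  then obtain y0 where y0Y: "y0 \<in> Y" and ymin: "\<And>g. g \<in> Y \<Longrightarrow> dg y0 \<le> dg g" using min_dg by metis
  have r: "red x y0 z" and y0: "line y y0 x z" using y0Y by (auto simp: Y_def)
  have y0lt: "dg y0 < dg y" using ymin[OF \<open>y1 \<in> Y\<close>] y1 by simp
  have lt: "dg x + dg y0 + dg z < d" using y0lt d by simp
  have irr: "dg y0 \<le> dg g" if "line g y0 x z" for g
  proof -
    have "red x g z" using closedD(2)[OF cl r lt that] .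
    moreover have "line y g x z" using line_trans[OF y0 line_sym[OF that]] .
    ultimately show ?thesis using ymin by (simp add: Y_def)
  qed
  have a0: "keller x y0 z" by (rule red_keller[OF r])
  have "keller y x z" using keller_line[OF keller_perm(1)[OF a0] y0] .
  then have a: "keller x y z" by (rule keller_perm)
  have wedge: "wedge x z \<noteq> 0" "wedge y z \<noteq> 0" "wedge x y \<noteq> 0" "wedge z y \<noteq> 0"
    using keller_wedge[OF a] keller_wedge[OF keller_perm(3)[OF a]] keller_wedge(1)[OF keller_perm(2)[OF a]] by auto
  have W0: "wedge y0 z \<noteq> 0" using keller_wedge[OF a0] by auto
  have pos: "0 < dg x" "0 < dg y" "0 < dg z" using keller_dg_pos[OF a] by auto
  have nS0: "\<not> line1 x' x z" using red_line1_move[OF cl r y0 y0lt d _ x'(2)] neg by blast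
  \<comment> \<open>If z alone lowered x, that reduction would commute with the descent of y, and x'
    would be reached from the smaller triple.\<close>
  have nb1: "\<not> (line1 g x z \<and> dg g < dg x)" for g
  proof
    assume g: "line1 g x z \<and> dg g < dg x"
    then have "red g y z" using red_line1_move[OF cl r y0 y0lt d] by simp
    moreover have "line x' g y z" using line_trans[OF x'(1) line1_line(1)[OF line1_sym]] g by blast
    ultimately show False using closedD(1)[OF cl, of g y z x'] g d neg by simp
  qed
  have nb: "dg x \<noteq> real n * dg z" for n using power_red[of x n z] pos nb1 by metis
  have na1: "\<not> (line1 g y z \<and> dg g < dg y)" for g
    using red_line_move[OF cl r y0 y0lt d _ _ x'] neg by blast
  have na: "dg y \<noteq> real n * dg z" for n using power_red[of y n z] pos na1 by metis
  have nac: "dg y \<noteq> dg z" "dg x \<noteq> dg z" using na[of 1] nb[of 1] by auto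
  have nab: "dg y \<noteq> dg x"
  proof
    assume e: "dg y = dg x"
    then obtain c where c: "c \<noteq> 0" "dg (y - cst c * x) < dg y" using cancel_top[of y x] pos by force
    \<comment> \<open>The same u lowers y modulo x and x modulo y, so the smaller triple (u, y, z)
      is a detour to x'.\<close>
    define u where "u = y - cst c * x"
    have "line u y x z" using c
      by (intro lineI[of 1 "- (cst c * x)"]) (auto simp: u_def intro!: alg_rules intro: alg_gen)
    then have ru: "red x u z" using closedD(2)[OF cl r lt] line_trans[OF _ y0] by blast
    have "line y x u z" using c
      by (intro lineI[of c u]) (auto simp: u_def intro: alg_gen)
    then have "red y u z" using closedD(1)[OF cl ru] c d by (simp add: u_def)
    then have ru2: "red u y z" by (rule red_perm)
    have "line u x y z" using c
      by (intro lineI[of "- c" y]) (auto simp: u_def cst_uminus intro: alg_gen)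
    then have "line x' u y z" using line_trans[OF x'(1) line_sym] by blast
    then show False using closedD(1)[OF cl ru2] c d e neg by (simp add: u_def)
  qed
  obtain c\<phi> \<phi> where \<phi>: "c\<phi> \<noteq> 0" "\<phi> \<in> alg {x, z}" "y = cst c\<phi> * y0 + \<phi>" using y0 by (auto simp: line_def)
  obtain c\<psi> \<psi> where \<psi>: "c\<psi> \<noteq> 0" "\<psi> \<in> alg {y, z}" "x' = cst c\<psi> * x + \<psi>" using x'(1) by (auto simp: line_def)
  have d\<phi>: "dg \<phi> = dg y" by (rule dg_move[OF \<phi>(1) y0lt \<phi>(3)])
  have d\<psi>: "dg \<psi> \<le> dg x"
  proof -
    have "\<psi> = x' - cst c\<psi> * x" using \<psi> by simp
    then show ?thesis using dg_diff[of x' "cst c\<psi> * x"] dg_cst_mult_le[of c\<psi> x] x'(2) by simp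
  qed
  have \<phi>0: "\<phi> \<noteq> 0" using d\<phi> pos by auto
  have low: False if "no_cancel \<psi> y z" "dg x < dg y"
  proof -
    have "dg \<psi> < 3 * dg y" "dg \<psi> < dg y + dg z" "dg \<psi> < dg y" using that d\<psi> pos by linarith+
    then have "\<psi> \<in> alg {z}" using no_cancel_quadratic[OF that(1) pos(2,3)] by (metis cst_0 mult_zero_left add_0)
    then show False using nS0 line1I[OF \<psi>(1) _ \<psi>(3)] by blast
  qed
  have zgood: "red x y g" if "line1 g z x" "dg g < dg z" for g
  proof -
    have "red g y x"
    proof (rule red_line1_move[OF cl red_perm(5)[OF r] _ y0lt])
      show "line y y0 z x" using y0 by (simp add: line_commute)
    qed (use that d in auto)
    then show ?thesis by (rule red_perm)
  qed
  \<comment> \<open>If z descends both over (x, y) and by y alone, the detour goes through z: x is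
    moved while z is low.\<close>
  have zS2: False if "red x g z'" "line z z' x g" "dg z' < dg z" "line1 h z y" "dg h < dg z" "g = y" for g h z'
  proof -
    have "red x' z y"
    proof (rule red_line_move[OF cl red_perm(1), where y' = h])
      show "red x y z'" "line z z' x y" using that by auto
      show "line x' x z y" using x'(1) by (simp add: line_commute)
    qed (use that d x' in auto)
    then show False using neg red_perm by blast
  qed
  have zpow: "\<exists>h. line1 h z v \<and> dg h < dg z" if "dg z = real n * dg v" "0 < dg v" for n v
    using power_red[OF that pos(3)] by metis
  have hub_xz: "hub \<delta> s y x z" if "0 < \<delta>" "odd s" "3 \<le> s" "dg x = real s * \<delta>" "dg z = 2 * \<delta>" "dg y < real s * \<delta>" for \<delta> s
  proof (rule hub_generic[OF closed_mono[OF cl] red_perm(2)[OF r]])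
    show "dg y \<noteq> 2 * real j * \<delta>" for j using na[of j] that by (simp add: mult.commute mult.left_commute)
  qed (use that lt irr y0 y0lt in auto)
  have hub_zx: "hub \<delta> 3 y z x" if "0 < \<delta>" "dg z = 3 * \<delta>" "dg x = 2 * \<delta>" "dg y < 2 * \<delta>" for \<delta>
  proof (rule hub_generic[OF closed_mono[OF cl] red_perm(3)[OF r]])
    show "dg y \<noteq> 2 * real j * \<delta>" for j
    proof -
      have "dg y \<noteq> real j * (2 * \<delta>)"
      proof
        assume "dg y = real j * (2 * \<delta>)"
        then show False using that pos by - (rule of_nat_mult_casesE[of "2 * \<delta>" j]; linarith)
      qed
      then show ?thesis by (simp add: mult.commute mult.left_commute)
    qed
  qed (use that lt irr y0 y0lt in \<open>auto simp: line_commute\<close>)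
  \<comment> \<open>Both orders of the generators are kept, because the derivative clause of
    \<open>top_cancel\<close> distinguishes them.\<close>
  consider "no_cancel \<psi> y z" | p q \<eta> p2 q2 \<eta>2 where "top_cancel p q \<eta> \<psi> y z" "top_cancel p2 q2 \<eta>2 \<psi> z y"
    using cancel[OF \<psi>(2) wedge(2)] cancel[of \<psi> z y] wedge(4) \<psi>(2) no_cancel_commute by (metis insert_commute)
  then show False
  proof cases
    case NCpsi: 1
    consider "no_cancel \<phi> x z" | p q \<eta> where "top_cancel p q \<eta> \<phi> x z" using cancel[OF \<phi>(2) wedge(1)] by blast
    then show False
    proof cases
      case 1
      then obtain k where "vd x z k = dg y" using \<phi>0 unfolding no_cancel_def d\<phi> by blast
      then have e: "real (fst k) * dg x + real (snd k) * dg z = dg y" by (simp add: vd_def)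
      then have "fst k \<noteq> 0" using na[of "snd k"] by (cases "fst k = 0") simp_all
      then have "dg x \<le> dg y" using e pos by - (rule of_nat_mult_casesE[of "dg x" "fst k"]; rule of_nat_mult_casesE[of "dg z" "snd k"]; linarith)
      then show False using low[OF NCpsi] nab by simp
    next
      case 2
      then have lxy: "dg y < dg x" using low[OF NCpsi] nab by force
      note C = 2[unfolded top_cancel_def]
      consider "p = 1" | "q = 1" | "2 \<le> p" "2 \<le> q" using C by force
      then show False
      proof cases
        case 1
        then have zq: "dg z = real q * dg x" using C by simp
        obtain h where h: "line1 h z x" "dg h < dg z" using zpow[OF zq pos(1)] by blast
        have zx: "dg x < dg z" using zq C pos nac by - (rule of_nat_mult_casesE[of "dg x" q]; linarith)
        have "dg \<psi> < 3 * dg z" "dg \<psi> < dg z + dg y" "dg \<psi> < dg z" using d\<psi> pos zx by linarith+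
        then have "\<psi> \<in> alg {y}" using no_cancel_quadratic[OF no_cancel_commute[OF NCpsi] pos(3,2)] by (metis cst_0 mult_zero_left add_0)
        then have l1: "line1 x' x y" using \<psi> by (intro line1I[of c\<psi> \<psi>])
        have "red x' z y"
        proof (rule red_line1_move[OF cl red_perm(1)[OF zgood[OF h]] _ h(2) _ l1 x'(2)])
          show "line z h x y" using line1_line(2)[OF line1_sym[OF h(1)]] .
        qed (use d in simp)
        then show False using neg red_perm by blast
      next
        case 2
        then show False using C nb[of p] by simp
      next
        case pq: 3
        have "0 < br x z" by (rule br_pos[OF wedge(1)])
        then have "(real p * real q - p - q) * \<eta> < real p * \<eta>" using C lxy d\<phi> by linarith
        then have "q = 2 \<or> p = 2 \<and> q = 3" using gap_small[OF pq] C by blast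
        then show False
        proof (elim disjE conjE)
          assume q: "q = 2"
          then have "odd p" using C by (simp add: coprime_right_2_iff_odd)
          then have p3: "3 \<le> p" using pq by (cases "p = 2") auto
          have hub: "hub \<eta> p y x z" by (rule hub_xz) (use C q p3 \<open>odd p\<close> lxy in auto)
          have xp: "dg x = real p * \<eta>" and ez: "0 < \<eta>" "dg z = 2 * \<eta>" using C q by auto
          have "(real p - 2) * \<eta> < dg y" using hub br_pos[OF wedge(1)] by (auto simp: hub_def)
          then have "dg \<psi> < 3 * dg y" "dg \<psi> < dg y + dg z"
            using d\<psi> xp odd_mult_bounds[OF p3 ez(1)] ez by linarith+
          then obtain e2 e1 \<chi> where Q: "\<psi> = cst e2 * (y * y) + cst e1 * y + \<chi>" "\<chi> \<in> alg {z}" "dg \<chi> \<le> dg \<psi>"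
            using no_cancel_quadratic[OF NCpsi pos(2,3)] by metis
          \<comment> \<open>Here the interchange fails for a reason: (y, x', z) is a
            Shestakov-Umirbaev reduction with hub y over (x, z).\<close>
          have "mates \<eta> p y x z x' z e2 e1 0"
            unfolding mates_def using \<psi> Q d\<psi> xp x'(2) C q
            by (intro exI[of _ c\<psi>] exI[of _ 1] exI[of _ 0] exI[of _ \<chi>]) (auto simp: add.assoc)
          then have "red y x' z" using red_su[OF red_perm(2)[OF r] _ y0lt hub] y0 by blast
          then show False using neg red_perm by blast
        next
          assume q: "p = 2" "q = 3"
          have num: "dg z = 3 * \<eta>" "dg x = 2 * \<eta>" "0 < \<eta>" using C q by auto
          have hub: "hub \<eta> 3 y z x" by (rule hub_zx) (use num lxy in auto)
          have "\<eta> < dg y" using hub br_pos[OF wedge(1)] br_swap[of x z]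
            by (auto simp: hub_def)
          then have l: "dg \<psi> < 3 * dg y" "dg \<psi> < dg y + dg z" "dg \<psi> < 2 * dg y" "dg \<psi> < dg z"
            using d\<psi> num by linarith+
          then obtain e1 \<chi> where Q: "\<psi> = cst e1 * y + \<chi>" "\<chi> \<in> alg {z}" "dg \<chi> \<le> dg \<psi>"
            using no_cancel_quadratic[OF NCpsi pos(2,3)] by (metis cst_0 mult_zero_left add_0)
          obtain b where b: "\<chi> = cst b" using alg1_const[OF Q(2) pos(3)] Q(3) l by force
          have "mates \<eta> 3 y z x z x' 0 0 e1"
            unfolding mates_def using \<psi> Q b num x'(2)
            by (intro exI[of _ 1] exI[of _ c\<psi>] exI[of _ b] exI[of _ "0::mpol"]) (auto simp: add.assoc)
          then have "red y z x'" using red_su[OF red_perm(3)[OF r] _ y0lt hub] y0 by (simp add: line_commute)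
          then show False using neg red_perm by blast
        qed
      qed
    qed
  next
    case CCpsi: 2
    note C = CCpsi(1)[unfolded top_cancel_def]
    have by0: "0 < br y z" by (rule br_pos[OF wedge(2)])
    have bx0: "0 < br x z" by (rule br_pos[OF wedge(1)])
    consider "p = 1" | "q = 1" | "2 \<le> p" "2 \<le> q" using C by force
    then show False
    proof cases
      case 1
      then have zq: "dg z = real q * dg y" using C by simp
      obtain h2 where h2: "line1 h2 z y" "dg h2 < dg z" using zpow[OF zq pos(2)] by blast
      have nz1: "dg z \<noteq> real n * dg x" for n
      proof
        assume "dg z = real n * dg x"
        then obtain h where h: "line1 h z x" "dg h < dg z" using zpow pos by blast
        show False
          by (rule zS2[OF zgood[OF h] _ h(2) h2 refl]) (rule line1_line(2)[OF line1_sym[OF h(1)]])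
      qed
      have yz: "2 * dg y \<le> dg z" using zq C pos nac by - (rule of_nat_mult_casesE[of "dg y" q]; linarith)
      consider "no_cancel \<phi> x z" | p' q' \<eta>' where "top_cancel p' q' \<eta>' \<phi> x z" using cancel[OF \<phi>(2) wedge(1)] by blast
      then show False
      proof cases
        case 1
        then obtain k where "vd x z k = dg y" using \<phi>0 unfolding no_cancel_def d\<phi> by blast
        then have e: "real (fst k) * dg x + real (snd k) * dg z = dg y" by (simp add: vd_def)
        have "snd k = 0" using e pos yz by - (rule of_nat_mult_casesE[of "dg z" "snd k"]; rule of_nat_mult_casesE[of "dg x" "fst k"]; linarith)
        then have "dg z = real (q * fst k) * dg x" using e zq by simp
        then show False using nz1 by blast
      next
        case 2
        note C' = 2[unfolded top_cancel_def]
        have "p' \<noteq> 1" using C' nz1[of q'] by auto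
        moreover have "q' \<noteq> 1" using C' nb[of p'] by auto
        ultimately have pq': "2 \<le> p'" "2 \<le> q'" using C' by force+
        have "(real p' * real q' - p' - q') * \<eta>' < real q' * \<eta>' / 2" using C' yz d\<phi> bx0 by linarith
        then have pq: "p' = 2" "q' = 3" using gap_small2[OF pq'] C' by blast+
        have num: "dg z = 3 * \<eta>'" "dg x = 2 * \<eta>'" "0 < \<eta>'" "\<eta>' < dg y" using C' pq d\<phi> bx0 by auto
        have y32: "dg y = 3/2 * \<eta>'" using zq C num yz by - (rule of_nat_mult_casesE[of "dg y" q]; linarith)
        have hub: "hub \<eta>' 3 y z x" by (rule hub_zx) (use num y32 in auto)
        have "y \<noteq> 0" "z \<noteq> 0" using pos by auto
        then have "dg z = dg (y * y)" using dg_mult(2)[of y y] num y32 by simp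
        then obtain e where e: "e \<noteq> 0" "dg (z - cst e * (y * y)) < dg z" using cancel_top[of z "y * y"] \<open>z \<noteq> 0\<close> by blast
        define z2 where "z2 = z - cst e * (y * y)"
        have l2: "line1 z2 z y"
          by (rule line1I[of 1 "- (cst e * (y * y))"]) (auto simp: z2_def intro!: alg_rules intro: alg_gen)
        \<comment> \<open>Subtracting the square of y from z gives a companion, so the triple with
          the lower \<open>z2\<close> is reducible and the detour through z applies.\<close>
        have "mates \<eta>' 3 y z x z2 x (- e) 0 0"
          unfolding mates_def using e num
          by (intro exI[of _ 1] exI[of _ 0] exI[of _ "0::mpol"]) (auto simp: z2_def cst_uminus)
        then have "red y z2 x" using red_su[OF red_perm(3)[OF r] _ y0lt hub] y0 by (simp add: line_commute)
        then have "red x y z2" by (rule red_perm)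
        then show False
          by (rule zS2[OF _ _ _ l2 _ refl]) (use e line1_line(1)[OF line1_sym[OF l2]] in \<open>auto simp: z2_def\<close>)
      qed
    next
      case 2
      then show False using C na[of p] by simp
    next
      case pq: 3
      \<comment> \<open>Cancellation in \<psi> bounds \<open>br y z\<close> above; this will
        contradict the genericity of any hub at y.\<close>
      have by1: "br y z \<le> dg x" using top_cancel_cases[OF CCpsi(1)] pq d\<psi> by auto
      have lo: "(real p * real q - p - q) * \<eta> < dg x" using C by0 d\<psi> by linarith
      consider "no_cancel \<phi> x z" | p' q' \<eta>' where "top_cancel p' q' \<eta>' \<phi> x z" using cancel[OF \<phi>(2) wedge(1)] by blast
      then show False
      proof cases
        case NCphi: 1
        then obtain k where "vd x z k = dg y" using \<phi>0 unfolding no_cancel_def d\<phi> by blast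
        then have e: "real (fst k) * dg x + real (snd k) * dg z = dg y" by (simp add: vd_def)
        then have k0: "fst k \<noteq> 0" using na[of "snd k"] by (cases "fst k = 0") simp_all
        then have "dg x \<le> dg y" using e pos by - (rule of_nat_mult_casesE[of "dg x" "fst k"]; rule of_nat_mult_casesE[of "dg z" "snd k"]; linarith)
        then have xy: "dg x < dg y" using nab by simp
        then have "(real p * real q - p - q) * \<eta> < real p * \<eta>" using lo C by linarith
        then have "q = 2 \<or> p = 2 \<and> q = 3" using gap_small[OF pq] C by blast
        then show False
        proof (elim disjE conjE)
          assume q: "q = 2"
          then have "odd p" using C by (simp add: coprime_right_2_iff_odd)
          then have p3: "3 \<le> p" using pq by (cases "p = 2") auto
          have \<eta>: "0 < \<eta>" and yp: "dg y = real p * \<eta>" and zp: "dg z = 2 * \<eta>" using C q by auto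
          note S = odd_mult_bounds[OF p3 \<eta>]
          have lo2: "(real p - 2) * \<eta> < dg x" using lo q by (simp add: algebra_simps)
          have x2: "2 * dg x = dg y \<and> dg y < 4 * \<eta>"
            using e k0 yp zp S lo2 xy \<eta> pos by - (rule of_nat_mult_casesE[of "dg x" "fst k"]; rule of_nat_mult_casesE[of "dg z" "snd k"]; linarith)
          then have "p < 4" using yp \<eta> by simp
          then have p: "p = 3" using p3 \<open>odd p\<close> by (cases "p = 4") auto
          have x32: "dg x = 3/2 * \<eta>" "dg y = 3 * \<eta>" using x2 yp p by auto
          have "dg \<phi> < 3 * dg x" "dg \<phi> < dg x + dg z" using d\<phi> x32 zp \<eta> by linarith+
          then obtain e2 e1 \<chi> where Q: "\<phi> = cst e2 * (x * x) + cst e1 * x + \<chi>" "\<chi> \<in> alg {z}" "dg \<chi> \<le> dg \<phi>"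
            using no_cancel_quadratic[OF NCphi pos(1,3)] by metis
          have chi: "dg \<chi> < 3 * \<eta>" using alg1_deg_odd[OF Q(2) zp \<eta>, of 3] Q(3) d\<phi> x32 by simp
          have e2: "e2 \<noteq> 0"
          proof
            assume "e2 = 0"
            then have "dg \<phi> \<le> max (dg (cst e1 * x)) (dg \<chi>)" using Q(1) dg_add[of "cst e1 * x" \<chi>] by simp
            then show False using chi d\<phi> x32 dg_cst_mult_le[of e1 x] \<eta> by simp
          qed
          have "red x' y z"
          proof (rule exceptional_move[OF cl \<eta> r x32(1) zp _ _ \<phi>(1) e2 Q(2) _ x32(2) _ \<psi>(3,1,2) x'(2) CCpsi(1)])
            show "y = cst c\<phi> * y0 + cst e2 * (x * x) + cst e1 * x + \<chi>" unfolding \<phi>(3) Q(1) by (simp add: add.assoc)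
          qed (use y0lt x32 chi d zp in auto)
          then show False using neg by blast
        next
          assume q: "p = 2" "q = 3"
          have "dg y = 2 * \<eta>" "dg z = 3 * \<eta>" "0 < \<eta>" "\<eta> < dg x" using C q lo by auto
          then show False using e k0 xy by - (rule of_nat_mult_casesE[of "dg x" "fst k"]; rule of_nat_mult_casesE[of "dg z" "snd k"]; linarith)
        qed
      next
        case CCphi: 2
        note C' = CCphi[unfolded top_cancel_def]
        have "q' \<noteq> 1" using C' nb[of p'] by auto
        then have q'2: "2 \<le> q'" using C' by force
        show False
        proof (cases "p' = 1")
          case True
          then have zq: "dg z = real q' * dg x" using C' by simp
          have xz: "2 * dg x \<le> dg z" using zq q'2 pos by - (rule of_nat_mult_casesE[of "dg x" q']; linarith)
          then have "(real p * real q - p - q) * \<eta> < real q * \<eta> / 2" using lo C by linarith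
          then have q: "p = 2" "q = 3" using gap_small2[OF pq] C by blast+
          have num: "dg y = 2 * \<eta>" "dg z = 3 * \<eta>" "0 < \<eta>" "\<eta> < dg x" using C q lo by auto
          then have x32: "dg x = 3/2 * \<eta>" using zq q'2 by - (rule of_nat_mult_casesE[of "dg x" q']; linarith)
          have "x \<noteq> 0" "z \<noteq> 0" using pos by auto
          then have "dg z = dg (x * x)" using dg_mult(2)[of x x] num x32 by simp
          then obtain e where e: "e \<noteq> 0" "dg (z - cst e * (x * x)) < dg z" using cancel_top[of z "x * x"] \<open>z \<noteq> 0\<close> by blast
          define z1 where "z1 = z - cst e * (x * x)"
          have l1: "line1 z1 z x"
            by (rule line1I[of 1 "- (cst e * (x * x))"]) (auto simp: z1_def intro!: alg_rules intro: alg_gen)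
          have r1: "red x z1 y" using red_perm(1)[OF zgood[OF l1]] e by (simp add: z1_def)
          \<comment> \<open>Degrees are 3/2, 2, 3 times eta for x, y, z, so z and y exchange their
            roles in \<open>exceptional_move\<close>.\<close>
          have "red x' z y"
          proof (rule exceptional_move[OF cl num(3) r1 x32 num(1) _ _ _ e(1) alg_0 _ num(2) _ \<psi>(3,1) _ x'(2) CCpsi(2)])
            show "z = cst 1 * z1 + cst e * (x * x) + cst 0 * x + 0" by (simp add: z1_def)
            show "\<psi> \<in> alg {z, y}" using \<psi>(2) by (simp add: insert_commute)
          qed (use e num x32 d in \<open>auto simp: z1_def\<close>)
          then show False using neg red_perm by blast
        next
          case False
          then have pq': "2 \<le> p'" "2 \<le> q'" using q'2 C' by force+
          show False
          proof (cases "dg y < dg x")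
            case True
            then have "(real p' * real q' - p' - q') * \<eta>' < real p' * \<eta>'" using C' d\<phi> bx0 by linarith
            then have "q' = 2 \<or> p' = 2 \<and> q' = 3" using gap_small[OF pq'] C' by blast
            then show False
            proof (elim disjE conjE)
              assume q: "q' = 2"
              then have "odd p'" using C' by (simp add: coprime_right_2_iff_odd)
              then have p3: "3 \<le> p'" using pq' by (cases "p' = 2") auto
              have "hub \<eta>' p' y x z" by (rule hub_xz) (use C' q p3 \<open>odd p'\<close> True in auto)
              \<comment> \<open>Genericity gives a bracket above p' eta', which is
                \<open>dg x\<close>, contrary to the upper bound from \<psi>.\<close>
              then have "real p' * \<eta>' + br x z \<le> br y z" by (auto simp: hub_def)
              then show False using by1 bx0 C' by linarith
            next
              assume q: "p' = 2" "q' = 3"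
              have num: "dg z = 3 * \<eta>'" "dg x = 2 * \<eta>'" "0 < \<eta>'" using C' q by auto
              have hub: "hub \<eta>' 3 y z x" by (rule hub_zx) (use num True in auto)
              have m: "mates \<eta>' 3 y z x z x 0 0 0" by (rule mates_refl) (use num in auto)
              have "br y z = (real 3 - 2) * \<eta>' + br y x"
                using su_red_facts(6)[OF _ hub m] keller_perm(3)[OF a] by auto
              moreover have "3 * \<eta>' + br z x \<le> br y x" using hub by (auto simp: hub_def)
              ultimately show False using by1 bx0 num br_swap[of z x] by simp
            qed
          next
            case False
            then have xy: "dg x < dg y" using nab by simp
            then have "(real p * real q - p - q) * \<eta> < real p * \<eta>" using lo C by linarith
            then have qq: "q = 2 \<or> p = 2 \<and> q = 3" using gap_small[OF pq] C by blast
            have "real p * 1 \<le> real p * real q" using pq by (intro mult_left_mono) auto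
            then have "real p * \<eta> \<le> real p * real q * \<eta>" using C by (intro mult_right_mono) auto
            then have "dg \<psi> < real p * real q * \<eta>" using d\<psi> xy C by linarith
            then obtain h h' where h: "\<And>i. D i \<psi> = h * D i y + h' * D i z" "h \<noteq> 0" "(real p * real q - p) * \<eta> \<le> dg h"
              using C pq by blast
            \<comment> \<open>Both moves now cancel top terms. Each provides a large derivative, and
              the Jacobian of (x', y0, z) must accommodate their product.\<close>
            have jac: "dg h + (real q' - 1) * dg x + sig \<le> dg x + dg y0 + dg z" if "dg y < real q' * dg x"
            proof -
              have "dg \<phi> < real p' * real q' * \<eta>'" using that d\<phi> C' by (simp add: mult.commute mult.left_commute)
              then obtain k k' where k: "\<And>i. D i \<phi> = k * D i x + k' * D i z" "k \<noteq> 0" "(real p' * real q' - p') * \<eta>' \<le> dg k"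
                using C' pq' by blast
              have Dy: "D i y = cst c\<phi> * D i y0 + k * D i x + k' * D i z" for i
                unfolding \<phi>(3) der_add exponent.der_cst_mult k(1) by (simp add: algebra_simps)
              have dx: "dg x = real p' * \<eta>'" using C' by blast
              have k3: "(real q' - 1) * dg x \<le> dg k" using k(3) unfolding dx by (simp add: algebra_simps)
              have "1 * dg x \<le> (real q' - 1) * dg x" using q'2 pos by (intro mult_right_mono) auto
              then have "0 < dg h + dg k" using k3 dg_nonneg[OF h(2)] pos by linarith
              then have "dg h + dg k + sig \<le> dg x' + br y0 z"
                using jac_two_moves[OF \<psi>(3) h(1,2) Dy k(2) a0 _ W0] by blast
              then show ?thesis using br_le[OF W0] k3 x'(2) by linarith
            qed
            show False using qq
            proof (elim disjE conjE)
              assume q: "q = 2"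
              then have "odd p" using C by (simp add: coprime_right_2_iff_odd)
              then have p3: "3 \<le> p" using pq by (cases "p = 2") auto
              have \<eta>: "0 < \<eta>" and yp: "dg y = real p * \<eta>" and zp: "dg z = 2 * \<eta>" using C q by auto
              note S = odd_mult_bounds[OF p3 \<eta>]
              have lo2: "(real p - 2) * \<eta> < dg x" using lo q by (simp add: algebra_simps)
              have hq: "dg y \<le> dg h" using h(3) q yp by (simp add: algebra_simps)
              have \<eta>': "0 < \<eta>'" "dg x = real p' * \<eta>'" "real q' * \<eta>' = 2 * \<eta>" using C' zp by auto
              have "q' \<noteq> 2"
              proof
                assume q2: "q' = 2"
                then have "\<eta>' = \<eta>" using \<eta>'(3) by simp
                \<comment> \<open>Both p and p' would be odd, yet p' lies strictly between p - 2 and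
                  p.\<close>
                then have "real p - 2 < real p'" "real p' < real p" using lo2 xy yp \<eta>'(2) \<eta> by auto
                moreover have "odd p'" using C' q2 by (simp add: coprime_right_2_iff_odd)
                ultimately have "p = p' + 1" by linarith
                then show False using \<open>odd p\<close> \<open>odd p'\<close> by simp
              qed
              then have q3: "3 \<le> q'" using q'2 by simp
              then have "3 * dg x \<le> real q' * dg x" using pos by (intro mult_right_mono) auto
              then have "dg y < real q' * dg x" using lo2 S yp by linarith
              note J1 = jac[OF this]
              have "(real q' - 1) * dg x = real q' * dg x - dg x" by (simp add: algebra_simps)
              then have u: "real q' * dg x < 2 * dg x + 2 * \<eta>" using J1 hq y0lt zp sig_pos by linarith
              then have "dg x < 2 * \<eta>" using \<open>3 * dg x \<le> real q' * dg x\<close> by linarith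
              then have "(real p - 2) * \<eta> < 2 * \<eta>" using lo2 by linarith
              then have "p < 4" using \<eta> by simp
              then have p: "p = 3" using p3 by simp
              have lx: "\<eta> < dg x" using lo2 p by simp
              have q'3: "q' = 3"
              proof (rule ccontr)
                assume "q' \<noteq> 3"
                then have "4 * dg x \<le> real q' * dg x" using q3 pos by (intro mult_right_mono) auto
                then show False using u lx by linarith
              qed
              have e': "\<eta>' = 2/3 * \<eta>" using \<eta>'(3) q'3 by simp
              have "real p' * 2 > 3" "real p' < 3" using lx \<open>dg x < 2 * \<eta>\<close> \<eta>'(2) e' \<eta> by auto
              then have "p' = 2" by linarith
              then have x43: "dg x = 4/3 * \<eta>" using \<eta>'(2) e' by simp
              have y3: "dg y = 3 * \<eta>" using yp p by simp
              \<comment> \<open>The arithmetic has isolated the degrees 4/3, 3, 2 times eta, which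
                need the separate argument.\<close>
              show False
                by (rule exceptional_4_3[OF \<eta> r x43 y3 zp \<phi>(3,1,2) y0lt irr \<psi>(3,2) x'(2) \<psi>(1) CCphi CCpsi(1)])
            next
              assume q: "p = 2" "q = 3"
              have num: "dg y = 2 * \<eta>" "dg z = 3 * \<eta>" "0 < \<eta>" "\<eta> < dg x" using C q lo by auto
              have h4: "4 * \<eta> \<le> dg h" using h(3) q by simp
              have "2 * dg x \<le> real q' * dg x" using pos q'2 by (intro mult_right_mono) auto
              then have "dg y < real q' * dg x" using num by linarith
              note J1 = jac[OF this]
              have "(real q' - 1) * dg x = real q' * dg x - dg x" by (simp add: algebra_simps)
              then have u: "real q' * dg x < 2 * dg x + \<eta>" using J1 h4 y0lt num sig_pos by linarith
              have q'2': "q' = 2"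
              proof (rule ccontr)
                assume "q' \<noteq> 2"
                then have "3 * dg x \<le> real q' * dg x" using q'2 pos by (intro mult_right_mono) auto
                then show False using u num by linarith
              qed
              have e': "\<eta>' = 3/2 * \<eta>" using C' num q'2' by simp
              have "2 * \<eta>' \<le> real p' * \<eta>'" using C' pq' by (intro mult_right_mono) auto
              then show False using C' e' num xy by linarith
            qed
          qed
        qed
      qed
    qed
  qed
qed

text \<open>Induction on the rank of the degree sum turns closure below d into closure at d. By
  \<open>red_cases\<close> the starting triple is minimal, elementarily reducible in one place, or a
  Shestakov-Umirbaev triple in some order.\<close>

theorem red_closed: "closed d"
proof -
  have "\<forall>x y z x'. rk (dg x + dg y + dg z) = n \<longrightarrow> red x y z \<longrightarrow> line x' x y z \<longrightarrow> red x' y z" for n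
  proof (induction n rule: less_induct)
    case (less n)
    show ?case
    proof (intro allI impI)
      fix x y z x' assume n: "rk (dg x + dg y + dg z) = n" and r: "red x y z" and l: "line x' x y z"
      define d where "d = dg x + dg y + dg z"
      have a: "keller x y z" by (rule red_keller[OF r])
      have "x \<noteq> 0" "y \<noteq> 0" "z \<noteq> 0" using keller_dg_pos[OF a] by auto
      then obtain k where k: "d = wt k" unfolding d_def using wt_add by (metis dg_top)
      have cl: "closed d"
        unfolding closed_def
      proof (intro allI impI)
        fix u v w u' assume u: "red u v w" "dg u + dg v + dg w < d" "line u' u v w"
        then have "rk (dg u + dg v + dg w) < n" using rk_less[of _ k] n k d_def by metis
        then show "red u' v w" using less u by blast
      qed
      show "red x' y z"
      proof (cases "dg x < dg x'")
        case True
        \<comment> \<open>A move that raises the degree is a reduction read backwards.\<close>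
        then show ?thesis using red_elem[OF r l] by blast
      next
        case False
        then have x': "dg x' \<le> dg x" by simp
        have su: "red x' y z" if "su_red x y z \<or> su_red x z y \<or> su_red y x z \<or> su_red y z x \<or> su_red z x y \<or> su_red z y x"
        proof -
          have 1: "red f' f1 f2" if "su_red f f1 f2" "dg f + dg f1 + dg f2 = d" "line f' f f1 f2" "dg f' \<le> dg f" for f f' f1 f2
            using that(1) unfolding su_red_def using su_red_closed(3)[OF cl] that(2-4) by (metis order_refl)
          have 2: "red f f1' f2" if "su_red f f1 f2" "dg f + dg f1 + dg f2 = d" "line f1' f1 f f2" "dg f1' \<le> dg f1" for f f1' f1 f2
            using that(1) unfolding su_red_def using su_red_closed(1)[OF cl] that(2-4) by (metis order_refl)
          have 3: "red f f1 f2'" if "su_red f f1 f2" "dg f + dg f1 + dg f2 = d" "line f2' f2 f f1" "dg f2' \<le> dg f2" for f f2' f1 f2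
            using that(1) unfolding su_red_def using su_red_closed(2)[OF cl] that(2-4) by (metis order_refl)
          have l': "line x' x z y" using l by (simp add: line_commute)
          from that show ?thesis
          proof (elim disjE)
            assume "su_red x y z"
            then show ?thesis using 1 l x' d_def by simp
          next
            assume "su_red x z y"
            then have "red x' z y" using 1 l' x' d_def by simp
            then show ?thesis by (rule red_perm)
          next
            assume "su_red y x z"
            then have "red y x' z" using 2 l x' d_def by simp
            then show ?thesis by (rule red_perm)
          next
            assume "su_red y z x"
            then have "red y z x'" using 3 l x' d_def by simp
            then show ?thesis by (rule red_perm)
          next
            assume "su_red z x y"
            then have "red z x' y" using 2 l' x' d_def by simp
            then show ?thesis by (rule red_perm)
          next
            assume "su_red z y x"
            then have "red z y x'" using 3 l' x' d_def by simp
            then show ?thesis by (rule red_perm)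
          qed
        qed
        show ?thesis using red_cases[OF r]
        proof (elim disjE)
          assume "dg x + dg y + dg z \<le> sig"
          then show ?thesis using keller_line[OF a l] x' by (intro red_base) auto
        next
          assume "el_red x y z"
          then obtain x0 where "red x0 y z" "line x x0 y z" "dg x0 < dg x" by (auto simp: el_red_def)
          then show ?thesis using closedD(1)[OF cl, of x0 y z x'] line_trans[OF l] d_def by simp
        next
          assume "el_red y x z"
          then obtain y0 where "red y0 x z" "line y y0 x z" "dg y0 < dg y" by (auto simp: el_red_def)
          then show ?thesis using el_red_closed[OF cl red_perm(2), of y0 x z y x'] l x' d_def by simp
        next
          assume "el_red z x y"
          then obtain z0 where z0: "red z0 x y" "line z z0 x y" "dg z0 < dg z" by (auto simp: el_red_def)
          then have "red x' z y"
            using el_red_closed[OF cl red_perm(2)[OF z0(1)] z0(2,3)] l x' d_def by (simp add: line_commute)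
          then show ?thesis by (rule red_perm)
        qed (use su in blast)+
      qed
    qed
  qed
  then show ?thesis unfolding closed_def by blast
qed

end

subsection \<open>Polynomial functions\<close>

definition mev :: "expo \<Rightarrow> c3 \<Rightarrow> complex" where
  "mev k v = fst v ^ fst k * fst (snd v) ^ fst (snd k) * snd (snd v) ^ snd (snd k)"

definition evalp :: "mpol \<Rightarrow> c3 \<Rightarrow> complex" where
  "evalp p v = (\<Sum>k\<in>supp p. coef p k * mev k v)"

definition td :: "expo \<Rightarrow> nat" where
  "td k = fst k + fst (snd k) + snd (snd k)"

lemma mev_add: "mev (k + l) v = mev k v * mev l v"
  by (simp add: mev_def power_add algebra_simps)

lemma mev_0 [simp]: "mev 0 v = 1"
  by (simp add: mev_def)

lemma td_add: "td (k + l) = td k + td l"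
  by (simp add: td_def)

lemma td_0 [simp]: "td 0 = 0"
  by (simp add: td_def)

lemma evalp_superset: "finite S \<Longrightarrow> supp p \<subseteq> S \<Longrightarrow> evalp p v = (\<Sum>k\<in>S. coef p k * mev k v)"
  unfolding evalp_def by (rule sum.mono_neutral_left) (auto simp: in_keys_iff)

lemma evalp_add: "evalp (p + q) v = evalp p v + evalp q v"
proof -
  let ?S = "supp p \<union> supp q"
  have "evalp (p + q) v = (\<Sum>k\<in>?S. coef (p + q) k * mev k v)"
    using keys_add[of p q] by (intro evalp_superset) auto
  moreover have "evalp p v = (\<Sum>k\<in>?S. coef p k * mev k v)" "evalp q v = (\<Sum>k\<in>?S. coef q k * mev k v)"
    by (auto intro!: evalp_superset)
  ultimately show ?thesis by (simp add: lookup_add sum.distrib algebra_simps)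
qed

lemma evalp_0 [simp]: "evalp 0 v = 0"
  by (simp add: evalp_def)

lemma evalp_mon: "evalp (mon k c) v = c * mev k v"
  by (cases "c = 0") (simp_all add: evalp_def supp_mon coef_mon)

lemma evalp_cst [simp]: "evalp (cst c) v = c"
  by (simp add: cst_def evalp_mon)

lemma evalp_mult: "evalp (p * q) v = evalp p v * evalp q v"
proof (induction p rule: mpol_induct)
  case (add k c p)
  have "evalp (mon k c * q) v = evalp (mon k c) v * evalp q v"
  proof (induction q rule: mpol_induct)
    case (add l d q)
    then show ?case by (simp add: distrib_left evalp_add mon_mult evalp_mon mev_add mult_ac)
  qed simp
  then show ?case using add by (simp add: distrib_right evalp_add)
qed simp

lemma evalp_sum: "evalp (sum f I) v = (\<Sum>i\<in>I. evalp (f i) v)"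
  by (induction I rule: infinite_finite_induct) (auto simp: evalp_add)

lemma evalp_power: "evalp (p ^ n) v = evalp p v ^ n"
  using evalp_cst[of 1 v] by (induction n) (auto simp: evalp_mult)

lemma evalp_uminus: "evalp (- p) v = - evalp p v"
  using evalp_add[of p "- p" v] by (simp add: minus_equation_iff[of "evalp p v"] eq_neg_iff_add_eq_0 add.commute)

lemma evalp_diff: "evalp (p - q) v = evalp p v - evalp q v"
  using evalp_add[of p "- q" v] evalp_uminus[of q v] by simp

lemma poly3_le_iff: "poly3_le d f \<longleftrightarrow> (\<exists>p. f = evalp p \<and> (\<forall>k\<in>supp p. td k \<le> d))"
proof
  assume "poly3_le d f"
  then obtain S c where S: "finite S" "\<forall>(i,j,k)\<in>S. i + j + k \<le> d"
    "f = (\<lambda>(x,y,z). \<Sum>(i,j,k)\<in>S. c (i,j,k) * x ^ i * y ^ j * z ^ k)"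
    unfolding poly3_le_def by blast
  define p where "p = (\<Sum>k\<in>S. mon k (c k))"
  have "f v = evalp p v" for v
    by (cases v) (simp add: S(3) p_def evalp_sum evalp_mon mev_def case_prod_unfold mult.assoc)
  moreover have "supp p \<subseteq> S"
  proof (rule subsetI)
    fix k assume "k \<in> supp p"
    then have "(\<Sum>l\<in>S. coef (mon l (c l)) k) \<noteq> 0" by (simp add: in_keys_iff p_def lookup_sum)
    then show "k \<in> S" using S(1) by (auto simp: coef_mon intro: ccontr)
  qed
  then have "\<forall>k\<in>supp p. td k \<le> d" using S(2) by (force simp: td_def)
  ultimately show "\<exists>p. f = evalp p \<and> (\<forall>k\<in>supp p. td k \<le> d)"
    by (intro exI[of _ p] conjI ext) auto
next
  assume "\<exists>p. f = evalp p \<and> (\<forall>k\<in>supp p. td k \<le> d)"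
  then obtain p where p: "f = evalp p" "\<forall>k\<in>supp p. td k \<le> d" by blast
  show "poly3_le d f" unfolding poly3_le_def
    using p(2) by (intro exI[of _ "supp p"] exI[of _ "coef p"])
      (auto simp: p(1) evalp_def fun_eq_iff mev_def td_def case_prod_unfold mult.assoc)
qed

lemma poly3_iff: "poly3 f \<longleftrightarrow> (\<exists>p. f = evalp p)"
proof
  show "poly3 f \<Longrightarrow> \<exists>p. f = evalp p" unfolding poly3_def poly3_le_iff by blast
  assume "\<exists>p. f = evalp p"
  then obtain p where p: "f = evalp p" by blast
  have "\<forall>k\<in>supp p. td k \<le> Max (td ` supp p)" by auto
  then show "poly3 f" unfolding poly3_def poly3_le_iff using p by blast
qed

definition sub :: "mpol \<Rightarrow> mpol \<Rightarrow> mpol \<Rightarrow> mpol \<Rightarrow> mpol" where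
  "sub p x y z = (\<Sum>k\<in>supp p. cst (coef p k) * (x ^ fst k * y ^ fst (snd k) * z ^ snd (snd k)))"

lemma evalp_sub: "evalp (sub p x y z) v = evalp p (evalp x v, evalp y v, evalp z v)"
  by (simp add: sub_def evalp_sum evalp_mult evalp_power evalp_def[of p] mev_def)

lemma sub_alg: "x \<in> alg S \<Longrightarrow> y \<in> alg S \<Longrightarrow> z \<in> alg S \<Longrightarrow> sub p x y z \<in> alg S"
  unfolding sub_def by (intro alg_sum alg_rules)

context weight
begin

text \<open>Along the curve with coordinates exp(w_i s), a monomial grows like exp of its weight
  times s. Dividing by the heaviest one isolates its coefficient as s tends to infinity.\<close>

lemma evalp_eq_0:
  assumes "\<And>v. evalp p v = 0"
  shows "p = 0"
proof (rule ccontr)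
  assume "p \<noteq> 0"
  then obtain a where a: "a \<in> supp p" "dg p = wt a" by (rule dg_top)
  define e where "e s = (complex_of_real (exp (wt_var 0 * s)), complex_of_real (exp (wt_var 1 * s)), complex_of_real (exp (wt_var 2 * s)))" for s :: real
  have mev: "mev k (e s) = complex_of_real (exp (wt k * s))" for k s
  proof (cases k)
    case (fields i j l)
    show ?thesis
      by (simp add: fields mev_def e_def wt_w exp_of_nat_mult[symmetric] exp_add[symmetric] algebra_simps
          flip: of_real_power of_real_mult)
  qed
  have lim: "((\<lambda>s. coef p k * complex_of_real (exp ((wt k - wt a) * s))) \<longlongrightarrow> (if k = a then coef p a else 0)) at_top"
    if "k \<in> supp p" for k
  proof (cases "k = a")
    case False
    have "wt k \<le> wt a" "wt k \<noteq> wt a" using dg_ge[OF that] a wt_inj False by (auto dest: injD)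
    then have "wt k - wt a < 0" by simp
    then have "filterlim (\<lambda>s. (wt k - wt a) * s) at_bot at_top"
      by (subst filterlim_tendsto_neg_mult_at_bot_iff[OF tendsto_const]) (auto simp: filterlim_ident)
    then have "((\<lambda>s. exp ((wt k - wt a) * s)) \<longlongrightarrow> 0) at_top"
      by (rule filterlim_compose[OF exp_at_bot])
    then have "((\<lambda>s. coef p k * complex_of_real (exp ((wt k - wt a) * s))) \<longlongrightarrow> coef p k * complex_of_real 0) at_top"
      by (intro tendsto_intros)
    then show ?thesis using False by simp
  qed simp
  have "((\<lambda>s. \<Sum>k\<in>supp p. coef p k * complex_of_real (exp ((wt k - wt a) * s))) \<longlongrightarrow> (\<Sum>k\<in>supp p. if k = a then coef p a else 0)) at_top"
    by (rule tendsto_sum) (rule lim)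
  moreover have "(\<Sum>k\<in>supp p. coef p k * complex_of_real (exp ((wt k - wt a) * s))) = 0" for s
  proof -
    have "(\<Sum>k\<in>supp p. coef p k * complex_of_real (exp ((wt k - wt a) * s)))
        = evalp p (e s) * complex_of_real (exp (- wt a * s))"
      unfolding evalp_def mev sum_distrib_right
      by (rule sum.cong) (simp_all add: algebra_simps exp_diff exp_minus divide_inverse)
    then show ?thesis using assms by simp
  qed
  moreover have "(\<Sum>k\<in>supp p. if k = a then coef p a else 0) = coef p a" using a by simp
  ultimately have "((\<lambda>s::real. 0) \<longlongrightarrow> coef p a) at_top" by simp
  then have "coef p a = 0" using tendsto_unique[OF _ tendsto_const] by (metis trivial_limit_at_top_linorder)
  then show False using a by (simp add: in_keys_iff)
qed

lemma evalp_inj: "evalp p = evalp q \<Longrightarrow> p = q"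
  using evalp_eq_0[of "p - q"] by (simp add: evalp_diff)

lemma deg3_evalp:
  assumes "p \<noteq> 0"
  shows "deg3 (evalp p) = Max (td ` supp p)"
proof -
  have "poly3_le d (evalp p) \<longleftrightarrow> Max (td ` supp p) \<le> d" for d
  proof -
    have "poly3_le d (evalp p) \<longleftrightarrow> (\<forall>k\<in>supp p. td k \<le> d)"
      unfolding poly3_le_iff using evalp_inj by blast
    then show ?thesis using assms by simp
  qed
  then show ?thesis unfolding deg3_def by (intro Least_equality) auto
qed

subsection \<open>Tame maps have reducible components\<close>

definition red_map :: "(c3 \<Rightarrow> c3) \<Rightarrow> bool" where
  "red_map H \<longleftrightarrow> (\<exists>x y z. red x y z \<and> H = (\<lambda>v. (evalp x v, evalp y v, evalp z v)))"

text \<open>Including the inverse makes the property stable under all closure rules of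
  \<open>tame3\<close>. Composition on the left acts on the components of H by moves.\<close>

definition preserves_red :: "(c3 \<Rightarrow> c3) \<Rightarrow> bool" where
  "preserves_red F \<longleftrightarrow> bij F \<and> (\<forall>H. red_map H \<longrightarrow> red_map (F \<circ> H) \<and> red_map (inv F \<circ> H))"

lemma preserves_redI:
  assumes "\<And>v. F (G v) = v" "\<And>v. G (F v) = v" "\<And>H. red_map H \<Longrightarrow> red_map (F \<circ> H)" "\<And>H. red_map H \<Longrightarrow> red_map (G \<circ> H)"
  shows "preserves_red F"
proof -
  have "bij F" by (rule bijI') (metis assms(2), metis assms(1))
  moreover have "inv F = G" using assms(1,2) by (intro inv_equality)
  ultimately show ?thesis using assms by (simp add: preserves_red_def)
qed

lemma preserves_red_comp: "preserves_red F \<Longrightarrow> preserves_red G \<Longrightarrow> preserves_red (F \<circ> G)"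
  unfolding preserves_red_def by (auto simp: bij_comp o_inv_distrib comp_assoc)

lemma preserves_red_inv: "preserves_red F \<Longrightarrow> preserves_red (inv F)"
  unfolding preserves_red_def by (auto simp: bij_imp_bij_inv inv_inv_eq)

lemma red_move:
  assumes "red x y z"
  shows "line x' x y z \<Longrightarrow> red x' y z" "line y' y x z \<Longrightarrow> red x y' z" "line z' z x y \<Longrightarrow> red x y z'"
  using closedD[OF red_closed[of "dg x + dg y + dg z + 1"] assms] by auto

section \<open>Gaussian elimination for affine automorphisms\<close>

definition elem_affine :: "complex \<Rightarrow> complex \<Rightarrow> complex \<Rightarrow> complex \<Rightarrow> c3 \<Rightarrow> c3" where
  "elem_affine c a b d v = (c * fst v + a * fst (snd v) + b * snd (snd v) + d, snd v)"

lemma elem_affine_inv: "c \<noteq> 0 \<Longrightarrow> elem_affine c a b d (elem_affine (inverse c) (- a / c) (- b / c) (- d / c) v) = v"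
  "c \<noteq> 0 \<Longrightarrow> elem_affine (inverse c) (- a / c) (- b / c) (- d / c) (elem_affine c a b d v) = v"
  by (auto simp: elem_affine_def prod_eq_iff field_simps)

lemma red_map_elem_affine:
  assumes "c \<noteq> 0" "red_map H"
  shows "red_map (elem_affine c a b d \<circ> H)"
proof -
  obtain x y z where H: "red x y z" "H = (\<lambda>v. (evalp x v, evalp y v, evalp z v))"
    using assms(2) unfolding red_map_def by blast
  let ?x = "cst c * x + (cst a * y + cst b * z + cst d)"
  have "red ?x y z"
    using assms(1) by (intro red_move(1)[OF H(1)] lineI[of c "cst a * y + cst b * z + cst d"])
      (auto intro!: alg_rules intro: alg_gen)
  moreover have "elem_affine c a b d \<circ> H = (\<lambda>v. (evalp ?x v, evalp y v, evalp z v))"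
    by (auto simp: H elem_affine_def evalp_add evalp_mult fun_eq_iff)
  ultimately show ?thesis unfolding red_map_def by blast
qed

lemma preserves_red_elem_affine:
  assumes "c \<noteq> 0"
  shows "preserves_red (elem_affine c a b d)"
  by (rule preserves_redI[OF elem_affine_inv[OF assms]]) (use assms in \<open>auto intro: red_map_elem_affine\<close>)

definition swap12 :: "c3 \<Rightarrow> c3" where "swap12 v = (fst (snd v), fst v, snd (snd v))"
definition swap23 :: "c3 \<Rightarrow> c3" where "swap23 v = (fst v, snd (snd v), fst (snd v))"

lemma preserves_red_swap: "preserves_red swap12" "preserves_red swap23"
proof -
  have "red_map (swap12 \<circ> H)" if T: "red_map H" for H
  proof -
    obtain x y z where H: "red x y z" "H = (\<lambda>v. (evalp x v, evalp y v, evalp z v))"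
      using T unfolding red_map_def by blast
    then have "red y x z" "swap12 \<circ> H = (\<lambda>v. (evalp y v, evalp x v, evalp z v))"
      using red_perm(2)[OF H(1)] by (auto simp: swap12_def fun_eq_iff)
    then show ?thesis unfolding red_map_def by blast
  qed
  then show "preserves_red swap12" by (intro preserves_redI[where G = swap12]) (auto simp: swap12_def)
  have "red_map (swap23 \<circ> H)" if T: "red_map H" for H
  proof -
    obtain x y z where H: "red x y z" "H = (\<lambda>v. (evalp x v, evalp y v, evalp z v))"
      using T unfolding red_map_def by blast
    then have "red x z y" "swap23 \<circ> H = (\<lambda>v. (evalp x v, evalp z v, evalp y v))"
      using red_perm(1)[OF H(1)] by (auto simp: swap23_def fun_eq_iff)
    then show ?thesis unfolding red_map_def by blast
  qed
  then show "preserves_red swap23" by (intro preserves_redI[where G = swap23]) (auto simp: swap23_def)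
qed

lemma swap_invol [simp]: "swap12 (swap12 v) = v" "swap23 (swap23 v) = v"
  by (simp_all add: swap12_def swap23_def)

text \<open>One elimination step. The remaining factor equals F composed with the inverse of E, so
  its bijectivity comes for free, and with it the pivot of the next step.\<close>

lemma preserves_red_factor:
  assumes "preserves_red E" "bij F" "\<And>v. F1 (E v) = F v" "bij F1 \<Longrightarrow> preserves_red F1"
  shows "preserves_red F"
proof -
  have E: "bij E" using assms(1) by (simp add: preserves_red_def)
  have "F1 \<circ> E = F" using assms(3) by auto
  then have "F1 = F \<circ> inv E" using E by (metis bij_is_surj comp_assoc comp_id surj_iff)
  then have "bij F1" using assms(2) E by (simp add: bij_comp bij_imp_bij_inv)
  then have "preserves_red (F1 \<circ> E)" using assms preserves_red_comp by blast
  then show ?thesis using \<open>F1 \<circ> E = F\<close> by simp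
qed

lemma preserves_red_lin3:
  assumes "bij F" "\<And>x y z. F (x, y, z) = (x, y, a * x + b * y + c * z + d)"
  shows "preserves_red F"
proof -
  have "c \<noteq> 0"
  proof
    assume "c = 0"
    then have "F (0, 0, 0) = F (0, 0, 1)" by (simp add: assms(2))
    then show False using assms(1) by (auto dest!: bij_is_inj injD)
  qed
  then have "preserves_red (swap23 \<circ> (swap12 \<circ> (elem_affine c a b d \<circ> (swap12 \<circ> swap23))))"
    by (intro preserves_red_comp preserves_red_swap preserves_red_elem_affine)
  moreover have "swap23 \<circ> (swap12 \<circ> (elem_affine c a b d \<circ> (swap12 \<circ> swap23))) = F"
    by (auto simp: fun_eq_iff assms(2) swap12_def swap23_def elem_affine_def)
  ultimately show ?thesis by simp
qed

lemma preserves_red_lin2':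
  assumes "bij F" "\<And>x y z. F (x, y, z) = (x, a * x + b * y + c * z + d, a' * x + b' * y + c' * z + d')" "b \<noteq> 0"
  shows "preserves_red F"
proof (rule preserves_red_factor[OF _ assms(1)])
  show "preserves_red (swap12 \<circ> (elem_affine b a c d \<circ> swap12))" by (intro preserves_red_comp preserves_red_swap preserves_red_elem_affine assms(3))
  let ?F1 = "\<lambda>v. (fst v, fst (snd v), (a' - b' / b * a) * fst v + b' / b * fst (snd v) + (c' - b' / b * c) * snd (snd v) + (d' - b' / b * d))"
  show "?F1 ((swap12 \<circ> (elem_affine b a c d \<circ> swap12)) v) = F v" for v
    using assms(3) by (cases v) (simp add: assms(2) swap12_def elem_affine_def field_simps)
  show "bij ?F1 \<Longrightarrow> preserves_red ?F1"
    by (rule preserves_red_lin3[where a = "a' - b' / b * a" and b = "b' / b" and c = "c' - b' / b * c" and d = "d' - b' / b * d"]) auto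
qed

lemma preserves_red_lin2:
  assumes "bij F" "\<And>x y z. F (x, y, z) = (x, a * x + b * y + c * z + d, a' * x + b' * y + c' * z + d')"
  shows "preserves_red F"
proof (cases "b = 0")
  case False
  then show ?thesis using preserves_red_lin2'[OF assms] by simp
next
  case True
  show ?thesis
  proof (cases "c = 0")
    case c: True
    \<comment> \<open>With first coordinate 0 the second output is always d, so without a pivot F
      misses this point.\<close>
    obtain x y z where "F (x, y, z) = (0, d + 1, 0)" using bij_is_surj[OF assms(1)] by (metis surjD prod_cases3)
    then show ?thesis using True c by (auto simp: assms(2))
  next
    case False
    show ?thesis
    proof (rule preserves_red_factor[OF preserves_red_swap(2) assms(1)])
      show "(F \<circ> swap23) (swap23 v) = F v" for v by simp
      show "bij (F \<circ> swap23) \<Longrightarrow> preserves_red (F \<circ> swap23)"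
        by (rule preserves_red_lin2'[where a = a and b = c and c = b and d = d and a' = a' and b' = c' and c' = b' and d' = d'])
          (use False in \<open>auto simp: swap23_def assms(2)\<close>)
    qed
  qed
qed

lemma preserves_red_lin1':
  assumes "bij F" "\<And>x y z. F (x, y, z) = (a * x + b * y + c * z + d, a1 * x + b1 * y + c1 * z + d1,
      a2 * x + b2 * y + c2 * z + d2)" "a \<noteq> 0"
  shows "preserves_red F"
proof (rule preserves_red_factor[OF preserves_red_elem_affine[OF assms(3)] assms(1)])
  let ?F1 = "\<lambda>v. (fst v, a1 / a * fst v + (b1 - a1 / a * b) * fst (snd v) + (c1 - a1 / a * c) * snd (snd v) + (d1 - a1 / a * d),
     a2 / a * fst v + (b2 - a2 / a * b) * fst (snd v) + (c2 - a2 / a * c) * snd (snd v) + (d2 - a2 / a * d))"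
  show "?F1 (elem_affine a b c d v) = F v" for v
    using assms(3) by (cases v) (simp add: assms(2) elem_affine_def field_simps)
  show "bij ?F1 \<Longrightarrow> preserves_red ?F1"
    by (rule preserves_red_lin2[where a = "a1 / a" and b = "b1 - a1 / a * b" and c = "c1 - a1 / a * c" and d = "d1 - a1 / a * d"
          and a' = "a2 / a" and b' = "b2 - a2 / a * b" and c' = "c2 - a2 / a * c" and d' = "d2 - a2 / a * d"]) auto
qed

lemma preserves_red_affine:
  assumes "affine3 F"
  shows "preserves_red F"
proof -
  obtain m :: "nat \<Rightarrow> nat \<Rightarrow> complex" and b :: "nat \<Rightarrow> complex" where bij: "bij F" and F0: "F = (\<lambda>(x,y,z). (m 0 0 * x + m 0 1 * y + m 0 2 * z + b 0,
                        m 1 0 * x + m 1 1 * y + m 1 2 * z + b 1,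
                        m 2 0 * x + m 2 1 * y + m 2 2 * z + b (2::nat)))"
    using assms unfolding affine3_def by blast
  have F: "F (x, y, z) = (m 0 0 * x + m 0 1 * y + m 0 2 * z + b 0, m 1 0 * x + m 1 1 * y + m 1 2 * z + b 1,
      m 2 0 * x + m 2 1 * y + m 2 2 * z + b 2)" for x y z by (simp add: F0)
  consider "m 0 0 \<noteq> 0" | "m 0 1 \<noteq> 0" | "m 0 2 \<noteq> 0" | "m 0 0 = 0" "m 0 1 = 0" "m 0 2 = 0" by blast
  then show ?thesis
  proof cases
    case 1
    then show ?thesis using preserves_red_lin1'[OF bij F] by simp
  next
    case 2
    show ?thesis
    proof (rule preserves_red_factor[OF preserves_red_swap(1) bij])
      show "(F \<circ> swap12) (swap12 v) = F v" for v by simp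
      show "bij (F \<circ> swap12) \<Longrightarrow> preserves_red (F \<circ> swap12)"
        by (rule preserves_red_lin1'[where a = "m 0 1" and b = "m 0 0" and c = "m 0 2" and d = "b 0"
              and ?a1.0 = "m 1 1" and ?b1.0 = "m 1 0" and ?c1.0 = "m 1 2" and ?d1.0 = "b 1"
              and ?a2.0 = "m 2 1" and ?b2.0 = "m 2 0" and ?c2.0 = "m 2 2" and ?d2.0 = "b 2"])
          (use 2 in \<open>auto simp: swap12_def F\<close>)
    qed
  next
    case 3
    have sw: "(swap23 \<circ> (swap12 \<circ> swap23)) v = (snd (snd v), fst (snd v), fst v)" for v
      by (simp add: swap12_def swap23_def)
    show ?thesis
    proof (rule preserves_red_factor[OF _ bij])
      show "preserves_red (swap23 \<circ> (swap12 \<circ> swap23))" by (intro preserves_red_comp preserves_red_swap)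
      show "(F \<circ> (swap23 \<circ> (swap12 \<circ> swap23))) ((swap23 \<circ> (swap12 \<circ> swap23)) v) = F v" for v by (simp add: swap23_def swap12_def)
      show "bij (F \<circ> (swap23 \<circ> (swap12 \<circ> swap23))) \<Longrightarrow> preserves_red (F \<circ> (swap23 \<circ> (swap12 \<circ> swap23)))"
        by (rule preserves_red_lin1'[where a = "m 0 2" and b = "m 0 1" and c = "m 0 0" and d = "b 0"
              and ?a1.0 = "m 1 2" and ?b1.0 = "m 1 1" and ?c1.0 = "m 1 0" and ?d1.0 = "b 1"
              and ?a2.0 = "m 2 2" and ?b2.0 = "m 2 1" and ?c2.0 = "m 2 0" and ?d2.0 = "b 2"])
          (use 3 in \<open>auto simp: swap12_def swap23_def F\<close>)
    qed
  next
    case 4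
    obtain x y z where "F (x, y, z) = (b 0 + 1, 0, 0)" using bij_is_surj[OF bij] by (metis surjD prod_cases3)
    then show ?thesis using 4 by (auto simp: F)
  qed
qed

lemma preserves_red_triangular:
  assumes "triangular3 F"
  shows "preserves_red F"
proof -
  obtain f2 f3 where f: "poly3 f2" "poly3 f3" "\<forall>x y z y' z'. f2 (x,y,z) = f2 (x,y',z')"
    "\<forall>x y z z'. f3 (x,y,z) = f3 (x,y,z')" and F0: "F = (\<lambda>(x,y,z). (x, y + f2 (x,y,z), z + f3 (x,y,z)))"
    using assms unfolding triangular3_def by blast
  obtain p2 p3 where p: "f2 = evalp p2" "f3 = evalp p3" using f(1,2) by (auto simp: poly3_iff)
  have e2: "f2 (x, y, z) = evalp p2 (x, 0, 0)" for x y z using f(3) p by metis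
  have e3: "f3 (x, y, z) = evalp p3 (x, y, 0)" for x y z using f(4) p by metis
  have F: "F (x, y, z) = (x, y + evalp p2 (x, 0, 0), z + evalp p3 (x, y, 0))" for x y z
    by (simp add: F0 e2 e3)
  define G where "G v = (fst v, fst (snd v) - evalp p2 (fst v, 0, 0),
     snd (snd v) - evalp p3 (fst v, fst (snd v) - evalp p2 (fst v, 0, 0), 0))" for v :: c3
  show ?thesis
  proof (rule preserves_redI)
    show "F (G v) = v" "G (F v) = v" for v by (cases v; simp add: F G_def)+
    fix H assume "red_map H"
    then obtain x y z where H: "red x y z" "H = (\<lambda>v. (evalp x v, evalp y v, evalp z v))"
      unfolding red_map_def by blast
    let ?P2 = "sub p2 x 0 0"
    have P2: "?P2 \<in> alg {x, u}" for u by (intro sub_alg) (auto intro: alg_gen)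
    show "red_map (F \<circ> H)"
    proof -
      let ?z = "cst 1 * z + sub p3 x y 0" and ?y = "cst 1 * y + ?P2"
      \<comment> \<open>z is moved first, while the second component is still the old y to which p3
        refers. For the inverse the order is reversed.\<close>
      have "red x y ?z" by (intro red_move(3)[OF H(1)] lineI[OF _ _ refl] sub_alg) (auto intro: alg_gen)
      then have "red x ?y ?z" by (rule red_move(2)) (intro lineI[OF _ _ refl] P2, simp)
      moreover have "F \<circ> H = (\<lambda>v. (evalp x v, evalp ?y v, evalp ?z v))"
        by (simp add: fun_eq_iff H(2) F evalp_add evalp_sub)
      ultimately show ?thesis unfolding red_map_def by blast
    qed
    show "red_map (G \<circ> H)"
    proof -
      let ?y = "cst 1 * y + - ?P2"
      let ?z = "cst 1 * z + - sub p3 x ?y 0"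
      have "red x ?y z"
        by (rule red_move(2)[OF H(1)]) (intro lineI[OF _ _ refl] alg_uminus P2, simp)
      then have "red x ?y ?z"
        by (rule red_move(3)) (intro lineI[OF _ _ refl] alg_uminus sub_alg, auto intro: alg_gen)
      moreover have "G \<circ> H = (\<lambda>v. (evalp x v, evalp ?y v, evalp ?z v))"
        by (simp add: fun_eq_iff H(2) G_def evalp_diff evalp_sub)
      ultimately show ?thesis unfolding red_map_def by blast
    qed
  qed
qed

lemma red_vars: "red (mon (1,0,0) 1) (mon (0,1,0) 1) (mon (0,0,1) 1)"
proof (rule red_base)
  have "jac (mon (1,0,0) 1) (mon (0,1,0) 1) (mon (0,0,1) 1) = mon (1,1,1) 1"
    by (simp add: jac_def wedge_form_def wedge_def der_mon exponent_def mon_mult)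
  then show "keller (mon (1,0,0) 1) (mon (0,1,0) 1) (mon (0,0,1) 1)"
    by (simp add: keller_def sig_def dg_mon)
  show "dg (mon (1,0,0) 1) + dg (mon (0,1,0) 1) + dg (mon (0,0,1) 1) \<le> sig"
    by (simp add: dg_mon sig_def wt_add[symmetric])
qed

theorem tame_red:
  assumes "F \<in> tame3"
  shows "red_map F"
proof -
  have "preserves_red F" using assms
  proof induction
    case (comp F G)
    then show ?case by (intro preserves_red_comp)
  qed (auto intro: preserves_red_affine preserves_red_triangular preserves_red_inv)
  moreover have "red_map id"
    unfolding red_map_def using red_vars
    by (intro exI[of _ "mon (1,0,0) 1"] exI[of _ "mon (0,1,0) 1"] exI[of _ "mon (0,0,1) 1"])
      (simp add: fun_eq_iff evalp_mon mev_def)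
  ultimately have "red_map (F \<circ> id)" unfolding preserves_red_def by blast
  then show ?thesis by simp
qed

end

subsection \<open>Total degrees\<close>

text \<open>The perturbation is below 1 up to total degree N, so there the weight order refines the
  order by total degree.\<close>

locale near_weight = weight +
  fixes N :: nat
  assumes wt_ge: "real (td k) \<le> wt k"
    and wt_lt: "td k \<le> N \<Longrightarrow> wt k < real (td k) + 1"
begin

lemma top_td:
  assumes "p \<noteq> 0" "deg3 (evalp p) \<le> N"
  obtains k where "dg p = wt k" "td k = deg3 (evalp p)"
proof -
  have M: "deg3 (evalp p) = Max (td ` supp p)" by (rule deg3_evalp[OF assms(1)])
  obtain k where k: "k \<in> supp p" "dg p = wt k" by (rule dg_top[OF assms(1)])
  have "Max (td ` supp p) \<in> td ` supp p" using assms(1) by (intro Max_in) auto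
  then obtain l where l: "l \<in> supp p" "td l = Max (td ` supp p)" by auto
  have kM: "td k \<le> Max (td ` supp p)" using k by simp
  have "real (td l) \<le> wt l" by (rule wt_ge)
  also have "\<dots> \<le> wt k" using dg_ge[OF l(1)] k by simp
  also have "\<dots> < real (td k) + 1" using kM assms(2) M by (intro wt_lt) simp
  finally have "td k = deg3 (evalp p)" using kM l M by linarith
  then show ?thesis using that k by blast
qed

text \<open>Injectivity of \<open>wt\<close> lifts the relation between weights to one between
  exponent vectors, and total degree is additive on these.\<close>

lemma wt_eq_td:
  assumes "real i * wt a + real j * wt b = real n * wt c"
  shows "i * td a + j * td b = n * td c"
proof -
  define sc where "sc n k = (n * fst k, n * fst (snd k), n * snd (snd k))" for n and k :: expo
  have "real n * wt k = wt (sc n k)" for n k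
    by (cases k) (simp add: sc_def wt_scale)
  then have "wt (sc i a + sc j b) = wt (sc n c)" using assms by (simp add: wt_add)
  then have "sc i a + sc j b = sc n c" using wt_inj by (rule injD[rotated])
  then have "td (sc i a + sc j b) = td (sc n c)" by simp
  moreover have "td (sc n k) = n * td k" for n k by (simp add: sc_def td_def algebra_simps)
  ultimately show ?thesis by (simp add: td_add)
qed

text \<open>If top terms cancel, coprimality of the total degrees identifies them with p and q, and
  the gap estimate becomes a Frobenius bound for \<open>td \<alpha>\<close>.\<close>

lemma el_red_td:
  assumes "el_red x y z" "keller x y z" "dg x = wt \<alpha>" "dg y = wt \<beta>" "dg z = wt \<gamma>" "td \<alpha> \<le> N"
    "coprime (td \<beta>) (td \<gamma>)" "2 \<le> td \<beta>" "2 \<le> td \<gamma>"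
  shows "(\<exists>i j. td \<alpha> = i * td \<beta> + j * td \<gamma>) \<or> td \<beta> * td \<gamma> + 2 \<le> td \<alpha> + td \<beta> + td \<gamma>"
proof -
  obtain x' c P where *: "c \<noteq> 0" "P \<in> alg {y, z}" "x = cst c * x' + P" "dg x' < dg x"
    using assms(1) by (auto simp: el_red_def line_def)
  have dP: "dg P = dg x" by (rule dg_move[OF *(1,4,3)])
  then have P0: "P \<noteq> 0" using keller_dg_pos[OF assms(2)] by auto
  have wedge: "wedge y z \<noteq> 0" using keller_wedge[OF assms(2)] by simp
  consider "no_cancel P y z" | p q \<eta> where "top_cancel p q \<eta> P y z" using cancel[OF *(2) wedge] by blast
  then show ?thesis
  proof cases
    case 1
    then obtain k where "vd y z k = dg x" using P0 unfolding no_cancel_def dP by blast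
    then have "real (fst k) * wt \<beta> + real (snd k) * wt \<gamma> = real 1 * wt \<alpha>" using assms by (simp add: vd_def)
    then have "td \<alpha> = fst k * td \<beta> + snd k * td \<gamma>" using wt_eq_td[of "fst k" \<beta> "snd k" \<gamma> 1 \<alpha>] by simp
    then show ?thesis by blast
  next
    case 2
    note C = 2[unfolded top_cancel_def]
    have "real q * wt \<beta> + real 0 * wt \<gamma> = real p * wt \<gamma>" using C assms by simp
    then have e: "q * td \<beta> = p * td \<gamma>" using wt_eq_td[of q \<beta> 0 \<gamma> p \<gamma>] by simp
    have "p dvd td \<beta>" using e C by (metis coprime_dvd_mult_right_iff dvd_triv_left)
    moreover have "td \<beta> dvd p" using e assms(7) by (metis coprime_dvd_mult_left_iff dvd_triv_right)
    ultimately have p: "p = td \<beta>" by (rule dvd_antisym)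
    then have q: "q = td \<gamma>" using e assms(8) by (simp add: mult.commute)
    \<comment> \<open>p eta is the weight of \<beta>, which is at least its total degree p.\<close>
    have "real p * 1 \<le> real p * \<eta>" using wt_ge[of \<beta>] C assms p by simp
    then have eta: "1 \<le> \<eta>" using p assms(8) by (simp add: mult_le_cancel_left_pos)
    have "(1::real) * 1 \<le> (real p - 1) * (real q - 1)" using p q assms by (intro mult_mono) auto
    then have "0 \<le> real p * real q - p - q" by (simp add: algebra_simps)
    then have "(real p * real q - p - q) * 1 \<le> (real p * real q - p - q) * \<eta>" using eta by (intro mult_left_mono) auto
    moreover have "2 \<le> br y z"
    proof -
      obtain k l where kl: "k \<noteq> 0" "l \<noteq> 0" "wt k + wt l \<le> br y z" by (rule br_lower[OF wedge])
      have t: "1 \<le> td k" if "k \<noteq> 0" for k using that by (cases k) (auto simp: td_def zero_prod_def)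
      show ?thesis using kl t[OF kl(1)] t[OF kl(2)] wt_ge[of k] wt_ge[of l] by linarith
    qed
    moreover have "(real p * real q - p - q) * \<eta> + br y z \<le> wt \<alpha>" using C dP assms(3) by simp
    ultimately have "real p * real q - p - q + 2 \<le> wt \<alpha>"
      unfolding mult_1_right by (meson add_mono order_trans)
    then have "real (p * q + 1) < real (td \<alpha> + p + q)" using wt_lt[OF assms(6)] by simp
    then have "p * q + 1 < td \<alpha> + p + q" by linarith
    then show ?thesis using p q by simp
  qed
qed

text \<open>The relations 2 \<open>dg g1\<close> = s \<open>dg f2\<close> and, in the exceptional
  case, 4 \<open>dg f\<close> = 3 \<open>dg f2\<close> pass to total degrees; since s is odd,
  \<open>td \<gamma>\<close> is even.\<close>

lemma su_red_td:
  assumes "su_red f f1 f2" "dg f = wt \<alpha>" "dg f1 = wt \<beta>" "dg f2 = wt \<gamma>"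
  shows "\<exists>m. 0 < m \<and> td \<gamma> = 2 * m \<and> ((\<exists>s\<ge>3. td \<beta> = s * m) \<or> 2 * td \<alpha> = 3 * m)"
proof -
  obtain \<delta> s g1 g2 g3 a b c where *: "red g3 g1 g2" "line f g3 g1 g2" "hub \<delta> s f g1 g2"
    "mates \<delta> s f g1 g2 f1 f2 a b c" using assms(1) unfolding su_red_def by blast
  have au: "keller f g1 g2" using red_keller[OF *(1)] *(2) keller_line by blast
  note F = su_red_facts[OF au *(3,4)]
  have h: "0 < \<delta>" "odd s" "3 \<le> s" "dg g1 = real s * \<delta>" using *(3) by (auto simp: hub_def)
  have "g1 \<noteq> 0" using keller_dg_pos[OF au] by auto
  then obtain l where l: "dg g1 = wt l" by (rule dg_top)
  have "real 2 * wt l + real 0 * wt l = real s * wt \<gamma>" using h l F(1) assms(4) by simp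
  then have e: "2 * td l = s * td \<gamma>" using wt_eq_td[of 2 l 0 l s \<gamma>] by simp
  then have "even (s * td \<gamma>)" by (metis dvd_triv_left)
  then have "even (td \<gamma>)" using h(2) by simp
  then obtain m where m: "td \<gamma> = 2 * m" by (rule evenE)
  have "wt \<gamma> > 0" using F(1) h assms(4) by simp
  then have "\<gamma> \<noteq> 0" by auto
  then have "0 < td \<gamma>" by (cases \<gamma>) (auto simp: td_def zero_prod_def)
  then have m0: "0 < m" using m by simp
  show ?thesis
  proof (cases "dg f1 = real s * \<delta>")
    case True
    then have "\<beta> = l" using l h assms(3) wt_inj by (auto dest: injD)
    then have "td \<beta> = s * m" using e m by simp
    then show ?thesis using m m0 h by blast
  next
    case False
    then have "dg f = 3/2 * \<delta>" using F(4) by blast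
    then have "real 4 * wt \<alpha> + real 0 * wt \<alpha> = real 3 * wt \<gamma>" using F(1) assms by simp
    then have "4 * td \<alpha> = 3 * td \<gamma>" using wt_eq_td[of 4 \<alpha> 0 \<alpha> 3 \<gamma>] by simp
    then show ?thesis using m m0 by auto
  qed
qed

end

text \<open>Take the least j for which n - j b is divisible by a. Then j is at most a - 1, and the
  bound leaves no room for j b to exceed n.\<close>

lemma frobenius_number:
  fixes a b n :: nat
  assumes "coprime a b" "0 < a" "0 < b" "a * b + 1 \<le> n + a + b"
  shows "\<exists>i j. n = i * a + j * b"
proof -
  obtain g x y where xy: "g dvd b" "g dvd a" "b * x = a * y + g"
    using bezout_add_strong_nat[of b a] assms(3) by blast
  have "g = 1" using assms(1) xy by (metis coprime_common_divisor_nat nat_dvd_1_iff_1)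
  define j where "j = (x * n) mod a"
  have "(j * b) mod a = (b * x * n) mod a" unfolding j_def by (metis mod_mult_left_eq mult.assoc mult.commute)
  also have "b * x * n = n + a * (y * n)" using xy(3) \<open>g = 1\<close> by (simp add: algebra_simps)
  finally have jm: "(j * b) mod a = n mod a" by simp
  have ja: "j < a" using assms(2) by (simp add: j_def)
  have "j * b \<le> n"
  proof (rule ccontr)
    assume "\<not> j * b \<le> n"
    then have lt: "n < j * b" by simp
    then have "a dvd j * b - n" using jm by (metis mod_eq_dvd_iff_nat less_imp_le)
    then have "a \<le> j * b - n" using lt by (intro dvd_imp_le) auto
    then have "n + a \<le> j * b" using lt by simp
    moreover have "j * b \<le> (a - 1) * b" using ja by (intro mult_right_mono) auto
    moreover have "(a - 1) * b + b = a * b" using assms(2) by (simp add: diff_mult_distrib)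
    ultimately show False using assms(4) by linarith
  qed
  then have "a dvd n - j * b" using jm by (metis mod_eq_dvd_iff_nat)
  then obtain i where "n - j * b = a * i" by (rule dvdE)
  then have "n = i * a + j * b" using \<open>j * b \<le> n\<close> by (simp add: mult.commute)
  then show ?thesis by blast
qed

context near_weight
begin

text \<open>If d3 were no combination, it would be coprime to both primes, so
  \<open>el_red_td\<close> applies in each position and each alternative fails.\<close>

lemma red_degrees:
  assumes r: "red x y z" and w: "dg x = wt \<alpha>" "dg y = wt \<beta>" "dg z = wt \<gamma>"
    and td: "td \<alpha> = p1" "td \<beta> = p2" "td \<gamma> = d3" and d: "d3 \<le> N"
    and p: "prime p1" "prime p2" "3 \<le> p1" "p1 < p2" "p2 \<le> d3"
  shows "\<exists>k1 k2. d3 = k1 * p1 + k2 * p2"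
proof (rule ccontr)
  assume no: "\<nexists>k1 k2. d3 = k1 * p1 + k2 * p2"
  have a: "keller x y z" by (rule red_keller[OF r])
  have n1: "\<not> p1 dvd d3" using no by (metis dvdE add_0_right mult.commute mult_0)
  have n2: "\<not> p2 dvd d3" using no by (metis dvdE add_0 mult.commute mult_0)
  have c12: "coprime p1 p2" using p primes_coprime[of p1 p2] by auto
  have c1: "coprime p1 d3" and c2: "coprime p2 d3"
    using p n1 n2 by (simp_all add: prime_imp_coprime)
  have odd: "odd p1" "odd p2" using p prime_odd_nat by auto
  have ge: "2 \<le> p1" "2 \<le> p2" "2 \<le> d3" "p1 \<le> N" "p2 \<le> N" using p d by auto
  have "\<not> el_red z x y"
  proof
    assume "el_red z x y"
    from el_red_td[OF this keller_perm(4)[OF a] w(3,1,2)]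
    have "(\<exists>i j. d3 = i * p1 + j * p2) \<or> p1 * p2 + 2 \<le> d3 + p1 + p2"
      using ge c12 d td by simp
    then have "p1 * p2 + 1 \<le> d3 + p1 + p2" using no by auto
    then show False using frobenius_number[OF c12] no ge by force
  qed
  moreover have "\<not> el_red y x z"
  proof
    assume "el_red y x z"
    from el_red_td[OF this keller_perm(1)[OF a] w(2,1,3)]
    have "(\<exists>i j. p2 = i * p1 + j * d3) \<or> p1 * d3 + 2 \<le> p2 + p1 + d3"
      using ge c1 d td by simp
    then show False
    proof (elim disjE exE)
      fix i j assume e: "p2 = i * p1 + j * d3"
      show False
      proof (cases "j = 0")
        case True
        then have "p1 dvd p2" using e by simp
        then show False using p primes_dvd_imp_eq by blast
      next
        case False
        then have "1 * d3 \<le> j * d3" by (intro mult_right_mono) auto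
        then have "d3 = 0 * p1 + 1 * p2" using e p by linarith
        then show False using no by blast
      qed
    next
      assume "p1 * d3 + 2 \<le> p2 + p1 + d3"
      moreover have "3 * d3 \<le> p1 * d3" using p by (intro mult_right_mono) auto
      ultimately show False using p by linarith
    qed
  qed
  moreover have "\<not> el_red x y z"
  proof
    assume "el_red x y z"
    from el_red_td[OF this a w]
    have "(\<exists>i j. p1 = i * p2 + j * d3) \<or> p2 * d3 + 2 \<le> p1 + p2 + d3"
      using ge c2 d td by simp
    then show False
    proof (elim disjE exE)
      fix i j assume e: "p1 = i * p2 + j * d3"
      have "i = 0" using e p by (cases i) auto
      moreover have "j = 0" using e p by (cases j) auto
      ultimately show False using e p by simp
    next
      assume "p2 * d3 + 2 \<le> p1 + p2 + d3"
      moreover have "3 * d3 \<le> p2 * d3" using p by (intro mult_right_mono) auto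
      ultimately show False using p by linarith
    qed
  qed
  \<comment> \<open>The last companion has even total degree, but p1 and p2 are odd; only z can
    stand there.\<close>
  moreover have "\<not> su_red y z x" "\<not> su_red z y x" "\<not> su_red x z y" "\<not> su_red z x y"
    using su_red_td w td odd by (metis dvd_triv_left)+
  moreover have "\<not> su_red f f1 z" if f: "{f, f1} = {x, y}" "dg f = wt a" "dg f1 = wt b" "{td a, td b} = {p1, p2}" for f f1 a b
  proof
    assume "su_red f f1 z"
    then obtain m where m: "0 < m" "d3 = 2 * m" "(\<exists>s\<ge>3. td b = s * m) \<or> 2 * td a = 3 * m"
      using su_red_td[OF _ f(2,3) w(3)] td by blast
    have ab: "td a = p1 \<or> td a = p2" "td b \<le> p2" using f(4) p by (auto simp: doubleton_eq_iff)
    from m(3) show False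
    proof (elim disjE exE conjE)
      fix s assume "3 \<le> s" "td b = s * m"
      then have "3 * m \<le> td b" by simp
      then show False using ab m p by linarith
    next
      assume e: "2 * td a = 3 * m"
      have "prime (td a)" using ab p by auto
      moreover have "3 dvd 2 * td a" using e by simp
      then have "3 dvd td a" by (simp add: coprime_dvd_mult_right_iff)
      \<comment> \<open>This would give m = 2 and d3 = 4, leaving 4 as the only value for the prime
        p2.\<close>
      ultimately have "td a = 3" using primes_dvd_imp_eq[of 3 "td a"] by simp
      then have "m = 2" using e by simp
      then have "p2 = 4" using ab m p \<open>td a = 3\<close> by linarith
      then show False using odd by simp
    qed
  qed
  then have "\<not> su_red x y z" "\<not> su_red y x z" using w td by blast+
  moreover have "\<not> dg x + dg y + dg z \<le> sig"
  proof -
    have "sig < 4" using wt_lt[of "(1,1,1)"] p d by (simp add: sig_def td_def)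
    moreover have "real p1 + real p2 + real d3 \<le> dg x + dg y + dg z"
      using wt_ge[of \<alpha>] wt_ge[of \<beta>] wt_ge[of \<gamma>] w td by simp
    ultimately show ?thesis using p by simp
  qed
  ultimately show False using red_cases[OF r] by blast
qed

lemma tame_degrees:
  assumes "F \<in> tame3" "mdeg3 F = (p1, p2, d3)" "d3 \<le> N"
    and p: "prime p1" "prime p2" "3 \<le> p1" "p1 < p2" "p2 \<le> d3"
  shows "\<exists>k1 k2. d3 = k1 * p1 + k2 * p2"
proof -
  obtain x y z where r: "red x y z" "F = (\<lambda>v. (evalp x v, evalp y v, evalp z v))"
    using tame_red[OF assms(1)] unfolding red_map_def by blast
  have deg: "deg3 (evalp x) = p1" "deg3 (evalp y) = p2" "deg3 (evalp z) = d3"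
    using assms(2) by (simp_all add: mdeg3_def r(2))
  have nz: "x \<noteq> 0" "y \<noteq> 0" "z \<noteq> 0" using keller_dg_pos[OF red_keller[OF r(1)]] by auto
  obtain \<alpha> where \<alpha>: "dg x = wt \<alpha>" "td \<alpha> = p1" using top_td[OF nz(1)] deg assms by auto
  obtain \<beta> where \<beta>: "dg y = wt \<beta>" "td \<beta> = p2" using top_td[OF nz(2)] deg assms by auto
  obtain \<gamma> where \<gamma>: "dg z = wt \<gamma>" "td \<gamma> = d3" using top_td[OF nz(3)] deg assms by auto
  show ?thesis by (rule red_degrees[OF r(1) \<alpha>(1) \<beta>(1) \<gamma>(1) \<alpha>(2) \<beta>(2) \<gamma>(2) assms(3) p])
qed

end

subsection \<open>Existence of suitable weights\<close>

text \<open>The multiplicity of p is even on the left and odd on the right unless both sides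
  vanish.\<close>

lemma square_prime_multiple:
  fixes X Y c p :: nat
  assumes "prime p" "\<not> p dvd c" "c * X\<^sup>2 = p * Y\<^sup>2"
  shows "Y = 0"
proof (rule ccontr)
  assume Y: "Y \<noteq> 0"
  have c: "c \<noteq> 0" using assms(2) by (metis dvd_0_right)
  have X: "X \<noteq> 0" using assms(3) Y prime_gt_0_nat[OF assms(1)] by (cases "X = 0") auto
  have pe: "prime_elem p" using assms(1) by simp
  have "multiplicity p (c * X\<^sup>2) = 2 * multiplicity p X"
    using pe c X assms(2) by (simp add: prime_elem_multiplicity_mult_distrib prime_elem_multiplicity_power_distrib not_dvd_imp_multiplicity_0)
  moreover have "multiplicity p (p * Y\<^sup>2) = Suc (2 * multiplicity p Y)"
    using pe Y prime_gt_0_nat[OF assms(1)] assms(1)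
    by (simp add: prime_elem_multiplicity_mult_distrib prime_elem_multiplicity_power_distrib prime_nat_iff)
  ultimately have "2 * multiplicity p X = Suc (2 * multiplicity p Y)" using assms(3) by simp
  then show False by presburger
qed

lemma square_prime_multiple_int:
  fixes X Y :: int and c p :: nat
  assumes "prime p" "\<not> p dvd c" "int c * X\<^sup>2 = int p * Y\<^sup>2"
  shows "X = 0 \<and> Y = 0"
proof -
  have "int (c * (nat \<bar>X\<bar>)\<^sup>2) = int (p * (nat \<bar>Y\<bar>)\<^sup>2)" using assms(3) by simp
  then have "c * (nat \<bar>X\<bar>)\<^sup>2 = p * (nat \<bar>Y\<bar>)\<^sup>2" by linarith
  then have "nat \<bar>Y\<bar> = 0" by (rule square_prime_multiple[OF assms(1,2)])
  then have "Y = 0" by simp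
  moreover have "c \<noteq> 0" using assms(2) by (metis dvd_0_right)
  ultimately show ?thesis using assms(3) by simp
qed

text \<open>Two squarings remove the roots; the resulting integer equations are excluded by parity
  of multiplicities.\<close>

lemma sqrt_independent:
  fixes A B C :: int
  assumes "real_of_int A + real_of_int B * sqrt 2 + real_of_int C * sqrt 3 = 0"
  shows "A = 0 \<and> B = 0 \<and> C = 0"
proof -
  have s2: "sqrt 2 * sqrt 2 = (2::real)" and s3: "sqrt 3 * sqrt 3 = (3::real)" by simp_all
  have "(A + B * sqrt 2)\<^sup>2 = (C * sqrt 3)\<^sup>2"
  proof -
    have "A + B * sqrt 2 = - (C * sqrt 3)" using assms by linarith
    then show ?thesis by simp
  qed
  then have "real_of_int A ^ 2 + 2 * real_of_int B ^ 2 - 3 * real_of_int C ^ 2 = - (2 * A * B) * sqrt 2"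
    by (simp add: power2_sum power_mult_distrib)
  then have "(real_of_int A ^ 2 + 2 * real_of_int B ^ 2 - 3 * real_of_int C ^ 2)\<^sup>2 = (2 * A * B)\<^sup>2 * (sqrt 2)\<^sup>2"
    by (simp add: power_mult_distrib)
  then have "real_of_int ((A\<^sup>2 + 2 * B\<^sup>2 - 3 * C\<^sup>2)\<^sup>2) = real_of_int (2 * (2 * A * B)\<^sup>2)" by simp
  then have "int 1 * (A\<^sup>2 + 2 * B\<^sup>2 - 3 * C\<^sup>2)\<^sup>2 = int 2 * (2 * A * B)\<^sup>2"
    unfolding of_int_eq_iff by simp
  then have z: "A\<^sup>2 + 2 * B\<^sup>2 - 3 * C\<^sup>2 = 0" "A * B = 0"
    using square_prime_multiple_int[of 2 1 "A\<^sup>2 + 2 * B\<^sup>2 - 3 * C\<^sup>2" "2 * A * B"] by simp_all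
  show ?thesis
  proof (cases "A = 0")
    case True
    then have "int 2 * B\<^sup>2 = int 3 * C\<^sup>2" using z by simp
    then show ?thesis using square_prime_multiple_int[of 3 2 B C] True by simp
  next
    case False
    then have "B = 0" using z by simp
    then have "int 1 * A\<^sup>2 = int 3 * C\<^sup>2" using z by simp
    then show ?thesis using square_prime_multiple_int[of 3 1 A C] \<open>B = 0\<close> by simp
  qed
qed

text \<open>The variables weigh 1, 1 + sqrt 2 / (2 N + 2) and 1 + sqrt 3 / (2 N + 2). Both roots are
  at most 2, so up to total degree N the perturbation is at most 2 N / (2 N + 2).\<close>

definition wtN :: "nat \<Rightarrow> expo \<Rightarrow> real" where
  "wtN N k = real (td k) + (real (fst (snd k)) * sqrt 2 + real (snd (snd k)) * sqrt 3) / (2 * real N + 2)"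

lemma near_weight_wtN: "near_weight (wtN N) N"
proof
  let ?M = "2 * real N + 2"
  have M: "0 < ?M" by simp
  show "wtN N (a + b) = wtN N a + wtN N b" for a b
    by (simp add: wtN_def td_add add_divide_distrib algebra_simps)
  show ge: "real (td k) \<le> wtN N k" for k by (simp add: wtN_def)
  show "0 < wtN N a" if "a \<noteq> 0" for a
  proof -
    have "0 < td a" using that by (cases a) (auto simp: td_def zero_prod_def)
    then show ?thesis using ge[of a] by linarith
  qed
  show "finite {a. wtN N a \<le> r}" for r
  proof (rule finite_subset)
    let ?m = "nat \<lfloor>r\<rfloor>"
    show "finite ({..?m} \<times> {..?m} \<times> {..?m})" by simp
    show "{a. wtN N a \<le> r} \<subseteq> {..?m} \<times> {..?m} \<times> {..?m}"
    proof
      fix a assume "a \<in> {a. wtN N a \<le> r}"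
      then have "real (td a) \<le> r" using ge[of a] by simp
      then have "td a \<le> ?m" by (simp add: le_nat_floor)
      then show "a \<in> {..?m} \<times> {..?m} \<times> {..?m}" by (cases a) (auto simp: td_def)
    qed
  qed
  show "inj (wtN N)"
  proof (rule injI)
    fix a b :: expo assume e: "wtN N a = wtN N b"
    obtain i j k where a: "a = (i, j, k)" by (cases a) auto
    obtain i' j' k' where b: "b = (i', j', k')" by (cases b) auto
    let ?A = "int (td a) - int (td b)"
    have wedge: "?M * wtN N k = ?M * real (td k) + (real (fst (snd k)) * sqrt 2 + real (snd (snd k)) * sqrt 3)" for k
      unfolding wtN_def distrib_left using M by simp
    have "?M * wtN N a = ?M * wtN N b" using e by simp
    then have "?M * real (td a) + (real j * sqrt 2 + real k * sqrt 3) = ?M * real (td b) + (real j' * sqrt 2 + real k' * sqrt 3)"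
      unfolding wedge by (simp add: a b)
    \<comment> \<open>Multiplying by the denominator gives an integer relation between 1, sqrt 2 and
      sqrt 3.\<close>
    then have "real_of_int (?A * (2 * int N + 2)) + real_of_int (int j - int j') * sqrt 2 + real_of_int (int k - int k') * sqrt 3 = 0"
      by (simp add: algebra_simps)
    then have "?A * (2 * int N + 2) = 0 \<and> int j - int j' = 0 \<and> int k - int k' = 0"
      by (rule sqrt_independent)
    then have "td a = td b" "j = j'" "k = k'" by auto
    then show "a = b" by (simp add: a b td_def)
  qed
  show "wtN N k < real (td k) + 1" if "td k \<le> N" for k
  proof -
    have s: "sqrt 2 \<le> 2" "sqrt 3 \<le> (2::real)" by (simp_all add: real_le_lsqrt)
    have "real (fst (snd k)) * sqrt 2 \<le> real (fst (snd k)) * 2" "real (snd (snd k)) * sqrt 3 \<le> real (snd (snd k)) * 2"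
      using s by (auto intro: mult_left_mono)
    moreover have "real (fst (snd k)) + real (snd (snd k)) \<le> N" using that by (simp add: td_def)
    ultimately have "real (fst (snd k)) * sqrt 2 + real (snd (snd k)) * sqrt 3 < ?M" by linarith
    then show ?thesis by (simp add: wtN_def)
  qed
qed

subsection \<open>Realisation\<close>

lemma poly3_le_add: "poly3_le d f \<Longrightarrow> poly3_le d g \<Longrightarrow> poly3_le d (\<lambda>v. f v + g v)"
proof -
  assume "poly3_le d f" "poly3_le d g"
  then obtain p q where *: "f = evalp p" "\<forall>k\<in>supp p. td k \<le> d" "g = evalp q" "\<forall>k\<in>supp q. td k \<le> d"
    by (auto simp: poly3_le_iff)
  have "\<forall>k\<in>supp (p + q). td k \<le> d" using * keys_add[of p q] by blast
  then show ?thesis unfolding poly3_le_iff using * by (intro exI[of _ "p + q"]) (auto simp: evalp_add)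
qed

lemma poly3_le_mult: "poly3_le d f \<Longrightarrow> poly3_le e g \<Longrightarrow> poly3_le (d + e) (\<lambda>v. f v * g v)"
proof -
  assume "poly3_le d f" "poly3_le e g"
  then obtain p q where *: "f = evalp p" "\<forall>k\<in>supp p. td k \<le> d" "g = evalp q" "\<forall>k\<in>supp q. td k \<le> e"
    by (auto simp: poly3_le_iff)
  have "\<forall>k\<in>supp (p * q). td k \<le> d + e"
  proof
    fix k assume "k \<in> supp (p * q)"
    then obtain a b where "k = a + b" "a \<in> supp p" "b \<in> supp q" using keys_mult[of p q] by blast
    then show "td k \<le> d + e" using * by (simp add: td_add add_mono)
  qed
  then show ?thesis unfolding poly3_le_iff using * by (intro exI[of _ "p * q"]) (auto simp: evalp_mult)
qed

lemma poly3_le_mon: "td k \<le> d \<Longrightarrow> poly3_le d (\<lambda>v. c * mev k v)"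
  unfolding poly3_le_iff by (intro exI[of _ "mon k c"]) (auto simp: evalp_mon supp_mon)

lemma poly3_le_power: "poly3_le d f \<Longrightarrow> poly3_le (n * d) (\<lambda>v. f v ^ n)"
proof (induction n)
  case 0
  then show ?case using poly3_le_mon[of 0 0 1] by simp
next
  case (Suc n)
  then show ?case using poly3_le_mult[of d f "n * d" "\<lambda>v. f v ^ n"] by simp
qed

text \<open>Restriction to the third axis cannot raise the degree, and there it is visibly n. The
  linear term c t allows for the summand z of the third component.\<close>

lemma deg3I:
  fixes f :: "c3 \<Rightarrow> complex"
  assumes "poly3_le n f" "\<And>t. f (0, 0, t) = t ^ n + c * t" "2 \<le> n"
  shows "deg3 f = n"
  unfolding deg3_def
proof (rule Least_equality)
  fix d assume "poly3_le d f"
  then obtain S a where S: "finite S" "\<forall>(i,j,k)\<in>S. i + j + k \<le> d"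
    "f = (\<lambda>(x,y,z). \<Sum>(i,j,k)\<in>S. a (i,j,k) * x ^ i * y ^ j * z ^ k)"
    unfolding poly3_le_def by blast
  \<comment> \<open>Restricted to the axis, only terms with i = j = 0 survive, because 0 ^ 0 =
    1.\<close>
  define q where "q = (\<Sum>(i,j,k)\<in>S. monom (a (i,j,k) * 0 ^ i * 0 ^ j) k)"
  have "poly q t = poly (monom 1 n + monom c 1) t" for t
    using assms(2)[of t] by (simp add: q_def S(3) poly_sum poly_monom case_prod_unfold)
  then have q: "q = monom 1 n + monom c 1" by (simp add: poly_eq_poly_eq_iff[symmetric] fun_eq_iff)
  have "coeff q n = 1" using assms(3) by (simp add: q)
  then have "n \<le> degree q" by (intro le_degree) simp
  also have "degree q \<le> d"
    unfolding q_def
  proof (rule degree_sum_le[OF S(1)])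
    fix l assume "l \<in> S"
    then have "snd (snd l) \<le> d" using S(2) by fastforce
    then show "degree (case l of (i, j, k) \<Rightarrow> monom (a (i, j, k) * 0 ^ i * 0 ^ j) k) \<le> d"
      by (auto simp: case_prod_unfold intro: order_trans[OF degree_monom_le])
  qed
  finally show "n \<le> d" .
qed (rule assms(1))

lemma realise:
  assumes "2 \<le> p1" "2 \<le> p2" "d3 = k1 * p1 + k2 * p2" "2 \<le> d3"
  shows "(p1, p2, d3) \<in> mdeg3 ` tame3"
proof -
  define s where "s = (\<lambda>(x, y, z). (z, y, x) :: c3)"
  have ss: "s (s v) = v" for v by (cases v) (simp add: s_def)
  have "bij s" by (rule o_bij[of s]) (auto simp: fun_eq_iff ss)
  moreover have "s = (\<lambda>(x,y,z). (m 0 0 * x + m 0 1 * y + m 0 2 * z + b 0,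
                        m 1 0 * x + m 1 1 * y + m 1 2 * z + b 1,
                        m 2 0 * x + m 2 1 * y + m 2 2 * z + b 2))"
    if "m = (\<lambda>i j. if i + j = 2 then 1 else 0)" "b = (\<lambda>i. 0)" for m :: "nat \<Rightarrow> nat \<Rightarrow> complex" and b :: "nat \<Rightarrow> complex"
    by (simp add: s_def that)
  ultimately have "affine3 s" unfolding affine3_def by blast
  then have s: "s \<in> tame3" by (rule tame3.affine)
  define T where "T = (\<lambda>(x,y,z). (x, y + x ^ p2, z + x ^ p1) :: c3)"
  have X: "poly3 (\<lambda>v. fst v ^ i * fst (snd v) ^ j)" for i j
    unfolding poly3_iff by (intro exI[of _ "mon (i,j,0) 1"]) (auto simp: evalp_mon mev_def)
  have "triangular3 T"
    unfolding triangular3_def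
    by (intro exI[of _ "\<lambda>v. fst v ^ p2"] exI[of _ "\<lambda>v. fst v ^ p1"])
      (use X[of p2 0] X[of p1 0] in \<open>auto simp: T_def\<close>)
  then have T: "T \<in> tame3" by (rule tame3.triangular)
  define U where "U = (\<lambda>(x,y,z). (x, y + 0, z + x ^ k1 * y ^ k2) :: c3)"
  have "triangular3 U"
    unfolding triangular3_def
    by (intro exI[of _ "\<lambda>v. 0"] exI[of _ "\<lambda>v. fst v ^ k1 * fst (snd v) ^ k2"])
      (use X[of k1 k2] in \<open>auto simp: U_def poly3_iff intro!: exI[of _ "0::mpol"]\<close>)
  then have U: "U \<in> tame3" by (rule tame3.triangular)
  \<comment> \<open>Conjugating \<open>T\<close> by the coordinate reversal \<open>s\<close> makes
    it add powers of z to x and y; \<open>U\<close> then uses the new first two components.\<close>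
  define F where "F = U \<circ> (s \<circ> (T \<circ> s))"
  have FT: "F \<in> tame3" unfolding F_def by (intro tame3.comp U s T)
  define f1 f2 f3 where "f1 v = fst v + snd (snd v) ^ p1" and "f2 v = fst (snd v) + snd (snd v) ^ p2"
    and "f3 v = snd (snd v) + f1 v ^ k1 * f2 v ^ k2" for v :: c3
  have Fv: "F v = (f1 v, f2 v, f3 v)" for v
    by (cases v) (simp add: F_def U_def T_def s_def f1_def f2_def f3_def)
  have m: "poly3_le (Suc 0) (\<lambda>v. fst v)" "poly3_le (Suc 0) (\<lambda>v. fst (snd v))" "poly3_le (Suc 0) (\<lambda>v. snd (snd v))"
    using poly3_le_mon[of "(1,0,0)" 1 1] poly3_le_mon[of "(0,1,0)" 1 1] poly3_le_mon[of "(0,0,1)" 1 1]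
    by (simp_all add: td_def mev_def)
  have up: "poly3_le d f" if "poly3_le e f" "e \<le> d" for d e f
  proof -
    have "\<exists>p. f = evalp p \<and> (\<forall>k\<in>supp p. td k \<le> e)" using that(1) by (simp add: poly3_le_iff)
    then obtain p where p: "f = evalp p" "\<forall>k\<in>supp p. td k \<le> e" by blast
    have "\<forall>k\<in>supp p. td k \<le> d" using p(2) that(2) by fastforce
    then show ?thesis unfolding poly3_le_iff using p(1) by blast
  qed
  have l1: "poly3_le p1 f1" unfolding f1_def
    using poly3_le_power[OF m(3), of p1] up[OF m(1), of p1] assms by (intro poly3_le_add) auto
  have l2: "poly3_le p2 f2" unfolding f2_def
    using poly3_le_power[OF m(3), of p2] up[OF m(2), of p2] assms by (intro poly3_le_add) auto
  have l3: "poly3_le d3 f3" unfolding f3_def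
    using poly3_le_mult[OF poly3_le_power[OF l1, of k1] poly3_le_power[OF l2, of k2]] up[OF m(3), of d3] assms
    by (intro poly3_le_add) auto
  have "deg3 f1 = p1" by (rule deg3I[OF l1, of 0]) (use assms in \<open>auto simp: f1_def\<close>)
  moreover have "deg3 f2 = p2" by (rule deg3I[OF l2, of 0]) (use assms in \<open>auto simp: f2_def\<close>)
  moreover have "deg3 f3 = d3"
  proof (rule deg3I[OF l3])
    show "f3 (0, 0, t) = t ^ d3 + 1 * t" for t
      by (simp add: f3_def f1_def f2_def assms(3) power_add power_mult mult.commute[of k1] mult.commute[of k2])
  qed (rule assms(4))
  moreover have "(\<lambda>v. fst (F v)) = f1" "(\<lambda>v. fst (snd (F v))) = f2" "(\<lambda>v. snd (snd (F v))) = f3"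
    by (auto simp: Fv)
  ultimately have "mdeg3 F = (p1, p2, d3)" by (simp add: mdeg3_def)
  then show ?thesis using FT by (metis imageI)
qed

theorem theorem1:
  fixes p1 p2 d3 :: nat
  assumes "prime p1" and "prime p2" and "3 \<le> p1" and "p1 < p2" and "p2 \<le> d3"
  shows "(p1, p2, d3) \<in> mdeg3 ` tame3 \<longleftrightarrow> (\<exists>k1 k2 :: nat. d3 = k1 * p1 + k2 * p2)"
proof
  assume "(p1, p2, d3) \<in> mdeg3 ` tame3"
  then obtain F where F: "F \<in> tame3" "mdeg3 F = (p1, p2, d3)" by (metis imageE)
  interpret near_weight "wtN d3" d3 by (rule near_weight_wtN)
  show "\<exists>k1 k2. d3 = k1 * p1 + k2 * p2"
    by (rule tame_degrees[OF F order_refl assms])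
next
  assume "\<exists>k1 k2. d3 = k1 * p1 + k2 * p2"
  then show "(p1, p2, d3) \<in> mdeg3 ` tame3" using realise assms by fastforce
qed

end
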